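(* Let $p(x,y)\in\mathbf{C}[x,y]$ be a polynomial of degree $n\ge 2$ without multiple factors and let $C\subset\mathbf{P}^2(\mathbf{C})$ be the projective closure of the curve $p(x,y)=0$. Assume that $C$ intersects the line at infinity at only one point $Q\neq(0:1:0)$. Put $D_\infty(x,t):=\mathrm{Disc}_y(p(x,y)-t)$ and let $L$ be the affine transformation $L(i,k)=(n(n-1)-i-nk,\,k)$. Then the curve $C$ is analytically irreducible at $Q$ if and only if $L(\mathcal{P}_\infty(D_\infty))$ is the Newton polygon at zero of a Merle type diagram.
   Context: Homogeneous coordinates on $\mathbf{P}^2(\mathbf{C})$ are $(x:y:z)$, the affine plane being $z=1$ and the line at infinity $z=0$; $C$ has homogeneous equation $P(x,y,z)=z^np(x/z,y/z)=0$. "Analytically irreducible at $Q$" means that a local equation of $C$ at $Q$ is irreducible in the ring of convergent power series at $Q$. $\mathrm{Disc}_y$ is the classical discriminant of a polynomial in the variable $y$. Write $\mathbf{R}_+=\{x\in\mathbf{R}:x\ge0\}$. For a non-zero power series (or polynomial) $g=\sum a_{i,j}x^iy^j$, $\mathrm{supp}\, g=\{(i,j):a_{i,j}\neq0\}$ and the Newton diagram is $\Delta_g=$ convex hull of $\mathrm{supp}\, g+\mathbf{R}_+^2$. Newton diagrams are added by Minkowski sum; for positive integers $L,M$ put $T(L,M)=\Delta_{x^L+y^M}$. Newton polygons: the Newton polygon at zero of a Newton diagram $\Delta$ intersecting both coordinate axes is the boundary of $\Delta$ relative to $\mathbf{R}_+^2$. For a polynomial $g(x,y)$ of positive degree with $g(x,0)\ne0$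 and $g(0,y)\neq0$, the Newton polygon of $g$ at infinity $\mathcal{P}_\infty(g)$ is the boundary relative to $\mathbf{R}_+^2$ of $\Delta_\infty(g)=$ convex hull of $\mathrm{supp}\, g\cup\{(0,0)\}$. For $D_\infty(x,t)$ the point $(i,k)$ corresponds to the monomial $x^it^k$. The map $L$ (defined on $\mathbf{Z}^2$) is applied to subsets of $\mathbf{R}^2$ by the same formula. Merle type diagrams: let $\bar b_0,\dots,\bar b_h$ ($h\ge1$) be positive integers and set $n_k=\gcd(\bar b_0,\dots,\bar b_{k-1})/\gcd(\bar b_0,\dots,\bar b_k)$ for $k\in\{1,\dots,h\}$. Suppose (Z$_1$) $n_k>1$ for all $k\in\{1,\dots,h\}$ and $n_1\cdots n_h=\bar b_0$; (Z$_2$) $n_k\bar b_k<\bar b_{k+1}$ for $k\in\{1,\dots,h-1\}$. Then put $$\mathcal{M}(\bar b_0,\dots,\bar b_h)=\sum_{k=1}^h T\big((n_k-1)\bar b_k,\ (n_k-1)n_1\cdots n_{k-1}\big).$$ A Merle type diagram is a Newton diagram of the form $\mathcal{M}(\bar b_0,\dots,\bar b_h)$ for some sequence satisfying (Z$_1$) and (Z$_2$). *)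

theory Defs
  imports
    "HOL-Analysis.Analysis"
    "HOL-Library.Set_Algebras"
    "HOL-Computational_Algebra.Computational_Algebra"
    "Subresultants.Resultant_Prelim"
begin

section \<open>Polynomials in two variables\<close>

text \<open>
  A polynomial in \<open>C[x,y]\<close> is an element of \<open>C[x][y]\<close>, the type \<^typ>\<open>complex poly poly\<close>: the outer
  variable is the second one, so \<open>x^i y^j\<close> has coefficient \<open>coeff (coeff g j) i\<close>.
\<close>

definition supp2 :: "complex poly poly \<Rightarrow> (nat \<times> nat) set" where
  "supp2 g = {(i, j). coeff (coeff g j) i \<noteq> 0}"

text \<open>The inserted \<open>0\<close> only fixes the total degree of the zero polynomial.\<close>

definition total_degree :: "complex poly poly \<Rightarrow> nat" where
  "total_degree g = Max (insert 0 ((\<lambda>(i, j). i + j) ` supp2 g))"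

lemma finite_supp2 [simp]: "finite (supp2 g)"
proof (rule finite_subset)
  show "supp2 g \<subseteq> (\<Union>j\<le>degree g. (\<lambda>i. (i, j)) ` {..degree (coeff g j)})"
  proof
    fix z assume "z \<in> supp2 g"
    then obtain i j where z: "z = (i, j)" "coeff (coeff g j) i \<noteq> 0"
      by (auto simp: supp2_def)
    then have "coeff g j \<noteq> 0" by auto
    with z show "z \<in> (\<Union>j\<le>degree g. (\<lambda>i. (i, j)) ` {..degree (coeff g j)})"
      using le_degree[of g j] le_degree[of "coeff g j" i] by auto
  qed
qed auto

text \<open>
  The value at \<open>(X, Y, Z)\<close> of the homogenization \<open>P(x,y,z) = z^n p(x/z, y/z)\<close>, \<open>n\<close> being the degree
  of \<open>p\<close>, in a commutative ring into which the complex numbers are mapped by \<open>\<kappa>\<close>.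
\<close>

definition homog_eval ::
  "(complex \<Rightarrow> 'a::comm_ring_1) \<Rightarrow> complex poly poly \<Rightarrow> 'a \<Rightarrow> 'a \<Rightarrow> 'a \<Rightarrow> 'a" where
  "homog_eval \<kappa> p X Y Z =
     (\<Sum>(i, j)\<in>supp2 p. \<kappa> (coeff (coeff p j) i) * X ^ i * Y ^ j * Z ^ (total_degree p - (i + j)))"


section \<open>The projective plane\<close>

text \<open>A point of the plane is identified with the set of its homogeneous coordinate triples.\<close>

type_synonym proj_point = "(complex \<times> complex \<times> complex) set"

definition hpoint :: "complex \<Rightarrow> complex \<Rightarrow> complex \<Rightarrow> proj_point" where
  "hpoint x y z = {(c * x, c * y, c * z) | c. c \<noteq> 0}"

definition proj_closure :: "complex poly poly \<Rightarrow> proj_point set" where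
  "proj_closure p =
     {hpoint x y z | x y z. (x, y, z) \<noteq> (0, 0, 0) \<and> homog_eval (\<lambda>c. c) p x y z = 0}"

definition line_at_infinity :: "proj_point set" where
  "line_at_infinity = {hpoint x y 0 | x y. (x, y) \<noteq> (0, 0)}"


section \<open>Convergent power series in two variables\<close>

text \<open>
  Formal power series in \<open>u, v\<close> are double series with outer variable \<open>v\<close>, as for polynomials.
\<close>

definition convergent2 :: "complex fps fps \<Rightarrow> bool" where
  "convergent2 f \<longleftrightarrow>
     (\<exists>r>0. (\<lambda>(i, j). norm (fps_nth (fps_nth f j) i) * r ^ (i + j)) summable_on UNIV)"

lemma convergent2_iff_bound:
  "convergent2 f \<longleftrightarrow> (\<exists>C\<ge>0. \<exists>R>0. \<forall>i j. norm (fps_nth (fps_nth f j) i) \<le> C * R ^ (i + j))"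
proof
  assume "convergent2 f"
  then obtain r where r: "r > 0" and
    s: "(\<lambda>(i, j). norm (fps_nth (fps_nth f j) i) * r ^ (i + j)) summable_on UNIV"
    by (auto simp: convergent2_def)
  let ?g = "\<lambda>(i, j). norm (fps_nth (fps_nth f j) i) * r ^ (i + j)"
  define C where "C = infsum ?g UNIV"
  have C0: "C \<ge> 0" unfolding C_def using r by (intro infsum_nonneg) auto
  have b: "norm (fps_nth (fps_nth f j) i) \<le> C * (1 / r) ^ (i + j)" for i j
  proof -
    have "sum ?g {(i, j)} \<le> C"
      unfolding C_def using r by (intro finite_sum_le_infsum[OF s]) auto
    then have "norm (fps_nth (fps_nth f j) i) * r ^ (i + j) \<le> C"
      by simp
    then show ?thesis using r by (simp add: field_simps)
  qed
  show "\<exists>C\<ge>0. \<exists>R>0. \<forall>i j. norm (fps_nth (fps_nth f j) i) \<le> C * R ^ (i + j)"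
    using C0 r b by (intro exI[of _ C] conjI exI[of _ "1 / r"]) auto
next
  assume "\<exists>C\<ge>0. \<exists>R>0. \<forall>i j. norm (fps_nth (fps_nth f j) i) \<le> C * R ^ (i + j)"
  then obtain C R where C: "C \<ge> 0" and R: "R > 0"
    and b: "\<And>i j. norm (fps_nth (fps_nth f j) i) \<le> C * R ^ (i + j)" by blast
  define r where "r = 1 / (2 * R)"
  have r: "r > 0" using R by (simp add: r_def)
  have g: "(\<lambda>i::nat. (1 / 2 :: real) ^ i) summable_on UNIV"
    by (rule summable_nonneg_imp_summable_on) (auto intro: summable_geometric)
  have "(\<lambda>(i, j). C * ((1 / 2 :: real) ^ i * (1 / 2) ^ j)) summable_on (UNIV \<times> UNIV)"
    using C g by (intro summable_on_SigmaI[where g = "\<lambda>i. C * ((1 / 2) ^ i * infsum (\<lambda>j. (1 / 2) ^ j) UNIV)"])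
      (auto intro!: has_sum_cmult_right has_sum_infsum summable_on_cmult_right summable_on_cmult_left)
  then have s: "(\<lambda>(i, j). C * ((1 / 2 :: real) ^ i * (1 / 2) ^ j)) summable_on UNIV" by simp
  have "(\<lambda>(i, j). norm (fps_nth (fps_nth f j) i) * r ^ (i + j)) summable_on UNIV"
  proof (rule summable_on_comparison_test[OF s]; clarify)
    fix i j
    have "norm (fps_nth (fps_nth f j) i) * r ^ (i + j) \<le> C * R ^ (i + j) * r ^ (i + j)"
      using b r by (intro mult_right_mono) auto
    also have "\<dots> = C * ((R * r) ^ (i + j))" by (simp add: power_mult_distrib)
    also have "R * r = 1 / 2" using R by (simp add: r_def)
    finally show "norm (fps_nth (fps_nth f j) i) * r ^ (i + j) \<le> C * ((1 / 2) ^ i * (1 / 2) ^ j)"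
      by (simp add: power_add)
  qed (use r in auto)
  with r show "convergent2 f" by (auto simp: convergent2_def)
qed

lemma convergent2I:
  assumes "C \<ge> 0" "R > 0" "\<And>i j. norm (fps_nth (fps_nth f j) i) \<le> C * R ^ (i + j)"
  shows "convergent2 f"
  using assms convergent2_iff_bound by blast

lemma convergent2_const [simp]: "convergent2 (fps_const (fps_const c))"
  by (rule convergent2I[of "norm c" 1]) auto

lemma convergent2_fst [simp]: "convergent2 (fps_const fps_X)"
  by (rule convergent2I[of 1 1]) (auto simp: fps_X_def)

lemma convergent2_snd [simp]: "convergent2 fps_X"
  by (rule convergent2I[of 1 1]) (auto simp: fps_X_def)

lemma convergent2_uminus [simp]: "convergent2 f \<Longrightarrow> convergent2 (- f)"
  by (simp add: convergent2_iff_bound)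

lemma convergent2_two_bounds:
  assumes "convergent2 f" "convergent2 g"
  obtains C R where "C \<ge> 0" "R > 0"
    "\<And>i j. norm (fps_nth (fps_nth f j) i) \<le> C * R ^ (i + j)"
    "\<And>i j. norm (fps_nth (fps_nth g j) i) \<le> C * R ^ (i + j)"
proof -
  obtain C R where f: "C \<ge> 0" "R > 0" "\<And>i j. norm (fps_nth (fps_nth f j) i) \<le> C * R ^ (i + j)"
    using assms convergent2_iff_bound by blast
  obtain D S where g: "D \<ge> 0" "S > 0" "\<And>i j. norm (fps_nth (fps_nth g j) i) \<le> D * S ^ (i + j)"
    using assms convergent2_iff_bound by blast
  have "norm (fps_nth (fps_nth f j) i) \<le> max C D * max R S ^ (i + j)" for i j
    by (rule order_trans[OF f(3)]) (use f g in \<open>auto intro!: mult_mono power_mono\<close>)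
  moreover have "norm (fps_nth (fps_nth g j) i) \<le> max C D * max R S ^ (i + j)" for i j
    by (rule order_trans[OF g(3)]) (use f g in \<open>auto intro!: mult_mono power_mono\<close>)
  ultimately show thesis using f g that[of "max C D" "max R S"] by auto
qed

lemma convergent2_add [simp]:
  assumes "convergent2 f" "convergent2 g"
  shows "convergent2 (f + g)"
proof -
  obtain C R where b: "C \<ge> 0" "R > 0"
    "\<And>i j. norm (fps_nth (fps_nth f j) i) \<le> C * R ^ (i + j)"
    "\<And>i j. norm (fps_nth (fps_nth g j) i) \<le> C * R ^ (i + j)"
    using convergent2_two_bounds[OF assms] by blast
  show ?thesis
  proof (rule convergent2I[of "2 * C" R])
    fix i j
    show "norm (fps_nth (fps_nth (f + g) j) i) \<le> 2 * C * R ^ (i + j)"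
      using norm_triangle_mono[OF b(3)[of j i] b(4)[of j i]] by simp
  qed (use b in auto)
qed

lemma convergent2_diff [simp]: "convergent2 f \<Longrightarrow> convergent2 g \<Longrightarrow> convergent2 (f - g)"
  using convergent2_add[of f "- g"] by simp

lemma convergent2_mult [simp]:
  assumes "convergent2 f" "convergent2 g"
  shows "convergent2 (f * g)"
proof -
  obtain C R where b: "C \<ge> 0" "R > 0"
    "\<And>i j. norm (fps_nth (fps_nth f j) i) \<le> C * R ^ (i + j)"
    "\<And>i j. norm (fps_nth (fps_nth g j) i) \<le> C * R ^ (i + j)"
    using convergent2_two_bounds[OF assms] by blast
  have two: "real (n + 1) \<le> 2 ^ n" for n
    by (induction n) auto
  show ?thesis
  proof (rule convergent2I[of "C * C" "2 * R"])
    fix i j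
    have "norm (fps_nth (fps_nth (f * g) j) i) \<le>
       (\<Sum>l=0..j. \<Sum>k=0..i. norm (fps_nth (fps_nth f l) k * fps_nth (fps_nth g (j - l)) (i - k)))"
      by (auto simp: fps_mult_nth fps_sum_nth intro!: order_trans[OF norm_sum] sum_mono)
    also have "\<dots> \<le> (\<Sum>l=0..j. \<Sum>k=0..i. C * C * R ^ (i + j))"
    proof (intro sum_mono)
      fix l k assume lk: "l \<in> {0..j}" "k \<in> {0..i}"
      have "norm (fps_nth (fps_nth f l) k) * norm (fps_nth (fps_nth g (j - l)) (i - k))
          \<le> (C * R ^ (k + l)) * (C * R ^ (i - k + (j - l)))"
        using b by (intro mult_mono) auto
      also have "\<dots> = C * C * R ^ ((k + l) + (i - k + (j - l)))"
        by (simp add: power_add)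
      also have "(k + l) + (i - k + (j - l)) = i + j" using lk by auto
      finally show "norm (fps_nth (fps_nth f l) k * fps_nth (fps_nth g (j - l)) (i - k))
          \<le> C * C * R ^ (i + j)" by (simp add: norm_mult)
    qed
    also have "\<dots> = (real (j + 1) * real (i + 1)) * (C * C * R ^ (i + j))"
      by simp
    also have "\<dots> \<le> (2 ^ j * 2 ^ i) * (C * C * R ^ (i + j))"
      using b two by (intro mult_right_mono mult_mono) auto
    also have "\<dots> = C * C * (2 * R) ^ (i + j)"
      by (simp add: power_add power_mult_distrib)
    finally show "norm (fps_nth (fps_nth (f * g) j) i) \<le> C * C * (2 * R) ^ (i + j)" .
  qed (use b in auto)
qed

typedef conv_series = "{f. convergent2 f}"
  by (rule exI[of _ fps_X]) simp

setup_lifting type_definition_conv_series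

instantiation conv_series :: idom
begin

lift_definition zero_conv_series :: conv_series is 0
  by (rule convergent2I[of 0 1]) auto

lift_definition one_conv_series :: conv_series is 1
  by (rule convergent2I[of 1 1]) auto

lift_definition plus_conv_series :: "conv_series \<Rightarrow> conv_series \<Rightarrow> conv_series" is "(+)"
  by simp

lift_definition minus_conv_series :: "conv_series \<Rightarrow> conv_series \<Rightarrow> conv_series" is "(-)"
  by simp

lift_definition uminus_conv_series :: "conv_series \<Rightarrow> conv_series" is uminus
  by simp

lift_definition times_conv_series :: "conv_series \<Rightarrow> conv_series \<Rightarrow> conv_series" is "(*)"
  by simp

instance
proof
  fix a b c :: conv_series
  show "a * b * c = a * (b * c)" by transfer (rule mult.assoc)
  show "a * b = b * a" by transfer (rule mult.commute)
  show "1 * a = a" by transfer simp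
  show "a + b + c = a + (b + c)" by transfer (rule add.assoc)
  show "a + b = b + a" by transfer (rule add.commute)
  show "0 + a = a" by transfer simp
  show "- a + a = 0" by transfer simp
  show "a - b = a + - b" by transfer simp
  show "(a + b) * c = a * c + b * c" by transfer (rule distrib_right)
  show "a * (b + c) = a * b + a * c" by transfer (rule distrib_left)
  show "0 * a = 0" by transfer simp
  show "a * 0 = 0" by transfer simp
  show "(0 :: conv_series) \<noteq> 1" by transfer simp
  show "a \<noteq> 0 \<Longrightarrow> b \<noteq> 0 \<Longrightarrow> a * b \<noteq> 0" by transfer simp
qed

end

lift_definition cs_const :: "complex \<Rightarrow> conv_series" is "\<lambda>c. fps_const (fps_const c)"
  by simp

lift_definition cs_U :: conv_series is "fps_const fps_X"
  by simp

lift_definition cs_V :: conv_series is fps_X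
  by simp


section \<open>Analytic irreducibility\<close>

text \<open>
  The local equation at \<open>(a : b : c)\<close> is the Taylor expansion of the homogenization in the first of
  the standard charts \<open>x = 1\<close>, \<open>y = 1\<close>, \<open>z = 1\<close> that contains the point, in affine coordinates
  \<open>u, v\<close> centred at the point.
\<close>

definition local_equation :: "complex poly poly \<Rightarrow> complex \<times> complex \<times> complex \<Rightarrow> conv_series" where
  "local_equation p = (\<lambda>(a, b, c).
     if a \<noteq> 0 then homog_eval cs_const p 1 (cs_const (b / a) + cs_U) (cs_const (c / a) + cs_V)
     else if b \<noteq> 0 then homog_eval cs_const p (cs_const (a / b) + cs_U) 1 (cs_const (c / b) + cs_V)
     else homog_eval cs_const p (cs_const (a / c) + cs_U) (cs_const (b / c) + cs_V) 1)"

lemma local_equation_scale: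
  "k \<noteq> 0 \<Longrightarrow> local_equation p (k * a, k * b, k * c) = local_equation p (a, b, c)"
  by (simp add: local_equation_def)

definition analytically_irreducible_at :: "complex poly poly \<Rightarrow> proj_point \<Rightarrow> bool" where
  "analytically_irreducible_at p Q \<longleftrightarrow> (\<exists>v\<in>Q. irreducible (local_equation p v))"


section \<open>Discriminants\<close>

text \<open>
  \<open>Disc f = (-1)^(d(d-1)/2) Res(f, f') / a\<close> for \<open>f\<close> of degree \<open>d\<close> with leading coefficient \<open>a\<close>. The
  division is exact.
\<close>

definition discriminant :: "'a::{idom_divide, ring_char_0} poly \<Rightarrow> 'a" where
  "discriminant f =
     (- 1) ^ (degree f * (degree f - 1) div 2) * (resultant f (pderiv f) div lead_coeff f)"

lemma lead_coeff_dvd_resultant_pderiv: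
  fixes f :: "'a::{idom_divide, ring_char_0} poly"
  assumes "degree f > 0"
  shows "lead_coeff f dvd resultant f (pderiv f)"
proof -
  let ?A = "sylvester_mat f (pderiv f)" and ?m = "degree f + degree (pderiv f)"
  have A: "?A \<in> carrier_mat ?m ?m"
    by (rule carrier_matI) (simp_all only: sylvester_mat_dim)
  have "resultant f (pderiv f) = (\<Sum>i<?m. ?A $$ (i, 0) * cofactor ?A i 0)"
    unfolding resultant_def by (rule laplace_expansion_column[OF A]) (use assms in linarith)
  also have "lead_coeff f dvd \<dots>"
  proof (intro dvd_sum dvd_mult2)
    fix i assume i: "i \<in> {..<?m}"
    have "?A $$ (i, 0) = (if i < degree (pderiv f)
        then if i \<le> 0 \<and> 0 - i \<le> degree f then coeff f (degree f + i - 0) else 0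
        else if i - degree (pderiv f) \<le> 0 \<and> 0 \<le> i then coeff (pderiv f) (i - 0) else 0)"
      by (rule sylvester_index_mat) (use i assms in \<open>auto intro: gr0I\<close>)
    moreover have "lead_coeff f dvd coeff (pderiv f) (degree (pderiv f))"
      using assms by (simp only: coeff_pderiv degree_pderiv Suc_diff_1 dvd_triv_right)
    ultimately show "lead_coeff f dvd ?A $$ (i, 0)"
      by (cases i "degree (pderiv f)" rule: linorder_cases) simp_all
  qed
  finally show ?thesis .
qed

text \<open>
  \<open>p(x,y) - t\<close> lies in \<open>C[x][t][y]\<close>, so \<open>D_infinity p\<close> lies in \<open>C[x][t]\<close> and the pair \<open>(i, k)\<close> in its
  support stands for \<open>x^i t^k\<close>.
\<close>

definition D_infinity :: "complex poly poly \<Rightarrow> complex poly poly" where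
  "D_infinity p = discriminant (map_poly (\<lambda>c. [:c:]) p - [:[:0, 1:]:])"


section \<open>Newton diagrams and Newton polygons\<close>

definition quadrant :: "(real \<times> real) set" where
  "quadrant = {(x, y). 0 \<le> x \<and> 0 \<le> y}"

definition rsupp :: "complex poly poly \<Rightarrow> (real \<times> real) set" where
  "rsupp g = (\<lambda>(i, j). (real i, real j)) ` supp2 g"

definition newton_diagram :: "complex poly poly \<Rightarrow> (real \<times> real) set" where
  "newton_diagram g = convex hull (rsupp g + quadrant)"

definition newton_polygon_at_zero :: "(real \<times> real) set \<Rightarrow> (real \<times> real) set" where
  "newton_polygon_at_zero \<Delta> = top_of_set quadrant frontier_of \<Delta>"

definition newton_polygon_at_infinity :: "complex poly poly \<Rightarrow> (real \<times> real) set" where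
  "newton_polygon_at_infinity g =
     top_of_set quadrant frontier_of (convex hull (insert (0, 0) (rsupp g)))"

definition affine_L :: "nat \<Rightarrow> real \<times> real \<Rightarrow> real \<times> real" where
  "affine_L n = (\<lambda>(i, k). (real n * (real n - 1) - i - real n * k, k))"


section \<open>Merle type diagrams\<close>

text \<open>\<open>x^L + y^M\<close>\<close>

definition T_diagram :: "nat \<Rightarrow> nat \<Rightarrow> (real \<times> real) set" where
  "T_diagram L M = newton_diagram (monom (monom 1 L) 0 + monom (monom 1 0) M)"

definition merle_n :: "(nat \<Rightarrow> nat) \<Rightarrow> nat \<Rightarrow> nat" where
  "merle_n b k = Gcd (b ` {..<k}) div Gcd (b ` {..k})"

definition merle_sequence :: "nat \<Rightarrow> (nat \<Rightarrow> nat) \<Rightarrow> bool" where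
  "merle_sequence h b \<longleftrightarrow>
     h \<ge> 1 \<and> (\<forall>k\<le>h. b k > 0) \<and>
     (\<forall>k\<in>{1..h}. merle_n b k > 1) \<and> (\<Prod>k=1..h. merle_n b k) = b 0 \<and>
     (\<forall>k\<in>{1..<h}. merle_n b k * b k < b (k + 1))"

text \<open>The addition of sets is the Minkowski sum.\<close>

definition merle_diagram :: "nat \<Rightarrow> (nat \<Rightarrow> nat) \<Rightarrow> (real \<times> real) set" where
  "merle_diagram h b =
     (\<Sum>k=1..h. T_diagram ((merle_n b k - 1) * b k)
                          ((merle_n b k - 1) * (\<Prod>j=1..<k. merle_n b j)))"

definition merle_type_diagram :: "(real \<times> real) set \<Rightarrow> bool" where
  "merle_type_diagram \<Delta> \<longleftrightarrow> (\<exists>h b. merle_sequence h b \<and> \<Delta> = merle_diagram h b)"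

end

(*
  Write Q = (1:c:0). Then p has top form a (y - c x)^n, and in the coordinates u, v at Q the local
  equation F(u, v) is monic in u up to the constant a and F(u, 0) = a u^n. After the substitution
  v = w^N, both F and its u-derivative split over C[[w]]: let Y be the set of roots of F and G the
  multiset of roots of the derivative. Up to a constant and a power of w, the discriminant at infinity
  becomes the product over g in G of F(g) - T. Hence L maps its Newton polygon at infinity to the Newton
  polygon at zero with slopes s_g = (1/N) * sum over y in Y of ord(g - y), and a diagram of this kind is
  determined by the multiset of the s_g.

  The branches of C at Q are the orbits of w -> zeta w on Y, where zeta is a primitive N-th root of unity.
  A nonarchimedean Rolle theorem says that every ball around a root y contains one point of G less than
  points of Y. Induction over the tree of balls, using this count only, shows that Y is a single orbit if
  and only if the multiset of the s_g is the multiset of slopes of a Merle sequence with b_0 = n.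
*)

theory Submission
  imports Defs "HOL-Computational_Algebra.Field_as_Ring" "Subresultants.Subresultant_Gcd"
begin

hide_const (open) Module.smult
declare pCons_one [simp del]

section \<open>Merle sequences\<close>

definition merle_seq0 :: "nat \<Rightarrow> (nat \<Rightarrow> nat) \<Rightarrow> bool" where
  "merle_seq0 h b \<longleftrightarrow> (\<forall>k\<le>h. b k > 0) \<and> (\<forall>k\<in>{1..h}. merle_n b k > 1) \<and>
     (\<Prod>k=1..h. merle_n b k) = b 0 \<and> (\<forall>k\<in>{1..<h}. merle_n b k * b k < b (Suc k))"

lemma merle_sequence_iff: "merle_sequence h b \<longleftrightarrow> h \<ge> 1 \<and> merle_seq0 h b"
  by (simp add: merle_sequence_def merle_seq0_def)

definition merle_ms :: "nat \<Rightarrow> (nat \<Rightarrow> nat) \<Rightarrow> real multiset" where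
  "merle_ms h b = (\<Sum>k=1..h. replicate_mset ((merle_n b k - 1) * (\<Prod>j=1..<k. merle_n b j))
      (real (b k) / real (\<Prod>j=1..<k. merle_n b j)))"

lemma merle_ms_0 [simp]: "merle_ms 0 b = {#}"
  by (simp add: merle_ms_def)

lemma merle_n_pos: "(\<forall>k\<in>{1..h}. merle_n b k > 1) \<Longrightarrow> k \<le> Suc h \<Longrightarrow> (\<Prod>j=1..<k. merle_n b j) > 0"
  by (rule prod_pos) (metis (no_types, lifting) atLeastAtMost_iff atLeastLessThan_iff gr_zeroI less_Suc_eq_le less_le_trans not_less0)

lemma size_merle_ms:
  assumes "merle_seq0 h b"
  shows "size (merle_ms h b) = b 0 - 1"
proof -
  have "(\<Sum>k=1..l. (merle_n b k - 1) * (\<Prod>j=1..<k. merle_n b j)) + 1 = (\<Prod>j=1..l. merle_n b j)"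
    if "l \<le> h" for l
    using that
  proof (induction l)
    case (Suc l)
    have "merle_n b (Suc l) > 1" using Suc.prems assms by (auto simp: merle_seq0_def)
    then obtain q where q: "merle_n b (Suc l) = Suc q" by (cases "merle_n b (Suc l)") auto
    have "(\<Prod>j=1..<Suc l. merle_n b j) = (\<Prod>j=1..l. merle_n b j)"
      by (simp add: atLeastLessThanSuc_atLeastAtMost)
    then show ?case using Suc q by simp
  qed simp
  from this[OF order_refl] have "(\<Sum>k=1..h. (merle_n b k - 1) * (\<Prod>j=1..<k. merle_n b j)) = b 0 - 1"
    using assms unfolding merle_seq0_def by linarith
  moreover have "size (\<Sum>k\<in>A. f k) = (\<Sum>k\<in>A. size (f k))" if "finite A"
    for A :: "nat set" and f :: "nat \<Rightarrow> real multiset"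
    using that by (induction A rule: finite_induct) auto
  ultimately show ?thesis by (simp add: merle_ms_def)
qed

lemma merle_ms_ge:
  assumes "merle_seq0 h b" "s \<in># merle_ms h b"
  shows "s \<ge> real (b 1)"
proof -
  have ge: "real (b k) / real (\<Prod>j=1..<k. merle_n b j) \<ge> real (b 1)" if "k \<in> {1..h}" for k
    using that
  proof (induction k)
    case (Suc k)
    show ?case
    proof (cases "k = 0")
      case False
      let ?P = "\<Prod>j=1..<k. merle_n b j"
      have P: "?P > 0"
        using merle_n_pos[of h b k] Suc.prems assms False by (auto simp: merle_seq0_def)
      have "merle_n b k > 1"
        using Suc.prems assms False by (auto simp: merle_seq0_def)
      then have n: "merle_n b k > 0" by simp
      have "merle_n b k * b k \<le> b (Suc k)"
        using Suc.prems assms False by (auto simp: merle_seq0_def intro!: less_imp_le)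
      then have "real (merle_n b k) * real (b k) \<le> real (b (Suc k))"
        by (metis of_nat_le_iff of_nat_mult)
      then have "real (b k) / real ?P \<le> real (b (Suc k)) / (real ?P * real (merle_n b k))"
      proof -
        have "x / p \<le> y / (p * m)" if "m * x \<le> y" "p > 0" "m > 0" for x y p m :: real
          using that by (simp add: field_simps)
        then show ?thesis using P n \<open>real (merle_n b k) * real (b k) \<le> real (b (Suc k))\<close> by (metis of_nat_0_less_iff)
      qed
      moreover have "real (\<Prod>j=1..<Suc k. merle_n b j) = real ?P * real (merle_n b k)"
        using False by simp
      ultimately show ?thesis using Suc False by simp
    qed simp
  qed simp
  from assms(2) obtain k where "k \<in> {1..h}" "s = real (b k) / real (\<Prod>j=1..<k. merle_n b j)"
    by (auto simp: merle_ms_def set_mset_sum split: if_splits)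
  with ge show ?thesis by blast
qed

lemma merle_ms_first:
  assumes "merle_seq0 h b" "h \<ge> 1"
  shows "real (b 1) \<in># merle_ms h b"
proof -
  have "merle_n b 1 > 1" using assms by (auto simp: merle_seq0_def)
  then show ?thesis using assms(2)
    by (auto simp: merle_ms_def set_mset_sum intro!: bexI[of _ 1])
qed

lemma merle_ms_elem_pos:
  assumes "merle_seq0 h b" "s \<in># merle_ms h b"
  shows "s > 0"
proof -
  from assms(2) obtain k where k: "k \<in> {1..h}"
    "s \<in># replicate_mset ((merle_n b k - 1) * (\<Prod>j=1..<k. merle_n b j)) (real (b k) / real (\<Prod>j=1..<k. merle_n b j))"
    by (auto simp: merle_ms_def set_mset_sum)
  have p: "(\<Prod>j=1..<k. merle_n b j) > 0" using merle_n_pos[of h b k] k assms by (auto simp: merle_seq0_def)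
  have "s = real (b k) / real (\<Prod>j=1..<k. merle_n b j)" using k(2) by (auto split: if_splits)
  moreover have "b k > 0" using k assms by (auto simp: merle_seq0_def)
  ultimately show ?thesis using p by (metis divide_pos_pos of_nat_0_less_iff)
qed

text \<open>
  The branch attached to \<open>b'\<close> is one of the \<open>b 0 div b' 0\<close> conjugate bunches, over a ramified
  cover, in which the roots of the branch attached to \<open>b\<close> split at their first characteristic exponent.
\<close>

locale merle_shift =
  fixes h :: nat and b b' M :: "nat \<Rightarrow> nat"
  assumes b0: "b 0 > 0" and b'0: "b' 0 = gcd (b 0) (b 1)"
    and shift: "\<And>k. k \<in> {1..h} \<Longrightarrow> b (Suc k) = b' k + M k * b 1"
begin

lemma Gcd_shift: "k \<le> h \<Longrightarrow> Gcd (b ` {..Suc k}) = Gcd (b' ` {..k})"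
proof (induction k)
  case 0
  show ?case by (simp add: b'0 atMost_Suc gcd.commute)
next
  case (Suc k)
  have d: "Gcd (b' ` {..k}) dvd b 1"
    using b'0 by (metis Gcd_dvd atMost_iff dvd_trans gcd_dvd2 image_eqI zero_le)
  have "Gcd (b ` {..Suc (Suc k)}) = gcd (b (Suc (Suc k))) (Gcd (b ` {..Suc k}))"
    by (simp add: atMost_Suc[of "Suc k"])
  also have "\<dots> = gcd (b' (Suc k) + M (Suc k) * b 1) (Gcd (b' ` {..k}))"
    using shift[of "Suc k"] Suc by simp
  also have "\<dots> = gcd (b' (Suc k)) (Gcd (b' ` {..k}))"
  proof -
    obtain c where c: "b 1 = Gcd (b' ` {..k}) * c" using d by blast
    have "gcd (Gcd (b' ` {..k})) (M (Suc k) * c * Gcd (b' ` {..k}) + b' (Suc k)) = gcd (Gcd (b' ` {..k})) (b' (Suc k))"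
      by (rule gcd_add_mult)
    moreover have "M (Suc k) * b 1 = M (Suc k) * c * Gcd (b' ` {..k})" by (simp only: c ac_simps)
    ultimately show ?thesis by (metis add.commute gcd.commute)
  qed
  also have "\<dots> = Gcd (b' ` {..Suc k})" by (simp add: atMost_Suc)
  finally show ?case .
qed

lemma merle_n_1: "merle_n b 1 = b 0 div b' 0"
  using Gcd_shift[of 0] by (simp add: merle_n_def lessThan_Suc)

lemma merle_n_Suc: "k \<in> {1..h} \<Longrightarrow> merle_n b (Suc k) = merle_n b' k"
proof -
  assume k: "k \<in> {1..h}"
  then obtain l where l: "k = Suc l" by (cases k) auto
  show ?thesis using Gcd_shift[of k] Gcd_shift[of l] k
    by (simp add: merle_n_def l lessThan_Suc_atMost)
qed

lemma prod_Suc: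
  assumes "k \<in> {1..Suc h}"
  shows "(\<Prod>j=1..<Suc k. merle_n b j) = merle_n b 1 * (\<Prod>j=1..<k. merle_n b' j)"
proof -
  have "(\<Prod>j=1..<Suc k. merle_n b j) = merle_n b 1 * (\<Prod>j=Suc 1..<Suc k. merle_n b j)"
    using assms by (subst prod.atLeast_Suc_lessThan) auto
  also have "(\<Prod>j=Suc 1..<Suc k. merle_n b j) = (\<Prod>j=1..<k. merle_n b (Suc j))"
    by (rule prod.shift_bounds_Suc_ivl)
  also have "\<dots> = (\<Prod>j=1..<k. merle_n b' j)"
    using assms by (intro prod.cong) (auto simp: merle_n_Suc)
  finally show ?thesis .
qed

lemma b0_eq: "b 0 = merle_n b 1 * b' 0"
  using merle_n_1 b'0 by simp

lemma n1_pos: "merle_n b 1 > 0"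
  using b0 b0_eq by (metis gr0I mult_0)

context
  assumes M: "\<And>k. k \<in> {1..h} \<Longrightarrow> M k = (\<Prod>j=1..<k. merle_n b' j) * (merle_n b 1 - 1)"
begin

lemma Z2_shift:
  assumes "k \<in> {1..<h}"
  shows "merle_n b (Suc k) * b (Suc k) < b (Suc (Suc k)) \<longleftrightarrow> merle_n b' k * b' k < b' (Suc k)"
proof -
  have "M (Suc k) = merle_n b' k * M k"
    using assms by (simp add: M)
  then show ?thesis using assms shift[of k] shift[of "Suc k"]
    by (simp add: merle_n_Suc algebra_simps)
qed

lemma Z2_shift_1:
  assumes "h \<ge> 1"
  shows "merle_n b 1 * b 1 < b (Suc 1) \<longleftrightarrow> b 1 < b' 1"
proof -
  obtain q where "merle_n b 1 = Suc q" using n1_pos by (cases "merle_n b 1") auto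
  then show ?thesis using assms shift[of 1] M[of 1] by simp
qed

lemma merle_seq0_Suc_iff:
  "merle_seq0 (Suc h) b \<longleftrightarrow>
     merle_n b 1 > 1 \<and> b 1 > 0 \<and> merle_seq0 h b' \<and> (h \<ge> 1 \<longrightarrow> b 1 < b' 1)"  (is "?L \<longleftrightarrow> ?R")
proof -
  have pr: "(\<Prod>k=1..Suc h. merle_n b k) = merle_n b 1 * (\<Prod>k=1..h. merle_n b' k)"
    using prod_Suc[of "Suc h"] by (simp add: atLeastLessThanSuc_atLeastAtMost)
  show ?thesis
  proof
    assume L: ?L
    have n1: "merle_n b 1 > 1" and b1: "b 1 > 0" using L by (auto simp: merle_seq0_def)
    have n: "merle_n b' k > 1" if "k \<in> {1..h}" for k
    proof -
      have "merle_n b (Suc k) > 1" using L that by (auto simp: merle_seq0_def)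
      then show ?thesis using merle_n_Suc[OF that] by simp
    qed
    have z1: "b 1 < b' 1" if "h \<ge> 1"
      using L Z2_shift_1 that unfolding merle_seq0_def by (auto simp: Ball_def)
    have z2: "merle_n b' k * b' k < b' (Suc k)" if "k \<in> {1..<h}" for k
      using L Z2_shift[of k] that unfolding merle_seq0_def by (auto simp: Ball_def)
    have "b' k > 0" if "k \<le> h" for k
    proof (cases "k \<le> 1")
      case True
      then show ?thesis using z1 that b0 b'0 by (cases k) auto
    next
      case False
      then obtain l where "k = Suc l" "l \<in> {1..<h}" using \<open>k \<le> h\<close> by (cases k) auto
      then show ?thesis using z2[of l] by (metis gr_implies_not_zero gr_zeroI)
    qed
    moreover have "(\<Prod>k=1..h. merle_n b' k) = b' 0"
      using L pr b0_eq n1 by (auto simp: merle_seq0_def)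
    ultimately show ?R using n1 b1 n z1 z2 by (auto simp: merle_seq0_def)
  next
    assume R: ?R
    have "b k > 0" if "k \<le> Suc h" for k
    proof -
      have "b (Suc l) > 0" if "l \<in> {1..h}" for l
        using R shift[OF that] that by (auto simp: merle_seq0_def)
      then have "b k > 0" if "k \<noteq> 0" "k \<noteq> 1"
        using that \<open>k \<le> Suc h\<close> by (cases k) auto
      then show ?thesis using b0 R by (cases "k = 0"; cases "k = 1") auto
    qed
    moreover have "merle_n b k > 1" if "k \<in> {1..Suc h}" for k
    proof (cases "k = 1")
      case False
      then obtain l where "k = Suc l" "l \<in> {1..h}" using \<open>k \<in> {1..Suc h}\<close> by (cases k) auto
      then show ?thesis using R merle_n_Suc by (auto simp: merle_seq0_def)
    qed (use R in auto)
    moreover have "merle_n b k * b k < b (Suc k)" if "k \<in> {1..<Suc h}" for k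
    proof (cases "k = 1")
      case False
      then obtain l where "k = Suc l" "l \<in> {1..<h}" using \<open>k \<in> {1..<Suc h}\<close> by (cases k) auto
      then show ?thesis using R Z2_shift by (auto simp: merle_seq0_def)
    qed (use R Z2_shift_1 that in auto)
    moreover have "(\<Prod>k=1..Suc h. merle_n b k) = b 0" using R pr b0_eq by (auto simp: merle_seq0_def)
    ultimately show ?L unfolding merle_seq0_def by blast
  qed
qed

lemma merle_ms_Suc:
  assumes n': "\<And>k. k \<in> {1..h} \<Longrightarrow> merle_n b' k > 1"
  shows "merle_ms (Suc h) b = replicate_mset (merle_n b 1 - 1) (real (b 1)) +
     repeat_mset (merle_n b 1)
       (image_mset (\<lambda>s. (s + (real (merle_n b 1) - 1) * real (b 1)) / real (merle_n b 1)) (merle_ms h b'))"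
proof -
  let ?r = "merle_n b 1" let ?f = "\<lambda>s. (s + (real ?r - 1) * real (b 1)) / real ?r"
  let ?P = "\<lambda>k. \<Prod>j=1..<k. merle_n b' j"
  let ?t = "\<lambda>k. replicate_mset ((merle_n b k - 1) * (\<Prod>j=1..<k. merle_n b j)) (real (b k) / real (\<Prod>j=1..<k. merle_n b j))"
  let ?t' = "\<lambda>k. replicate_mset ((merle_n b' k - 1) * ?P k) (real (b' k) / real (?P k))"
  have rpt: "repeat_mset c (replicate_mset a x) = replicate_mset (c * a) x" for a c and x :: real
    by (rule multiset_eqI) auto
  have t: "?t (Suc k) = repeat_mset ?r (image_mset ?f (?t' k))" if k: "k \<in> {1..h}" for k
  proof -
    have P: "?P k > 0" using merle_n_pos[of h b' k] n' k by auto
    have "real (b (Suc k)) / real (?r * ?P k) = ?f (real (b' k) / real (?P k))"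
      using P n1_pos shift[OF k] M[OF k] by (simp add: field_simps of_nat_diff)
    moreover have "(\<Prod>j=1..<Suc k. merle_n b j) = ?r * ?P k" using prod_Suc[of k] k by auto
    ultimately show ?thesis using k
      by (simp only: merle_n_Suc image_replicate_mset rpt) (simp add: ac_simps)
  qed
  have "merle_ms (Suc h) b = ?t 1 + (\<Sum>k=Suc 1..Suc h. ?t k)"
    unfolding merle_ms_def by (subst sum.atLeast_Suc_atMost) auto
  also have "(\<Sum>k=Suc 1..Suc h. ?t k) = (\<Sum>k=1..h. ?t (Suc k))"
    by (rule sum.shift_bounds_cl_Suc_ivl)
  also have "\<dots> = (\<Sum>k=1..h. repeat_mset ?r (image_mset ?f (?t' k)))"
    using t by (intro sum.cong) auto
  also have "\<dots> = repeat_mset ?r (image_mset ?f (\<Sum>k=1..h. ?t' k))"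
  proof -
    have "(\<Sum>k\<in>A. repeat_mset ?r (image_mset ?f (?t' k))) = repeat_mset ?r (image_mset ?f (\<Sum>k\<in>A. ?t' k))"
      if "finite A" for A
      using that by (induction A rule: finite_induct) (auto simp del: image_replicate_mset)
    then show ?thesis by blast
  qed
  finally show ?thesis by (simp add: merle_ms_def)
qed

end

end

lemma merle_shift_down:
  assumes b: "merle_seq0 (Suc h) b"
  obtains b' M where "merle_shift h b b' M"
    "\<And>k. k \<in> {1..h} \<Longrightarrow> M k = (\<Prod>j=1..<k. merle_n b' j) * (merle_n b 1 - 1)"
proof -
  let ?M = "\<lambda>k. (\<Prod>j=1..<k. merle_n b (Suc j)) * (merle_n b 1 - 1)"
  define b' where "b' = (\<lambda>k. if k = 0 then gcd (b 0) (b 1) else b (Suc k) - ?M k * b 1)"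
  have le: "?M k * b 1 \<le> b (Suc k)" if "k \<in> {1..h}" for k
    using that
  proof (induction k)
    case (Suc k)
    show ?case
    proof (cases "k = 0")
      case True
      have "merle_n b 1 * b 1 < b (Suc 1)" using b Suc.prems by (auto simp: merle_seq0_def)
      moreover have "(merle_n b 1 - 1) * b 1 \<le> merle_n b 1 * b 1" by (intro mult_right_mono) auto
      ultimately have "(merle_n b 1 - 1) * b 1 \<le> b (Suc 1)" by linarith
      then show ?thesis using True by simp
    next
      case False
      have "?M (Suc k) * b 1 = merle_n b (Suc k) * (?M k * b 1)" using False by simp
      also have "\<dots> \<le> merle_n b (Suc k) * b (Suc k)" using Suc False by (intro mult_left_mono) auto
      also have "\<dots> \<le> b (Suc (Suc k))" using b Suc.prems False by (auto simp: merle_seq0_def intro!: less_imp_le)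
      finally show ?thesis .
    qed
  qed simp
  interpret merle_shift h b b' ?M
  proof
    show "b 0 > 0" using b by (auto simp: merle_seq0_def)
  qed (use le in \<open>auto simp: b'_def\<close>)
  have "?M k = (\<Prod>j=1..<k. merle_n b' j) * (merle_n b 1 - 1)" if "k \<in> {1..h}" for k
  proof -
    have "(\<Prod>j=1..<k. merle_n b (Suc j)) = (\<Prod>j=1..<k. merle_n b' j)"
      using that by (intro prod.cong) (auto simp: merle_n_Suc)
    then show ?thesis by simp
  qed
  with that merle_shift_axioms show thesis by blast
qed

lemma merle_shift_up:
  assumes b': "b' 0 > 0" and B: "gcd (r * b' 0) B = b' 0" and r: "r > 0"
  obtains b M where "merle_shift h b b' M" "b 0 = r * b' 0" "b 1 = B" "merle_n b 1 = r"
    "\<And>k. k \<in> {1..h} \<Longrightarrow> M k = (\<Prod>j=1..<k. merle_n b' j) * (merle_n b 1 - 1)"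
proof -
  let ?M = "\<lambda>k. (\<Prod>j=1..<k. merle_n b' j) * (r - 1)"
  define b where "b = (\<lambda>k. if k = 0 then r * b' 0 else if k = 1 then B else b' (k - 1) + ?M (k - 1) * B)"
  interpret merle_shift h b b' ?M
    by unfold_locales (use assms in \<open>auto simp: b_def\<close>)
  have "merle_n b 1 = r" using merle_n_1 b' by (simp add: b_def)
  then show thesis using that[OF merle_shift_axioms] by (auto simp: b_def)
qed

section \<open>Bunches of conjugate power series\<close>

definition near :: "nat \<Rightarrow> complex fps \<Rightarrow> complex fps \<Rightarrow> bool" where
  "near h a b \<longleftrightarrow> (\<forall>k<h. fps_nth a k = fps_nth b k)"

definition twist :: "complex \<Rightarrow> complex fps \<Rightarrow> complex fps" where
  "twist z f = Abs_fps (\<lambda>k. z ^ k * fps_nth f k)"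

lemma twist_nth [simp]: "fps_nth (twist z f) k = z ^ k * fps_nth f k"
  by (simp add: twist_def)

lemma twist_1 [simp]: "twist 1 f = f"
  by (rule fps_ext) simp

lemma twist_twist: "twist z (twist w f) = twist (z * w) f"
  by (rule fps_ext) (simp add: power_mult_distrib)

lemma twist_diff: "twist z (f - g) = twist z f - twist z g"
  by (rule fps_ext) (simp add: algebra_simps)

lemma twist_sum: "twist z (\<Sum>x\<in>A. f x) = (\<Sum>x\<in>A. twist z (f x))"
  by (rule fps_ext) (simp add: fps_sum_nth sum_distrib_left)

lemma twist_mult_const: "twist z (fps_const c * f) = fps_const c * twist z f"
  by (rule fps_ext) simp

lemma inj_twist: "z \<noteq> 0 \<Longrightarrow> inj (twist z)"
  by (rule injI) (auto simp: fps_eq_iff)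

lemma subdegree_twist: "z \<noteq> 0 \<Longrightarrow> subdegree (twist z f) = subdegree f"
proof (cases "f = 0")
  case True then show ?thesis by (simp add: twist_def flip: fps_zero_def)
next
  case False
  then show "z \<noteq> 0 \<Longrightarrow> ?thesis" by (intro subdegreeI) auto
qed

lemma near_0 [simp]: "near 0 a b"
  and near_refl [simp]: "near h a a"
  and near_sym: "near h a b \<Longrightarrow> near h b a"
  and near_trans: "near h a b \<Longrightarrow> near h b c \<Longrightarrow> near h a c"
  and near_mono: "near h a b \<Longrightarrow> h' \<le> h \<Longrightarrow> near h' a b"
  and near_Suc: "near (Suc h) a b \<longleftrightarrow> near h a b \<and> fps_nth a h = fps_nth b h"
  by (auto simp: near_def less_Suc_eq)

lemma near_iff_subdegree:
  assumes "a \<noteq> b"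
  shows "near h a b \<longleftrightarrow> h \<le> subdegree (a - b)"
proof
  assume "near h a b"
  then show "h \<le> subdegree (a - b)"
    using assms by (intro subdegree_geI) (auto simp: near_def)
next
  assume "h \<le> subdegree (a - b)"
  then have "fps_nth (a - b) k = 0" if "k < h" for k using that by (intro nth_less_subdegree_zero) auto
  then show "near h a b" by (auto simp: near_def)
qed

lemma subdegree_eq_near: "near h a b \<Longrightarrow> \<not> near (Suc h) a b \<Longrightarrow> subdegree (a - b) = h"
  using near_iff_subdegree[of a b] by (metis le_antisym near_refl not_less_eq_eq)

definition rolle :: "complex fps set \<Rightarrow> complex fps multiset \<Rightarrow> bool" where
  "rolle Y G \<longleftrightarrow> (\<forall>y\<in>Y. \<forall>h. size (filter_mset (near h y) G) + 1 = card {y' \<in> Y. near h y y'})"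

definition polar_ms :: "complex fps set \<Rightarrow> complex fps multiset \<Rightarrow> nat multiset" where
  "polar_ms Y G = image_mset (\<lambda>g. \<Sum>y\<in>Y. subdegree (g - y)) G"

definition conjugate_set :: "complex \<Rightarrow> complex fps set \<Rightarrow> bool" where
  "conjugate_set z Y \<longleftrightarrow> (\<forall>x\<in>Y. \<forall>y\<in>Y. \<exists>k. y = twist (z ^ k) x)"

lemma rolle_size: "rolle Y G \<Longrightarrow> y \<in> Y \<Longrightarrow> size G + 1 = card Y"
proof -
  assume "rolle Y G" "y \<in> Y"
  then have "size (filter_mset (near 0 y) G) + 1 = card {y' \<in> Y. near 0 y y'}" by (simp add: rolle_def)
  moreover have "filter_mset (near 0 y) G = G" by (simp add: filter_mset_eq_conv)
  ultimately show ?thesis by simp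
qed

lemma rolle_disjoint:
  assumes "rolle Y G" "finite Y" "g \<in># G"
  shows "g \<notin> Y"
proof
  assume g: "g \<in> Y"
  define h where "h = Suc (Max (insert 0 ((\<lambda>y. subdegree (g - y)) ` Y)))"
  have "y = g" if "y \<in> Y" "near h g y" for y
  proof (rule ccontr)
    assume "y \<noteq> g"
    then have "h \<le> subdegree (g - y)" using that near_iff_subdegree by metis
    moreover have "subdegree (g - y) < h" unfolding h_def less_Suc_eq_le
      using assms that by (intro Max_ge) auto
    ultimately show False by simp
  qed
  with g have "{y' \<in> Y. near h g y'} = {g}" by auto
  moreover have "size (filter_mset (near h g) G) + 1 = card {y' \<in> Y. near h g y'}"
    using assms(1) g by (simp add: rolle_def)
  ultimately have "filter_mset (near h g) G = {#}" by simp
  then show False using assms(3) by (metis (mono_tags) filter_mset_eq_conv near_refl set_mset_empty empty_iff mem_Collect_eq set_mset_filter)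
qed

lemma rolle_near:
  assumes r: "rolle Y G" and "y \<in> Y"
  shows "rolle {y' \<in> Y. near h y y'} (filter_mset (near h y) G)"
  unfolding rolle_def
proof (intro ballI allI)
  fix y' l assume y': "y' \<in> {y' \<in> Y. near h y y'}"
  show "size (filter_mset (near l y') (filter_mset (near h y) G)) + 1 =
      card {x \<in> {y' \<in> Y. near h y y'}. near l y' x}"
  proof (cases "l \<le> h")
    case True
    have "near l y' x" if "near h y x" for x
      using that y' True near_trans near_sym near_mono by (metis mem_Collect_eq)
    then have "filter_mset (near l y') (filter_mset (near h y) G) = filter_mset (near h y) G"
      "{x \<in> {y' \<in> Y. near h y y'}. near l y' x} = {x \<in> Y. near h y x}"
      by (auto simp: filter_filter_mset intro!: filter_mset_cong)
    then show ?thesis using assms by (simp add: rolle_def)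
  next
    case False
    have "near h y x" if "near l y' x" for x
      using that y' False near_trans near_mono by (metis mem_Collect_eq nat_le_linear)
    then have "filter_mset (near l y') (filter_mset (near h y) G) = filter_mset (near l y') G"
      "{x \<in> {y' \<in> Y. near h y y'}. near l y' x} = {x \<in> Y. near l y' x}"
      by (auto simp: filter_filter_mset intro!: filter_mset_cong)
    then show ?thesis using y' r by (simp add: rolle_def)
  qed
qed

lemma filter_mset_partition:
  assumes "finite T"
  shows "M = filter_mset (\<lambda>x. f x \<notin> T) M + (\<Sum>c\<in>T. filter_mset (\<lambda>x. f x = c) M)"
  using assms
proof (induction T rule: finite_induct)
  case (insert c T)
  have "filter_mset (\<lambda>x. f x \<notin> T) M =
      filter_mset (\<lambda>x. f x \<notin> insert c T) M + filter_mset (\<lambda>x. f x = c) M"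
    using insert.hyps by (intro multiset_eqI) auto
  then show ?case using insert by (simp add: ac_simps)
qed simp

lemma image_mset_sum: "finite T \<Longrightarrow> image_mset f (\<Sum>c\<in>T. M c) = (\<Sum>c\<in>T. image_mset f (M c))"
  by (induction T rule: finite_induct) auto

lemma size_sum_mset: "finite T \<Longrightarrow> size (\<Sum>c\<in>T. M c :: 'a multiset) = (\<Sum>c\<in>T. size (M c))"
  by (induction T rule: finite_induct) auto

lemma sum_const_mset: "finite T \<Longrightarrow> (\<Sum>c\<in>T. X) = repeat_mset (card T) X"
  by (induction T rule: finite_induct) auto

locale bunch =
  fixes Y :: "complex fps set" and G :: "complex fps multiset" and H :: nat and a :: "complex fps"
  assumes fin: "finite Y" and ne: "Y \<noteq> {}" and rolle: "rolle Y G"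
    and near_a: "\<And>y. y \<in> Y \<Longrightarrow> near H a y"
begin

definition chi where "chi f = fps_nth f H - fps_nth a H"
definition cls where "cls c = {y \<in> Y. chi y = c}"
definition gcls where "gcls c = filter_mset (\<lambda>g. chi g = c) G"

lemma near_a_G: "g \<in># G \<Longrightarrow> near H a g"
proof -
  obtain y where y: "y \<in> Y" using ne by blast
  have "{y' \<in> Y. near H y y'} = Y" using near_a near_trans near_sym y by blast
  moreover have "size (filter_mset (near H y) G) + 1 = card {y' \<in> Y. near H y y'}"
    using rolle y by (simp add: rolle_def)
  ultimately have "size (filter_mset (near H y) G) = size G"
    using rolle_size[OF rolle y] by simp
  then have "filter_mset (near H y) G = G"
    by (metis multiset_filter_subset mset_subset_size less_irrefl subset_mset.le_imp_less_or_eq)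
  moreover assume "g \<in># G"
  ultimately have "near H y g" by (metis filter_mset_eq_conv filter_mset_cong set_mset_filter mem_Collect_eq)
  with near_a[OF y] show ?thesis by (rule near_trans)
qed

lemma near_Suc_iff:
  assumes "near H a f" "near H a g"
  shows "near (Suc H) f g \<longleftrightarrow> chi f = chi g"
  using near_trans[OF near_sym[OF assms(1)] assms(2)] by (auto simp: near_Suc chi_def)

lemma cls_eq: "y \<in> Y \<Longrightarrow> chi y = c \<Longrightarrow> cls c = {y' \<in> Y. near (Suc H) y y'}"
  using near_a near_Suc_iff[of y] by (auto simp: cls_def)

lemma gcls_eq: "y \<in> Y \<Longrightarrow> chi y = c \<Longrightarrow> gcls c = filter_mset (near (Suc H) y) G"
  unfolding gcls_def using near_a near_a_G near_Suc_iff[of y]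
  by (intro filter_mset_cong) auto

lemma rolle_cls: "c \<in> chi ` Y \<Longrightarrow> rolle (cls c) (gcls c)"
  using rolle_near[OF rolle] cls_eq gcls_eq by fastforce

lemma size_gcls: "c \<in> chi ` Y \<Longrightarrow> size (gcls c) + 1 = card (cls c)"
  using rolle_size[OF rolle_cls] by (auto simp: cls_def)

lemma sum_card_cls: "(\<Sum>c\<in>chi ` Y. card (cls c)) = card Y"
proof -
  have "card Y = card (\<Union>c\<in>chi ` Y. cls c)" by (rule arg_cong[of _ _ card]) (auto simp: cls_def)
  also have "\<dots> = (\<Sum>c\<in>chi ` Y. card (cls c))"
    using fin by (intro card_UN_disjoint) (auto simp: cls_def)
  finally show ?thesis by simp
qed

lemma subdegree_not_near:
  assumes "y \<in> Y" "g \<in># G" "chi y \<noteq> chi g"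
  shows "subdegree (g - y) = H"
proof (rule subdegree_eq_near)
  show "near H g y" using near_a[OF assms(1)] near_a_G[OF assms(2)] near_trans near_sym by blast
  show "\<not> near (Suc H) g y" using assms near_a near_a_G near_Suc_iff[of g y] by auto
qed

lemma subdegree_near:
  assumes "y \<in> Y" "g \<in># G" "chi y = chi g"
  shows "subdegree (g - y) > H"
proof -
  have "g \<noteq> y" using rolle_disjoint[OF rolle fin] assms by blast
  then show ?thesis using assms near_a near_a_G near_Suc_iff[of g y] near_iff_subdegree[of g y "Suc H"] by auto
qed

lemma polar_ms_cls_gt:
  assumes "c \<in> chi ` Y" "s \<in># polar_ms (cls c) (gcls c)"
  shows "s > card (cls c) * H"
proof -
  obtain g where g: "g \<in># G" "chi g = c" and s: "s = (\<Sum>y\<in>cls c. subdegree (g - y))"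
    using assms(2) by (auto simp: polar_ms_def gcls_def)
  have "card (cls c) * H = (\<Sum>y\<in>cls c. H)" by simp
  also have "\<dots> < s" unfolding s
    using assms(1) fin subdegree_near g by (intro sum_strict_mono) (auto simp: cls_def)
  finally show ?thesis .
qed

lemma polar_ms_decomp:
  "polar_ms Y G = replicate_mset (card (chi ` Y) - 1) (card Y * H) +
     (\<Sum>c\<in>chi ` Y. image_mset (\<lambda>s. s + (card Y - card (cls c)) * H) (polar_ms (cls c) (gcls c)))"
proof -
  let ?R = "filter_mset (\<lambda>g. chi g \<notin> chi ` Y) G"
  let ?f = "\<lambda>g. \<Sum>y\<in>Y. subdegree (g - y)"
  have G: "G = ?R + (\<Sum>c\<in>chi ` Y. gcls c)"
    unfolding gcls_def using fin by (intro filter_mset_partition) auto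
  obtain y where y: "y \<in> Y" using ne by blast
  have "size G = size ?R + (\<Sum>c\<in>chi ` Y. size (gcls c))"
    using fin by (subst G) (simp add: size_sum_mset)
  moreover have "(\<Sum>c\<in>chi ` Y. size (gcls c)) + card (chi ` Y) = card Y"
  proof -
    have "(\<Sum>c\<in>chi ` Y. size (gcls c)) + card (chi ` Y) = (\<Sum>c\<in>chi ` Y. size (gcls c) + 1)"
      by (simp only: sum.distrib sum_constant) simp
    also have "\<dots> = (\<Sum>c\<in>chi ` Y. card (cls c))" using size_gcls by (intro sum.cong) auto
    finally show ?thesis using sum_card_cls by simp
  qed
  ultimately have sR: "size ?R = card (chi ` Y) - 1" using rolle_size[OF rolle y] by linarith
  have "image_mset ?f ?R = image_mset (\<lambda>_. card Y * H) ?R"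
  proof (rule image_mset_cong)
    fix g assume g: "g \<in># ?R"
    have "?f g = (\<Sum>y\<in>Y. H)" using g by (intro sum.cong refl subdegree_not_near) (auto, metis imageI)
    then show "?f g = card Y * H" by simp
  qed
  then have R: "image_mset ?f ?R = replicate_mset (card (chi ` Y) - 1) (card Y * H)"
    using sR by (simp add: image_mset_const_eq)
  have C: "image_mset ?f (gcls c) = image_mset (\<lambda>s. s + (card Y - card (cls c)) * H) (polar_ms (cls c) (gcls c))"
    if c: "c \<in> chi ` Y" for c
    unfolding polar_ms_def multiset.map_comp
  proof (rule image_mset_cong)
    fix g assume g: "g \<in># gcls c"
    have sub: "cls c \<subseteq> Y" by (auto simp: cls_def)
    have "?f g = (\<Sum>y\<in>cls c. subdegree (g - y)) + (\<Sum>y\<in>Y - cls c. subdegree (g - y))"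
      using fin sub by (metis sum.subset_diff add.commute)
    also have "(\<Sum>y\<in>Y - cls c. subdegree (g - y)) = (\<Sum>y\<in>Y - cls c. H)"
      using g by (intro sum.cong refl subdegree_not_near) (auto simp: gcls_def cls_def)
    finally show "?f g = ((\<lambda>s. s + (card Y - card (cls c)) * H) \<circ> (\<lambda>g. \<Sum>y\<in>cls c. subdegree (g - y))) g"
      using fin sub by (simp add: card_Diff_subset finite_subset)
  qed
  have "polar_ms Y G = image_mset ?f (?R + (\<Sum>c\<in>chi ` Y. gcls c))"
    unfolding polar_ms_def using G by (rule arg_cong)
  also have "\<dots> = image_mset ?f ?R + (\<Sum>c\<in>chi ` Y. image_mset ?f (gcls c))"
    using fin by (simp add: image_mset_sum)
  also have "(\<Sum>c\<in>chi ` Y. image_mset ?f (gcls c)) =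
     (\<Sum>c\<in>chi ` Y. image_mset (\<lambda>s. s + (card Y - card (cls c)) * H) (polar_ms (cls c) (gcls c)))"
    using C by (intro sum.cong) auto
  finally show ?thesis using R by simp
qed

end

locale twisted_bunch = bunch +
  fixes z :: complex
  assumes z0: "z \<noteq> 0" and twist_Y: "twist z ` Y = Y" and twist_G: "image_mset (twist z) G = G"
    and twist_a: "twist z a = a"
begin

lemma chi_twist: "chi (twist z f) = z ^ H * chi f"
proof -
  have "fps_nth a H = z ^ H * fps_nth a H" using twist_a by (metis twist_nth)
  then show ?thesis by (simp add: chi_def algebra_simps)
qed

lemma twist_power_Y: "twist (z ^ k) ` Y = Y"
proof (induction k)
  case (Suc k)
  have "twist (z ^ Suc k) ` Y = twist z ` (twist (z ^ k) ` Y)" by (simp add: image_image twist_twist)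
  then show ?case using Suc twist_Y by simp
qed simp

lemma chi_twist_power: "chi (twist (z ^ k) f) = (z ^ H) ^ k * chi f"
proof (induction k)
  case (Suc k)
  have "twist (z ^ Suc k) f = twist z (twist (z ^ k) f)" by (simp add: twist_twist)
  then show ?case using Suc chi_twist by simp
qed simp

lemma cls_twist: "cls (z ^ H * c) = twist z ` cls c"
proof -
  have "cls (z ^ H * c) = {y \<in> twist z ` Y. chi y = z ^ H * c}" using twist_Y by (simp add: cls_def)
  also have "\<dots> = twist z ` cls c" using z0 by (auto simp: cls_def chi_twist)
  finally show ?thesis .
qed

lemma gcls_twist: "gcls (z ^ H * c) = image_mset (twist z) (gcls c)"
proof -
  have "gcls (z ^ H * c) = filter_mset (\<lambda>g. chi g = z ^ H * c) (image_mset (twist z) G)"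
    using twist_G by (simp add: gcls_def)
  also have "\<dots> = image_mset (twist z) (gcls c)"
    using z0 by (simp add: filter_mset_image_mset gcls_def chi_twist)
  finally show ?thesis .
qed

lemma polar_ms_twist: "polar_ms (cls (z ^ H * c)) (gcls (z ^ H * c)) = polar_ms (cls c) (gcls c)"
  unfolding polar_ms_def cls_twist gcls_twist multiset.map_comp
proof (rule image_mset_cong)
  fix g assume "g \<in># gcls c"
  have "(\<Sum>y\<in>twist z ` cls c. subdegree (twist z g - y)) = (\<Sum>y\<in>cls c. subdegree (twist z g - twist z y))"
    using inj_twist[OF z0] by (subst sum.reindex) (auto simp: inj_on_def inj_def)
  then show "((\<lambda>g. \<Sum>y\<in>twist z ` cls c. subdegree (g - y)) \<circ> twist z) g = (\<Sum>y\<in>cls c. subdegree (g - y))"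
    using z0 by (simp add: subdegree_twist flip: twist_diff)
qed

lemma card_cls_twist: "card (cls (z ^ H * c)) = card (cls c)"
  unfolding cls_twist by (rule card_image) (use inj_twist[OF z0] in \<open>auto simp: inj_on_def inj_def\<close>)

lemma twist_power_cls: "cls ((z ^ H) ^ k * c) = twist (z ^ k) ` cls c"
  and twist_power_gcls: "gcls ((z ^ H) ^ k * c) = image_mset (twist (z ^ k)) (gcls c)"
  and polar_ms_twist_power: "polar_ms (cls ((z ^ H) ^ k * c)) (gcls ((z ^ H) ^ k * c)) = polar_ms (cls c) (gcls c)"
  and card_cls_twist_power: "card (cls ((z ^ H) ^ k * c)) = card (cls c)"
proof (induction k)
  case (Suc k)
  { case 1 then show ?case using Suc cls_twist[of "(z ^ H) ^ k * c"]
      by (simp add: mult.assoc image_image twist_twist) }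
  { case 2 then show ?case using Suc gcls_twist[of "(z ^ H) ^ k * c"]
      by (simp add: mult.assoc multiset.map_comp twist_twist o_def) }
  { case 3 then show ?case using Suc polar_ms_twist[of "(z ^ H) ^ k * c"] by (simp add: mult.assoc) }
  { case 4 then show ?case using Suc card_cls_twist[of "(z ^ H) ^ k * c"] by (simp add: mult.assoc) }
qed (simp_all add: multiset.map_ident_strong)

lemma chi_orbit:
  assumes "c \<in> chi ` Y"
  shows "(z ^ H) ^ k * c \<in> chi ` Y"
proof -
  obtain y where y: "y \<in> Y" "c = chi y" using assms by auto
  then have "twist (z ^ k) y \<in> Y" using twist_power_Y by blast
  then show ?thesis using chi_twist_power[of k y] y by (metis imageI)
qed

end

context twisted_bunch
begin

context
  fixes r :: nat and c :: complex
  assumes order: "\<And>k. (z ^ H) ^ k = 1 \<longleftrightarrow> r dvd k" and r0: "r > 0" and c0: "c \<noteq> 0"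
    and orbit: "chi ` Y = (\<lambda>k. (z ^ H) ^ k * c) ` {..<r}"
begin

lemma inj_orbit: "inj_on (\<lambda>k. (z ^ H) ^ k * c) {..<r}"
proof -
  have "i = j" if "i < r" "j < r" "i \<le> j" "(z ^ H) ^ i * c = (z ^ H) ^ j * c" for i j
  proof -
    have "(z ^ H) ^ j = (z ^ H) ^ i * (z ^ H) ^ (j - i)" using that by (simp flip: power_add)
    then have "(z ^ H) ^ (j - i) = 1" using that c0 z0 by auto
    then have "r dvd j - i" using order by simp
    then show ?thesis using that by (auto dest: dvd_imp_le)
  qed
  then show ?thesis by (intro inj_onI) (metis lessThan_iff linear)
qed

lemma card_orbit: "card (chi ` Y) = r"
  unfolding orbit using card_image[OF inj_orbit] by simp

lemma card_cls_orbit: "c' \<in> chi ` Y \<Longrightarrow> card (cls c') = card (cls c)"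
  and polar_ms_orbit: "c' \<in> chi ` Y \<Longrightarrow> polar_ms (cls c') (gcls c') = polar_ms (cls c) (gcls c)"
  using card_cls_twist_power polar_ms_twist_power by (auto simp: orbit)

lemma card_Y_orbit: "card Y = r * card (cls c)"
proof -
  have "card Y = (\<Sum>c'\<in>chi ` Y. card (cls c))" using card_cls_orbit sum_card_cls by simp
  then show ?thesis using card_orbit by simp
qed

lemma polar_ms_orbit_decomp:
  "polar_ms Y G = replicate_mset (r - 1) (card Y * H) +
     repeat_mset r (image_mset (\<lambda>s. s + (card Y - card (cls c)) * H) (polar_ms (cls c) (gcls c)))"
proof -
  have "(\<Sum>c'\<in>chi ` Y. image_mset (\<lambda>s. s + (card Y - card (cls c')) * H) (polar_ms (cls c') (gcls c')))
     = (\<Sum>c'\<in>chi ` Y. image_mset (\<lambda>s. s + (card Y - card (cls c)) * H) (polar_ms (cls c) (gcls c)))"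
    using card_cls_orbit polar_ms_orbit by (intro sum.cong) auto
  then show ?thesis using polar_ms_decomp fin card_orbit by (simp add: sum_const_mset)
qed

lemma twist_r_cls: "twist (z ^ r) ` cls c = cls c"
  and twist_r_gcls: "image_mset (twist (z ^ r)) (gcls c) = gcls c"
  using twist_power_cls[of r c] twist_power_gcls[of r c] order[of r] by simp_all

lemma conjugate_set_orbit: "conjugate_set z Y \<longleftrightarrow> conjugate_set (z ^ r) (cls c)"
proof
  assume L: "conjugate_set z Y"
  show "conjugate_set (z ^ r) (cls c)"
    unfolding conjugate_set_def
  proof (intro ballI)
    fix x y assume x: "x \<in> cls c" and y: "y \<in> cls c"
    then obtain k where k: "y = twist (z ^ k) x" using L by (auto simp: conjugate_set_def cls_def)
    then have "c = (z ^ H) ^ k * c" using x y chi_twist_power by (simp add: cls_def)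
    then have "r dvd k" using order c0 by simp
    then obtain l where "k = r * l" by blast
    then show "\<exists>k. y = twist ((z ^ r) ^ k) x" using k by (auto simp: power_mult)
  qed
next
  assume R: "conjugate_set (z ^ r) (cls c)"
  show "conjugate_set z Y"
    unfolding conjugate_set_def
  proof (intro ballI)
    fix x y assume x: "x \<in> Y" and y: "y \<in> Y"
    obtain i where i: "i < r" "chi x = (z ^ H) ^ i * c" using x orbit by (metis (no_types, lifting) imageE imageI lessThan_iff)
    obtain j where j: "j < r" "chi y = (z ^ H) ^ j * c" using y orbit by (metis (no_types, lifting) imageE imageI lessThan_iff)
    obtain y0 where y0: "y0 \<in> Y" "y = twist (z ^ j) y0" using y twist_power_Y[of j] by blast
    have "(z ^ H) ^ j * chi y0 = (z ^ H) ^ j * c" using j y0 chi_twist_power by metis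
    then have y0c: "y0 \<in> cls c" using z0 y0 by (simp add: cls_def)
    have "chi (twist (z ^ (r - i)) x) = ((z ^ H) ^ (r - i) * (z ^ H) ^ i) * c"
      by (simp only: chi_twist_power i mult.assoc)
    also have "(z ^ H) ^ (r - i) * (z ^ H) ^ i = (z ^ H) ^ r"
      using i by (simp flip: power_add)
    finally have "chi (twist (z ^ (r - i)) x) = c" using order[of r] by simp
    moreover have "twist (z ^ (r - i)) x \<in> Y" using x twist_power_Y by blast
    ultimately have "twist (z ^ (r - i)) x \<in> cls c" by (simp add: cls_def)
    then obtain k where "y0 = twist ((z ^ r) ^ k) (twist (z ^ (r - i)) x)"
      using R y0c by (auto simp: conjugate_set_def)
    then have "y = twist (z ^ (j + r * k + (r - i))) x"
      using y0 by (simp add: twist_twist power_add power_mult mult.assoc)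
    then show "\<exists>k. y = twist (z ^ k) x" by blast
  qed
qed

end

end

lemma div_gcd_cross:
  fixes a b c d :: nat
  assumes "a * d = b * c" "a > 0" "c > 0"
  shows "a div gcd a b = c div gcd c d"
proof -
  have "gcd a b * c = gcd (a * c) (a * d)" using assms by (simp add: gcd_mult_distrib_nat mult.commute)
  also have "\<dots> = a * gcd c d" by (simp add: gcd_mult_distrib_nat)
  finally have e: "gcd a b * c = a * gcd c d" .
  obtain x where x: "a = gcd a b * x" using gcd_dvd1 by blast
  obtain y where y: "c = gcd c d * y" using gcd_dvd1 by blast
  have "gcd a b * (gcd c d * y) = gcd a b * x * gcd c d" using e x y by metis
  then have "x = y" using assms by simp
  moreover have "a div gcd a b = x" using x assms by (metis gcd_pos_nat nonzero_mult_div_cancel_left less_numeral_extra(3))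
  moreover have "c div gcd c d = y" using y assms by (metis gcd_pos_nat nonzero_mult_div_cancel_left less_numeral_extra(3))
  ultimately show ?thesis by simp
qed

lemma repeat_mset_cancel: "r > 0 \<Longrightarrow> repeat_mset r A = repeat_mset r B \<Longrightarrow> A = B"
  by (metis count_repeat_mset multiset_eqI mult_cancel1 less_numeral_extra(3))

lemma image_mset_repeat_mset: "image_mset f (repeat_mset r A) = repeat_mset r (image_mset f A)"
  by (induction r) auto

lemma in_repeat_mset: "s \<in># repeat_mset r A \<longleftrightarrow> r > 0 \<and> s \<in># A"
  by (simp flip: count_greater_zero_iff)

lemma min_and_count_eq:
  fixes x y :: "'a::linorder"
  assumes e: "replicate_mset (Suc a) x + A = replicate_mset (Suc b) y + B"
    and A: "\<And>s. s \<in># A \<Longrightarrow> s > x" and B: "\<And>s. s \<in># B \<Longrightarrow> s > y"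
  shows "x = y" "a = b"
proof -
  have "x \<in># replicate_mset (Suc b) y + B" using e by (metis in_replicate_mset union_iff zero_less_Suc)
  then have "y \<le> x" using B by (auto dest: less_imp_le split: if_splits)
  moreover have "y \<in># replicate_mset (Suc a) x + A" using e by (metis in_replicate_mset union_iff zero_less_Suc)
  then have "x \<le> y" using A by (auto dest: less_imp_le split: if_splits)
  ultimately show xy: "x = y" by simp
  have "count A x = 0" "count B x = 0" using A B xy by (meson count_inI less_irrefl)+
  then have "count (replicate_mset (Suc a) x + A) x = Suc a" "count (replicate_mset (Suc b) y + B) x = Suc b"
    using xy by simp_all
  then show "a = b" using e by (metis nat.inject)
qed

theorem conjugate_iff_merle:
  fixes \<zeta> :: complex
  assumes N: "N > 0" and prim: "\<And>k. \<zeta> ^ k = 1 \<longleftrightarrow> N dvd k"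
    and "d dvd N" "finite Y" "Y \<noteq> {}" "twist (\<zeta> ^ d) ` Y = Y"
    "image_mset (twist (\<zeta> ^ d)) G = G" "rolle Y G"
  shows "conjugate_set (\<zeta> ^ d) Y \<longleftrightarrow>
    (\<exists>h b. merle_seq0 h b \<and> b 0 = card Y \<and>
       merle_ms h b = image_mset (\<lambda>s. real s * real d / real N) (polar_ms Y G))"
  using assms(3-)
proof (induction "card Y" arbitrary: d Y G rule: less_induct)
  case less
  note dN = less.prems(1) and fin = less.prems(2) and ne = less.prems(3) and tY = less.prems(4)
    and tG = less.prems(5) and rol = less.prems(6)
  have d: "d > 0" using dN N by (auto intro: Nat.gr0I)
  show ?case
  proof (cases "card Y = 1")
    case True
    then obtain y where y: "Y = {y}" by (auto simp: card_1_singleton_iff)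
    have "\<exists>k. y = twist ((\<zeta> ^ d) ^ k) y" by (rule exI[of _ 0]) simp
    then have "conjugate_set (\<zeta> ^ d) Y" by (auto simp: conjugate_set_def y)
    moreover have "G = {#}" using rolle_size[OF rol] y True by auto
    then have "merle_ms 0 (\<lambda>_. 1) = image_mset (\<lambda>s. real s * real d / real N) (polar_ms Y G)"
      by (simp add: polar_ms_def)
    moreover have "merle_seq0 0 (\<lambda>_. 1)" by (simp add: merle_seq0_def)
    ultimately show ?thesis using True by (metis (no_types, lifting))
  next
    case False
    define m where "m = card Y"
    have m2: "m \<ge> 2" using False fin ne unfolding m_def
      by (metis One_nat_def Suc_leI card_gt_0_iff le_neq_implies_less numeral_2_eq_2)
    define z where "z = \<zeta> ^ d"
    have \<zeta>0: "\<zeta> \<noteq> 0" using prim[of N] N by (metis dvd_refl power_0_left not_gr0 zero_neq_one)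
    then have z0: "z \<noteq> 0" by (simp add: z_def)
    define H where "H = (LEAST h. \<exists>y\<in>Y. \<exists>y'\<in>Y. \<not> near (Suc h) y y')"
    obtain y1 y2 where y12: "y1 \<in> Y" "y2 \<in> Y" "y1 \<noteq> y2"
      using m2 unfolding m_def by (metis card_le_Suc0_iff_eq fin not_less_eq_eq numeral_2_eq_2)
    have ex: "\<exists>h. \<exists>y\<in>Y. \<exists>y'\<in>Y. \<not> near (Suc h) y y'"
      using y12 near_iff_subdegree[of y1 y2 "Suc (subdegree (y1 - y2))"] by (metis Suc_n_not_le_n)
    have H1: "\<exists>y\<in>Y. \<exists>y'\<in>Y. \<not> near (Suc H) y y'"
      unfolding H_def by (rule LeastI_ex[OF ex])
    have H2: "near H y y'" if "y \<in> Y" "y' \<in> Y" for y y'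
    proof (cases H)
      case (Suc l)
      then have "l < H" by simp
      then show ?thesis using not_less_Least[of l "\<lambda>h. \<exists>y\<in>Y. \<exists>y'\<in>Y. \<not> near (Suc h) y y'"] that Suc
        unfolding H_def by auto
    qed simp
    define a where "a = fps_const (1 / of_nat m) * (\<Sum>y\<in>Y. y)"
    have near_a: "near H a y" if "y \<in> Y" for y
      unfolding near_def
    proof (intro allI impI)
      fix k assume k: "k < H"
      have "(\<Sum>y'\<in>Y. fps_nth y' k) = (\<Sum>y'\<in>Y. fps_nth y k)"
        using H2[OF _ that] k by (intro sum.cong) (auto simp: near_def)
      then show "fps_nth a k = fps_nth y k" using m2 by (simp add: a_def fps_sum_nth m_def)
    qed
    have twa: "twist z a = a"
    proof -
      have "(\<Sum>y\<in>Y. twist z y) = (\<Sum>y\<in>twist z ` Y. y)"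
        using inj_twist[OF z0] by (subst sum.reindex) (auto simp: inj_on_def inj_def)
      then show ?thesis using tY by (simp add: a_def twist_mult_const twist_sum z_def)
    qed
    interpret twisted_bunch Y G H a z
      by unfold_locales (use fin ne rol near_a z0 tY tG twa in \<open>auto simp: z_def\<close>)
    have t2: "card (chi ` Y) \<ge> 2"
    proof -
      obtain y y' where "y \<in> Y" "y' \<in> Y" "\<not> near (Suc H) y y'" using H1 by blast
      then have "chi y \<noteq> chi y'" using near_Suc_iff[of y y'] near_a by blast
      then have "card {chi y, chi y'} = 2" by simp
      moreover have "{chi y, chi y'} \<subseteq> chi ` Y" using \<open>y \<in> Y\<close> \<open>y' \<in> Y\<close> by auto
      ultimately show ?thesis using fin by (metis card_mono finite_imageI)
    qed
    obtain c where c: "c \<in> chi ` Y" "c \<noteq> 0"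
    proof -
      have "\<not> chi ` Y \<subseteq> {0}"
      proof
        assume "chi ` Y \<subseteq> {0}"
        then have "card (chi ` Y) \<le> card {0 :: complex}" by (intro card_mono) auto
        then show False using t2 by simp
      qed
      then show thesis using that by blast
    qed
    define r where "r = N div gcd N (d * H)"
    have r0: "r > 0" using N by (simp add: r_def div_greater_zero_iff dvd_imp_le)
    define g where "g = gcd N (d * H)"
    have g0: "g > 0" using N by (simp add: g_def)
    have Nrg: "N = r * g" by (simp add: r_def g_def)
    obtain e where e: "d * H = e * g" unfolding g_def by (metis gcd_dvd2 dvd_def mult.commute)
    have "d * H div g = e" using e g0 by simp
    then have cop: "coprime r e"
      using div_gcd_coprime[of N "d * H"] N unfolding r_def g_def[symmetric] by simp
    have order: "(z ^ H) ^ k = 1 \<longleftrightarrow> r dvd k" for k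
    proof -
      have "(z ^ H) ^ k = \<zeta> ^ (d * H * k)" by (simp add: z_def power_mult)
      moreover have "d * H * k = e * k * g" using e by simp
      ultimately have "(z ^ H) ^ k = 1 \<longleftrightarrow> r * g dvd e * k * g" using prim Nrg by simp
      also have "\<dots> \<longleftrightarrow> r dvd e * k" using g0 by (simp add: dvd_mult_cancel2)
      also have "\<dots> \<longleftrightarrow> r dvd k" using cop by (rule coprime_dvd_mult_right_iff)
      finally show ?thesis .
    qed
    have orb: "(z ^ H) ^ k * c \<in> chi ` Y" for k using chi_orbit c by blast
    have drN: "d * r dvd N"
    proof -
      have "d dvd g" using dN by (simp add: g_def)
      then show ?thesis using Nrg by (metis mult.commute mult_dvd_mono dvd_refl)
    qed
    have inj_r: "card ((\<lambda>k. (z ^ H) ^ k * c) ` {..<r}) = r"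
    proof -
      have "inj_on (\<lambda>k. (z ^ H) ^ k * c) {..<r}"
      proof -
        have "i = j" if "i < r" "j < r" "i \<le> j" "(z ^ H) ^ i * c = (z ^ H) ^ j * c" for i j
        proof -
          have "(z ^ H) ^ j = (z ^ H) ^ i * (z ^ H) ^ (j - i)" using that by (simp flip: power_add)
          then have "(z ^ H) ^ (j - i) = 1" using that c z0 by auto
          then have "r dvd j - i" using order by simp
          then show ?thesis using that by (auto dest: dvd_imp_le)
        qed
        then show ?thesis by (intro inj_onI) (metis lessThan_iff linear)
      qed
      then show ?thesis by (simp add: card_image)
    qed
    have sc: "real (m * H) * real d / real N = real (m * e) / real r"
    proof -
      have "real H * real d = real e * real g" using e by (metis mult.commute of_nat_mult)
      then have "real (m * H) * real d = real (m * e) * real g" by simp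
      then show ?thesis using g0 by (simp only: Nrg of_nat_mult) (simp add: field_simps)
    qed
    define rhs where "rhs = (\<lambda>d Y G. \<exists>h b. merle_seq0 h b \<and> b 0 = card Y \<and>
       merle_ms h b = image_mset (\<lambda>s. real s * real d / real N) (polar_ms Y G))"
    have IH: "conjugate_set (z ^ r) (cls c) \<longleftrightarrow> rhs (d * r) (cls c) (gcls c)"
      if O: "chi ` Y = (\<lambda>k. (z ^ H) ^ k * c) ` {..<r}"
    proof -
      have "r \<ge> 2" using O inj_r t2 by simp
      have "card Y = r * card (cls c)" by (rule card_Y_orbit[OF order r0 c(2) O])
      moreover have "cls c \<noteq> {}" using c by (auto simp: cls_def)
      moreover have "finite (cls c)" using fin by (simp add: cls_def)
      ultimately have "card (cls c) < card Y" using \<open>r \<ge> 2\<close>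
        by (metis One_nat_def card_gt_0_iff less_le_trans lessI n_less_m_mult_n numeral_2_eq_2)
      then have "conjugate_set (\<zeta> ^ (d * r)) (cls c) \<longleftrightarrow> rhs (d * r) (cls c) (gcls c)"
        unfolding rhs_def
        using drN \<open>finite (cls c)\<close> \<open>cls c \<noteq> {}\<close> rolle_cls[OF c(1)]
          twist_r_cls[OF order r0 c(2) that] twist_r_gcls[OF order r0 c(2) that]
        by (intro less.hyps) (simp_all add: z_def power_mult)
      then show ?thesis by (simp add: z_def power_mult)
    qed
    show ?thesis
    proof
      assume L: "conjugate_set (\<zeta> ^ d) Y"
      have O: "chi ` Y = (\<lambda>k. (z ^ H) ^ k * c) ` {..<r}"
      proof
        show "(\<lambda>k. (z ^ H) ^ k * c) ` {..<r} \<subseteq> chi ` Y" using orb by blast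
        show "chi ` Y \<subseteq> (\<lambda>k. (z ^ H) ^ k * c) ` {..<r}"
        proof
          fix c' assume "c' \<in> chi ` Y"
          then obtain x y where "x \<in> Y" "chi x = c" "y \<in> Y" "chi y = c'" using c by auto
          moreover then obtain k where "y = twist (z ^ k) x" using L by (auto simp: conjugate_set_def z_def)
          ultimately have "c' = (z ^ H) ^ k * c" using chi_twist_power by simp
          also have "(z ^ H) ^ k = (z ^ H) ^ (r * (k div r)) * (z ^ H) ^ (k mod r)"
            by (simp flip: power_add)
          also have "(z ^ H) ^ (r * (k div r)) = 1" using order by simp
          finally show "c' \<in> (\<lambda>k. (z ^ H) ^ k * c) ` {..<r}" using r0 by auto
        qed
      qed
      define m' where "m' = card (cls c)"
      have mm: "m = r * m'" unfolding m_def m'_def by (rule card_Y_orbit[OF order r0 c(2) O])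
      have r2: "r \<ge> 2" using O inj_r t2 by simp
      have m'0: "m' > 0" using mm m2 by (intro Nat.gr0I) auto
      have "conjugate_set (z ^ r) (cls c)"
        using L conjugate_set_orbit[OF order r0 c(2) O] by (simp add: z_def)
      then obtain h b' where b': "merle_seq0 h b'" "b' 0 = m'"
        and ms': "merle_ms h b' = image_mset (\<lambda>s. real s * real (d * r) / real N) (polar_ms (cls c) (gcls c))"
        using IH[OF O] unfolding rhs_def m'_def by blast
      define B where "B = m' * e"
      have "gcd (r * b' 0) B = b' 0"
        using cop by (simp add: b' B_def mult.commute[of r] gcd_mult_distrib_nat[symmetric])
      then obtain b M where sh: "merle_shift h b b' M" and b: "b 0 = r * b' 0" "b 1 = B" "merle_n b 1 = r"
        and M: "\<And>k. k \<in> {1..h} \<Longrightarrow> M k = (\<Prod>j=1..<k. merle_n b' j) * (merle_n b 1 - 1)"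
        using merle_shift_up[of b' r B h] b' m'0 r0 by metis
      interpret merle_shift h b b' M by (rule sh)
      have B_eq: "real B = real m' * real H * real d * real r / real N"
        using sc r0 by (simp add: mm B_def field_simps)
      have "e \<noteq> 0" using cop r2 by (intro notI) simp
      then have B0: "B > 0" using m'0 by (simp add: B_def)
      have "b' 1 > B" if "h \<ge> 1"
      proof -
        have "real (b' 1) \<in># merle_ms h b'" using merle_ms_first b' that by blast
        then obtain s where s: "s \<in># polar_ms (cls c) (gcls c)" "real (b' 1) = real s * real (d * r) / real N"
          unfolding ms' by auto
        have "m' * H < s" using polar_ms_cls_gt[OF c(1) s(1)] by (simp add: m'_def)
        then have "real (m' * H) < real s" by (simp only: of_nat_less_iff)
        then have "real (m' * H) * (real (d * r) / real N) < real s * (real (d * r) / real N)"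
          using d r0 N by (intro mult_strict_right_mono) auto
        then have "real B < real (b' 1)" using s(2) B_eq by (simp add: ac_simps)
        then show ?thesis by simp
      qed
      then have seq: "merle_seq0 (Suc h) b"
        using merle_seq0_Suc_iff[OF M] b b' r2 B0 by simp
      have "merle_ms (Suc h) b = replicate_mset (r - 1) (real B) +
          repeat_mset r (image_mset (\<lambda>s. (s + (real r - 1) * real B) / real r) (merle_ms h b'))"
        using merle_ms_Suc[OF M] b b' by (auto simp: merle_seq0_def)
      also have "real B = real (m * H) * real d / real N"
        using B_eq by (simp add: mm ac_simps)
      also have "image_mset (\<lambda>s. (s + (real r - 1) * (real (m * H) * real d / real N)) / real r) (merle_ms h b') =
          image_mset (\<lambda>s. real s * real d / real N) (image_mset (\<lambda>s. s + (m - m') * H) (polar_ms (cls c) (gcls c)))"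
        unfolding ms' multiset.map_comp
      proof (rule image_mset_cong)
        fix s
        have "m - m' = (r - 1) * m'" by (simp add: mm diff_mult_distrib)
        then have "real ((m - m') * H) = (real r - 1) * real m' * real H" using r0 by (simp add: of_nat_diff)
        then show "((\<lambda>s. (s + (real r - 1) * (real (m * H) * real d / real N)) / real r) \<circ> (\<lambda>s. real s * real (d * r) / real N)) s =
            ((\<lambda>s. real s * real d / real N) \<circ> (\<lambda>s. s + (m - m') * H)) s"
          using r0 N by (simp add: mm field_simps)
      qed
      finally have "merle_ms (Suc h) b = image_mset (\<lambda>s. real s * real d / real N) (polar_ms Y G)"
        using polar_ms_orbit_decomp[OF order r0 c(2) O]
        by (simp add: m_def m'_def image_mset_repeat_mset)
      then show "\<exists>h b. merle_seq0 h b \<and> b 0 = card Y \<and>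
          merle_ms h b = image_mset (\<lambda>s. real s * real d / real N) (polar_ms Y G)"
        using seq b b' mm by (metis m_def)
    next
      assume "\<exists>h b. merle_seq0 h b \<and> b 0 = card Y \<and>
          merle_ms h b = image_mset (\<lambda>s. real s * real d / real N) (polar_ms Y G)"
      then obtain h0 b where b: "merle_seq0 h0 b" "b 0 = m"
        and ms: "merle_ms h0 b = image_mset (\<lambda>s. real s * real d / real N) (polar_ms Y G)"
        unfolding m_def by blast
      have "h0 \<noteq> 0" using b m2 by (intro notI) (simp add: merle_seq0_def)
      then obtain h where h0: "h0 = Suc h" by (cases h0) auto
      obtain b' M where sh: "merle_shift h b b' M"
        and M: "\<And>k. k \<in> {1..h} \<Longrightarrow> M k = (\<Prod>j=1..<k. merle_n b' j) * (merle_n b 1 - 1)"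
        using merle_shift_down b h0 by metis
      interpret merle_shift h b b' M by (rule sh)
      let ?n = "merle_n b 1" let ?t = "card (chi ` Y)"
      have n1: "?n > 1" and b1: "b 1 > 0" and b': "merle_seq0 h b'" and bb: "h \<ge> 1 \<Longrightarrow> b 1 < b' 1"
        using merle_seq0_Suc_iff[OF M] b(1) h0 by auto
      let ?f = "\<lambda>s. (s + (real ?n - 1) * real (b 1)) / real ?n"
      let ?A = "repeat_mset ?n (image_mset ?f (merle_ms h b'))"
      have msb: "merle_ms h0 b = replicate_mset (Suc (?n - 2)) (real (b 1)) + ?A"
      proof -
        have "\<And>k. k \<in> {1..h} \<Longrightarrow> merle_n b' k > 1" using b' by (auto simp: merle_seq0_def)
        note merle_ms_Suc[OF M this]
        moreover have "?n - 1 = Suc (?n - 2)" using n1 by linarith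
        ultimately show ?thesis unfolding h0 by (simp only:)
      qed
      let ?g = "\<lambda>s. real s * real d / real N"
      let ?B = "image_mset ?g (\<Sum>c\<in>chi ` Y. image_mset (\<lambda>s. s + (card Y - card (cls c)) * H) (polar_ms (cls c) (gcls c)))"
      have msp: "merle_ms h0 b = replicate_mset (Suc (?t - 2)) (?g (m * H)) + ?B"
      proof -
        have "?t - 1 = Suc (?t - 2)" using t2 by linarith
        then show ?thesis unfolding ms polar_ms_decomp m_def
          by (simp only: image_mset_union image_replicate_mset)
      qed
      have A: "s > real (b 1)" if "s \<in># ?A" for s
      proof -
        from that obtain x where x: "x \<in># merle_ms h b'" "s = ?f x"
          by (auto simp: in_repeat_mset)
        have "h \<ge> 1" using x by (cases h) auto
        then have "x > real (b 1)" using merle_ms_ge[OF b' x(1)] bb by simp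
        then have "real (b 1) * real ?n < x + (real ?n - 1) * real (b 1)" by (simp add: algebra_simps)
        moreover have "real ?n > 0" using n1 by simp
        ultimately show ?thesis unfolding x(2) by (simp only: pos_less_divide_eq)
      qed
      have B: "s > ?g (m * H)" if "s \<in># ?B" for s
      proof -
        from that obtain l where l: "s = ?g l"
          "l \<in># (\<Sum>c\<in>chi ` Y. image_mset (\<lambda>s. s + (card Y - card (cls c)) * H) (polar_ms (cls c) (gcls c)))"
          by (metis (no_types, lifting) image_iff set_image_mset)
        then obtain c' x where x: "c' \<in> chi ` Y" "x \<in># polar_ms (cls c') (gcls c')"
          "l = x + (card Y - card (cls c')) * H"
          unfolding set_mset_sum[OF finite_imageI[OF fin]] by auto
        have le: "card (cls c') \<le> card Y" using fin by (intro card_mono) (auto simp: cls_def)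
        have "m * H = card (cls c') * H + (card Y - card (cls c')) * H"
          using le by (simp add: m_def flip: add_mult_distrib)
        also have "\<dots> < x + (card Y - card (cls c')) * H" using polar_ms_cls_gt[OF x(1,2)] by simp
        finally have "real (m * H) < real (x + (card Y - card (cls c')) * H)" by (simp only: of_nat_less_iff)
        then show ?thesis unfolding l(1) x(3) using d N by (intro divide_strict_right_mono mult_strict_right_mono) auto
      qed
      note e2 = trans[OF msb[symmetric] msp]
      have b1_eq: "real (b 1) = ?g (m * H)" by (rule min_and_count_eq(1)[OF e2 A B])
      have "?n - 2 = ?t - 2" by (rule min_and_count_eq(2)[OF e2 A B])
      then have nt: "?n = ?t" using n1 t2 by linarith
      have "real (b 1 * N) = real (m * (d * H))" using b1_eq N by (simp add: field_simps)
      then have "m * (d * H) = b 1 * N" by (simp only: of_nat_eq_iff)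
      then have "m div gcd m (b 1) = N div gcd N (d * H)"
        using m2 N by (intro div_gcd_cross) auto
      then have nr: "?n = r" using merle_n_1 b b'0 by (simp add: r_def)
      have O: "chi ` Y = (\<lambda>k. (z ^ H) ^ k * c) ` {..<r}"
        using orb inj_r nt nr fin by (intro card_subset_eq[symmetric]) auto
      define m' where "m' = card (cls c)"
      have mm: "m = r * m'" unfolding m_def m'_def by (rule card_Y_orbit[OF order r0 c(2) O])
      have b'm: "b' 0 = m'" using b0_eq mm b nr r0 by simp
      have "merle_ms h0 b = replicate_mset (Suc (?n - 2)) (real (b 1)) +
         repeat_mset r (image_mset ?g (image_mset (\<lambda>s. s + (m - m') * H) (polar_ms (cls c) (gcls c))))"
      proof -
        have "r - 1 = Suc (?n - 2)" using n1 nr by linarith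
        then show ?thesis
          unfolding ms polar_ms_orbit_decomp[OF order r0 c(2) O] b1_eq m_def m'_def
          by (simp only: image_mset_union image_replicate_mset image_mset_repeat_mset)
      qed
      with msb have "repeat_mset r (image_mset ?f (merle_ms h b')) =
         repeat_mset r (image_mset ?g (image_mset (\<lambda>s. s + (m - m') * H) (polar_ms (cls c) (gcls c))))"
        using nr by simp
      then have eq: "image_mset ?f (merle_ms h b') =
         image_mset ?g (image_mset (\<lambda>s. s + (m - m') * H) (polar_ms (cls c) (gcls c)))"
        by (rule repeat_mset_cancel[OF r0])
      let ?f' = "\<lambda>s. real r * s - (real r - 1) * real (b 1)"
      have "image_mset ?f' (image_mset ?f (merle_ms h b')) = image_mset (\<lambda>s. s) (merle_ms h b')"
        unfolding multiset.map_comp nr by (rule image_mset_cong) (use r0 in simp)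
      then have "merle_ms h b' = image_mset ?f' (image_mset ?f (merle_ms h b'))" by simp
      also have "\<dots> = image_mset (\<lambda>s. real s * real (d * r) / real N) (polar_ms (cls c) (gcls c))"
        unfolding eq multiset.map_comp
      proof (rule image_mset_cong)
        fix s
        have "m - m' = (r - 1) * m'" by (simp add: mm diff_mult_distrib)
        then have "real ((m - m') * H) = (real r - 1) * real m' * real H" using r0 by (simp add: of_nat_diff)
        then show "(?f' \<circ> (?g \<circ> (\<lambda>s. s + (m - m') * H))) s = real s * real (d * r) / real N"
          unfolding o_def b1_eq
          using r0 N by (simp add: mm field_simps)
      qed
      finally have "rhs (d * r) (cls c) (gcls c)" using b' b'm unfolding rhs_def m'_def by blast
      then have "conjugate_set (z ^ r) (cls c)" using IH[OF O] by blast
      then show "conjugate_set (\<zeta> ^ d) Y"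
        using conjugate_set_orbit[OF order r0 c(2) O] by (simp add: z_def)
    qed
  qed
qed

section \<open>Roots of a polynomial and of its derivative in a ball\<close>

definition red :: "complex fps poly \<Rightarrow> complex poly" where
  "red = map_poly (\<lambda>a. fps_nth a 0)"

lemma coeff_red [simp]: "coeff (red f) i = fps_nth (coeff f i) 0"
  by (simp add: red_def coeff_map_poly)

lemma red_0 [simp]: "red 0 = 0" and red_1 [simp]: "red 1 = 1"
  by (auto simp: poly_eq_iff)

lemma red_mult [simp]: "red (f * g) = red f * red g"
  by (rule poly_eqI) (simp add: coeff_mult fps_sum_nth)

lemma red_smult [simp]: "red (smult a f) = smult (fps_nth a 0) (red f)"
  by (rule poly_eqI) simp

lemma red_pderiv [simp]: "red (pderiv f) = pderiv (red f)"
  by (rule poly_eqI) (simp add: coeff_pderiv flip: fps_of_nat)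

lemma red_pCons [simp]: "red (pCons a f) = pCons (fps_nth a 0) (red f)"
  by (rule poly_eqI) (simp add: coeff_pCons split: nat.splits)

definition roots_poly :: "'a::idom multiset \<Rightarrow> 'a poly" where
  "roots_poly R = (\<Prod>r\<in>#R. [:- r, 1:])"

lemma roots_poly_empty [simp]: "roots_poly {#} = 1"
  and roots_poly_add [simp]: "roots_poly (add_mset r R) = [:- r, 1:] * roots_poly R"
  by (simp_all add: roots_poly_def)

lemma roots_poly_union [simp]: "roots_poly (R + S) = roots_poly R * roots_poly S"
  by (simp add: roots_poly_def)

lemma roots_poly_neq_0 [simp]: "roots_poly R \<noteq> 0"
  by (induction R) (simp_all del: mult_pCons_left)

lemma degree_roots_poly [simp]: "degree (roots_poly R) = size R"
proof (induction R)
  case (add r R)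
  have "degree ([:- r, 1:] * roots_poly R) = 1 + degree (roots_poly R)"
    by (subst degree_mult_eq) (simp_all del: mult_pCons_left)
  then show ?case using add by simp
qed simp

lemma monic_roots_poly [simp]: "lead_coeff (roots_poly R) = 1"
  by (induction R) (simp_all add: lead_coeff_mult del: mult_pCons_left)

lemma poly_roots_poly: "poly (roots_poly R) x = (\<Prod>r\<in>#R. x - r)"
  by (induction R) (simp_all add: algebra_simps)

text \<open>
  The substitution \<open>u = y + X^h z\<close> turns the roots of \<open>f\<close> in the ball of radius \<open>h\<close> about \<open>y\<close> into
  integral values of \<open>z\<close>; the other roots only contribute constants after reduction.
\<close>

lemma ball_reduction:
  obtains k c g where "c \<noteq> 0" "pcompose (roots_poly R) [:y, fps_X ^ h:] = smult (fps_X ^ k) g"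
    "red g = smult c (roots_poly (image_mset (\<lambda>r. fps_nth r h - fps_nth y h) (filter_mset (near h y) R)))"
proof (induction R arbitrary: thesis)
  case empty
  show ?case by (rule empty(1)[of 1 0 1]) (simp_all add: pcompose_1)
next
  case (add r R)
  obtain k c g where IH: "c \<noteq> 0" "pcompose (roots_poly R) [:y, fps_X ^ h:] = smult (fps_X ^ k) g"
    "red g = smult c (roots_poly (image_mset (\<lambda>r. fps_nth r h - fps_nth y h) (filter_mset (near h y) R)))"
    using add.IH by metis
  have lin: "pcompose [:- r, 1:] [:y, fps_X ^ h:] = [:y - r, fps_X ^ h:]"
    by (simp add: pcompose_pCons)
  show ?case
  proof (cases "near h y r")
    case True
    define q where "q = fps_shift h (y - r)"
    have q: "y - r = fps_X ^ h * q"
      using True by (intro fps_ext) (auto simp: q_def fps_X_power_mult_nth near_def)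
    have "pcompose (roots_poly (add_mset r R)) [:y, fps_X ^ h:] =
        pcompose [:- r, 1:] [:y, fps_X ^ h:] * pcompose (roots_poly R) [:y, fps_X ^ h:]"
      by (simp only: roots_poly_add pcompose_mult)
    also have "\<dots> = smult (fps_X ^ (h + k)) ([:q, 1:] * g)"
      by (simp only: lin IH(2)) (simp add: q power_add smult_add_right algebra_simps)
    finally have e: "pcompose (roots_poly (add_mset r R)) [:y, fps_X ^ h:] = smult (fps_X ^ (h + k)) ([:q, 1:] * g)" .
    have "red ([:q, 1:] * g) = smult c (roots_poly (image_mset (\<lambda>r. fps_nth r h - fps_nth y h) (filter_mset (near h y) (add_mset r R))))"
      using True by (simp only: red_mult IH(3)) (simp add: q_def algebra_simps)
    then show ?thesis using add.prems[OF IH(1) e] by blast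
  next
    case False
    then have yr: "y \<noteq> r" by auto
    define s where "s = subdegree (y - r)"
    have s: "s < h" using False near_iff_subdegree[OF yr] by (simp add: s_def)
    define q where "q = fps_shift s (y - r)"
    have q: "y - r = fps_X ^ s * q"
      unfolding q_def s_def by (metis mult.commute subdegree_decompose)
    have "fps_nth (y - r) s \<noteq> 0" unfolding s_def using yr by (intro nth_subdegree_nonzero) simp
    then have q0: "fps_nth q 0 \<noteq> 0" by (simp add: q_def)
    have hs: "fps_X ^ h = fps_X ^ s * (fps_X ^ (h - s) :: complex fps)" using s by (simp flip: power_add)
    have "pcompose (roots_poly (add_mset r R)) [:y, fps_X ^ h:] =
        pcompose [:- r, 1:] [:y, fps_X ^ h:] * pcompose (roots_poly R) [:y, fps_X ^ h:]"
      by (simp only: roots_poly_add pcompose_mult)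
    also have "\<dots> = smult (fps_X ^ (s + k)) ([:q, fps_X ^ (h - s):] * g)"
      by (simp only: lin IH(2)) (simp add: q hs power_add smult_add_right algebra_simps)
    finally have e: "pcompose (roots_poly (add_mset r R)) [:y, fps_X ^ h:] =
        smult (fps_X ^ (s + k)) ([:q, fps_X ^ (h - s):] * g)" .
    have "fps_nth (fps_X ^ (h - s)) 0 = (0::complex)" using s by simp
    then have "red ([:q, fps_X ^ (h - s):] * g) = smult (fps_nth q 0 * c) (roots_poly (image_mset (\<lambda>r. fps_nth r h - fps_nth y h) (filter_mset (near h y) (add_mset r R))))"
      using False by (simp only: red_mult IH(3) red_pCons) (simp add: mult.commute)
    with e show ?thesis using add.prems[of "fps_nth q 0 * c"] q0 IH(1) by simp
  qed
qed

lemma smult_X_power_cancel: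
  fixes f g :: "complex fps poly"
  assumes "smult (fps_X ^ a) f = smult (fps_X ^ b) g" "red f \<noteq> 0" "red g \<noteq> 0"
  shows "f = g"
proof -
  have "f = g" if e: "smult (fps_X ^ a) f = smult (fps_X ^ b) g" and "a \<le> b" and f: "red f \<noteq> 0" for a b f g
  proof -
    have "smult (fps_X ^ a) f = smult (fps_X ^ a) (smult (fps_X ^ (b - a)) g)"
      using e \<open>a \<le> b\<close> by (simp flip: power_add)
    then have "smult (fps_X ^ a) (f - smult (fps_X ^ (b - a)) g) = 0"
      by (simp add: smult_diff_right)
    then have fg: "f = smult (fps_X ^ (b - a)) g" by (subst (asm) smult_eq_0_iff) simp
    have "b - a = 0"
    proof (rule ccontr)
      assume "b - a \<noteq> 0"
      then have "red f = 0" by (subst fg) simp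
      then show False using f by simp
    qed
    then show ?thesis using fg by simp
  qed
  from this[of a f b g] this[of b g a f] assms show ?thesis by (metis nat_le_linear)
qed

lemma rolleI:
  assumes der: "pderiv (roots_poly (mset_set Y)) = smult (of_nat n) (roots_poly G)" and n: "n > 0" and fin: "finite Y"
  shows "rolle Y G"
  unfolding rolle_def
proof (intro ballI allI)
  fix y h assume y: "y \<in> Y"
  let ?q = "[:y, fps_X ^ h:]"
  obtain k c g where F: "c \<noteq> 0" "pcompose (roots_poly (mset_set Y)) ?q = smult (fps_X ^ k) g"
    "red g = smult c (roots_poly (image_mset (\<lambda>r. fps_nth r h - fps_nth y h) (filter_mset (near h y) (mset_set Y))))"
    by (rule ball_reduction)
  obtain k' c' g' where G: "c' \<noteq> 0" "pcompose (roots_poly G) ?q = smult (fps_X ^ k') g'"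
    "red g' = smult c' (roots_poly (image_mset (\<lambda>r. fps_nth r h - fps_nth y h) (filter_mset (near h y) G)))"
    by (rule ball_reduction)
  have m: "size (filter_mset (near h y) (mset_set Y)) = card {y' \<in> Y. near h y y'}"
    using fin by (simp add: filter_mset_mset_set)
  have pos: "card {y' \<in> Y. near h y y'} > 0" using y fin by (auto simp: card_gt_0_iff)
  have dg: "degree (red g) = card {y' \<in> Y. near h y y'}"
    using F(1) m by (simp add: F(3))
  have "smult (fps_X ^ k) (pderiv g) = pderiv (pcompose (roots_poly (mset_set Y)) ?q)"
    by (simp add: F(2) pderiv_smult)
  also have "\<dots> = pcompose (smult (of_nat n) (roots_poly G)) ?q * pderiv ?q"
    by (simp add: pderiv_pcompose der)
  also have "pderiv ?q = [:fps_X ^ h:]" by (simp add: pderiv_pCons)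
  finally have e: "smult (fps_X ^ k) (pderiv g) = smult (fps_X ^ (h + k')) (smult (of_nat n) g')"
    by (simp add: pcompose_smult G(2) power_add ac_simps)
  have "pderiv (red g) \<noteq> 0" using dg pos by (auto simp: pderiv_eq_0_iff)
  moreover have rg': "red (smult (of_nat n) g') \<noteq> 0" using G n by (simp flip: fps_of_nat)
  ultimately have "pderiv g = smult (of_nat n) g'"
    using smult_X_power_cancel[OF e] by simp
  then have "pderiv (red g) = smult (of_nat n) (red g')"
    using red_pderiv[of g] by (simp flip: fps_of_nat)
  then have "degree (red g) - 1 = degree (red g')"
    using n by (metis degree_pderiv degree_smult_eq of_nat_eq_0_iff less_numeral_extra(3))
  moreover have "degree (red g') = size (filter_mset (near h y) G)" using G(1) by (simp add: G(3))
  ultimately show "size (filter_mset (near h y) G) + 1 = card {y' \<in> Y. near h y y'}"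
    using dg pos by simp
qed

section \<open>Puiseux's theorem\<close>

definition slice :: "nat \<Rightarrow> complex fps poly \<Rightarrow> complex poly" where
  "slice k f = map_poly (\<lambda>a. fps_nth a k) f"

lemma coeff_slice [simp]: "coeff (slice k f) i = fps_nth (coeff f i) k"
  by (simp add: slice_def coeff_map_poly)

lemma degree_less_iff: "n > 0 \<Longrightarrow> (\<And>i. i \<ge> n \<Longrightarrow> coeff f i = 0) \<Longrightarrow> degree f < n"
proof (rule ccontr)
  assume n: "n > 0" and c: "\<And>i. i \<ge> n \<Longrightarrow> coeff f i = 0" and "\<not> degree f < n"
  then have "coeff f (degree f) = 0" by (intro c) linarith
  then have "f = 0" by simp
  then show False using n \<open>\<not> degree f < n\<close> by simp
qed

lemma bezout_degree:
  fixes A B E :: "complex poly"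
  assumes "coprime A B" "degree E < degree A + degree B" "degree A > 0" "degree B > 0"
  obtains a b where "degree a < degree A" "degree b < degree B" "A * b + B * a = E"
proof -
  obtain s t where st: "s * A + t * B = 1"
  proof (rule that)
    show "fst (bezout_coefficients A B) * A + snd (bezout_coefficients A B) * B = 1"
      using assms(1) by (simp add: bezout_coefficients_fst_snd)
  qed
  define a where "a = (t * E) mod A"
  have A0: "A \<noteq> 0" "B \<noteq> 0" using assms by auto
  have a: "degree a < degree A" unfolding a_def using assms(3) A0 degree_mod_less'[of A "t * E"]
    by (cases "(t * E) mod A = 0") auto
  have "A dvd E - B * a"
  proof -
    have te: "t * E = A * ((t * E) div A) + a" by (simp add: a_def)
    have "E = (s * A + t * B) * E" using st by simp
    also have "\<dots> = A * (s * E) + B * (t * E)" by (simp add: algebra_simps)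
    also have "\<dots> = A * (s * E) + B * (A * ((t * E) div A) + a)" by (subst te) (rule refl)
    also have "\<dots> = A * (s * E + B * ((t * E) div A)) + B * a" by (simp add: algebra_simps)
    finally have "E - B * a = A * (s * E + B * ((t * E) div A))" by (simp only: diff_eq_eq)
    then show ?thesis by simp
  qed
  then obtain b where b: "E - B * a = A * b" by blast
  have "degree b < degree B"
  proof (cases "b = 0")
    case False
    have "degree (B * a) < degree A + degree B"
      using a degree_mult_le[of B a] by linarith
    then have "degree (A * b) < degree A + degree B" unfolding b[symmetric]
      using assms(2) by (metis degree_diff_less)
    then show ?thesis using False A0 by (simp add: degree_mult_eq)
  qed (use assms in simp)
  with a b that show thesis by (metis add.commute diff_add_cancel)
qed

lemma hensel:
  fixes g :: "complex fps poly" and A B :: "complex poly"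
  assumes g: "lead_coeff g = 1" and red: "red g = A * B" and "coprime A B"
    and A: "lead_coeff A = 1" "degree A > 0" and B: "lead_coeff B = 1" "degree B > 0"
  obtains G1 G2 where "g = G1 * G2" "lead_coeff G1 = 1" "lead_coeff G2 = 1"
    "degree G1 = degree A" "degree G2 = degree B"
proof -
  have dg: "degree g = degree A + degree B"
  proof -
    have "degree (red g) \<le> degree g" by (rule degree_le) (simp add: coeff_eq_0)
    moreover have "coeff (red g) (degree g) = 1" using g by simp
    ultimately have "degree (red g) = degree g" by (metis le_antisym le_degree zero_neq_one)
    then show ?thesis using red A B by (metis degree_mult_eq leading_coeff_0_iff zero_neq_one)
  qed
  define P where "P = (\<lambda>(f :: nat \<Rightarrow> complex poly \<times> complex poly) k c.
    if k = 0 then c = (A, B) else degree (fst c) < degree A \<and> degree (snd c) < degree B \<and>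
      A * snd c + B * fst c = slice k g - (\<Sum>i\<in>{1..<k}. fst (f i) * snd (f (k - i))))"
  have "\<exists>f. \<forall>k. P f k (f k)"
  proof (rule dependent_wellorder_choice)
    fix c k and f f' :: "nat \<Rightarrow> complex poly \<times> complex poly"
    assume "\<And>y. y < k \<Longrightarrow> f y = f' y"
    then have "(\<Sum>i\<in>{1..<k}. fst (f i) * snd (f (k - i))) = (\<Sum>i\<in>{1..<k}. fst (f' i) * snd (f' (k - i)))"
      by (intro sum.cong) auto
    then show "P f k c = P f' k c" unfolding P_def by simp
  next
    fix k f assume IH: "\<And>y. y < k \<Longrightarrow> P f y (f y)"
    show "\<exists>c. P f k c"
    proof (cases "k = 0")
      case False
      let ?S = "\<Sum>i\<in>{1..<k}. fst (f i) * snd (f (k - i))"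
      have "degree (slice k g) < degree A + degree B"
      proof (rule degree_less_iff)
        fix i assume "i \<ge> degree A + degree B"
        then show "coeff (slice k g) i = 0"
          proof (cases "i = degree g")
          case True
          then show ?thesis using g False by simp
        next
          case n: False
          then have "degree g < i" using dg \<open>i \<ge> degree A + degree B\<close> by linarith
          then show ?thesis by (simp add: coeff_eq_0)
        qed
      qed (use A in simp)
      moreover have "degree (fst (f i) * snd (f (k - i))) < degree A + degree B" if "i \<in> {1..<k}" for i
        using IH[of i] IH[of "k - i"] that degree_mult_le[of "fst (f i)" "snd (f (k - i))"]
        by (auto simp: P_def)
      then have "degree ?S < degree A + degree B"
        using A by (intro degree_sum_less) auto
      ultimately have "degree (slice k g - ?S) < degree A + degree B" by (rule degree_diff_less)
      from bezout_degree[OF \<open>coprime A B\<close> this A(2) B(2)]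
      obtain a b where "degree a < degree A" "degree b < degree B" "A * b + B * a = slice k g - ?S" .
      then show ?thesis using False by (intro exI[of _ "(a, b)"]) (simp add: P_def)
    qed (simp add: P_def)
  qed
  then obtain f where f: "\<And>k. P f k (f k)" by blast
  have f0: "f 0 = (A, B)" using f[of 0] by (simp add: P_def)
  have fS: "degree (fst (f k)) < degree A" "degree (snd (f k)) < degree B"
    "A * snd (f k) + B * fst (f k) = slice k g - (\<Sum>i\<in>{1..<k}. fst (f i) * snd (f (k - i)))"
    if "k > 0" for k using f[of k] that by (auto simp: P_def)
  have conv: "(\<Sum>i\<in>{0..k}. fst (f i) * snd (f (k - i))) = slice k g" for k
  proof (cases "k = 0")
    case True
    then show ?thesis using red f0 by (simp add: poly_eq_iff flip: coeff_red)
  next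
    case False
    then have "{0..k} = insert 0 (insert k {1..<k})" by auto
    then show ?thesis using fS(3)[of k] False f0 by (simp add: algebra_simps)
  qed
  define mk where "mk = (\<lambda>d (p :: nat \<Rightarrow> complex poly). \<Sum>i\<le>d. monom (Abs_fps (\<lambda>k. coeff (p k) i)) i)"
  have mk: "fps_nth (coeff (mk d p) i) k = coeff (p k) i" if "\<And>k. degree (p k) \<le> d" for d p i k
  proof (cases "i \<le> d")
    case True
    then show ?thesis by (simp add: mk_def coeff_sum)
  next
    case False
    then show ?thesis using that[of k] by (simp add: mk_def coeff_sum coeff_eq_0)
  qed
  define G1 where "G1 = mk (degree A) (\<lambda>k. fst (f k))"
  define G2 where "G2 = mk (degree B) (\<lambda>k. snd (f k))"
  have d1: "degree (fst (f k)) \<le> degree A" and d2: "degree (snd (f k)) \<le> degree B" for k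
    using f0 fS[of k] by (cases "k = 0"; simp)+
  have G1: "fps_nth (coeff G1 i) k = coeff (fst (f k)) i" for i k
    unfolding G1_def using d1 by (rule mk)
  have G2: "fps_nth (coeff G2 i) k = coeff (snd (f k)) i" for i k
    unfolding G2_def using d2 by (rule mk)
  have "g = G1 * G2"
  proof (intro poly_eqI fps_ext)
    fix i k
    have "fps_nth (coeff (G1 * G2) i) k =
        (\<Sum>j\<le>i. \<Sum>l\<in>{0..k}. coeff (fst (f l)) j * coeff (snd (f (k - l))) (i - j))"
      by (simp add: coeff_mult fps_sum_nth fps_mult_nth G1 G2)
    also have "\<dots> = (\<Sum>l\<in>{0..k}. \<Sum>j\<le>i. coeff (fst (f l)) j * coeff (snd (f (k - l))) (i - j))"
      by (rule sum.swap)
    also have "\<dots> = coeff (\<Sum>l\<in>{0..k}. fst (f l) * snd (f (k - l))) i"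
      by (simp add: coeff_sum coeff_mult)
    finally show "fps_nth (coeff g i) k = fps_nth (coeff (G1 * G2) i) k" by (simp add: conv)
  qed
  moreover have "lead_coeff G1 = 1 \<and> degree G1 = degree A"
  proof -
    have "coeff G1 (degree A) = 1"
    proof (rule fps_ext)
      fix k show "fps_nth (coeff G1 (degree A)) k = fps_nth 1 k"
        using G1[of "degree A" k] A(1) f0 fS(1)[of k] by (cases "k = 0") (auto simp: coeff_eq_0)
    qed
    moreover have "degree G1 \<le> degree A" unfolding G1_def mk_def
      by (intro degree_sum_le) (auto intro: order_trans[OF degree_monom_le])
    ultimately show ?thesis by (metis le_antisym le_degree zero_neq_one)
  qed
  moreover have "lead_coeff G2 = 1 \<and> degree G2 = degree B"
  proof -
    have "coeff G2 (degree B) = 1"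
    proof (rule fps_ext)
      fix k show "fps_nth (coeff G2 (degree B)) k = fps_nth 1 k"
        using G2[of "degree B" k] B(1) f0 fS(2)[of k] by (cases "k = 0") (auto simp: coeff_eq_0)
    qed
    moreover have "degree G2 \<le> degree B" unfolding G2_def mk_def
      by (intro degree_sum_le) (auto intro: order_trans[OF degree_monom_le])
    ultimately show ?thesis by (metis le_antisym le_degree zero_neq_one)
  qed
  ultimately show thesis using that by blast
qed

definition fsub :: "nat \<Rightarrow> complex fps \<Rightarrow> complex fps" where
  "fsub N a = (if N = 0 then fps_const (fps_nth a 0) else a oo (fps_X ^ N))"

lemma fsub_nth: "N > 0 \<Longrightarrow> fps_nth (fsub N a) k = (if N dvd k then fps_nth a (k div N) else 0)"
  by (simp add: fsub_def fps_nth_compose_X_power)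

lemma fsub_0 [simp]: "fsub N 0 = 0" and fsub_1 [simp]: "fsub N 1 = 1"
  and fsub_add: "fsub N (a + b) = fsub N a + fsub N b"
  and fsub_mult: "fsub N (a * b) = fsub N a * fsub N b"
  by (auto simp: fsub_def fps_compose_add_distrib fps_compose_mult_distrib)

interpretation fsub: comm_ring_hom "fsub N" for N
  by unfold_locales (simp_all add: fsub_add fsub_mult)

interpretation psub: map_poly_comm_ring_hom "fsub N" for N ..

lemma fsub_fsub: "N > 0 \<Longrightarrow> M > 0 \<Longrightarrow> fsub M (fsub N a) = fsub (N * M) a"
proof (rule fps_ext)
  fix k assume NM: "N > 0" "M > 0"
  show "fps_nth (fsub M (fsub N a)) k = fps_nth (fsub (N * M) a) k"
  proof (cases "M dvd k")
    case True
    then obtain l where "k = M * l" by blast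
    then show ?thesis using NM by (simp add: fsub_nth mult.commute div_mult2_eq)
  next
    case False
    then have "\<not> N * M dvd k" by (meson dvd_mult_right)
    then show ?thesis using NM False by (simp add: fsub_nth)
  qed
qed

abbreviation psub :: "nat \<Rightarrow> complex fps poly \<Rightarrow> complex fps poly" where
  "psub N \<equiv> map_poly (fsub N)"

lemma psub_psub: "N > 0 \<Longrightarrow> M > 0 \<Longrightarrow> psub M (psub N f) = psub (N * M) f"
  by (rule poly_eqI) (simp add: coeff_map_poly fsub_fsub)

lemma psub_roots_poly: "psub M (roots_poly R) = roots_poly (image_mset (fsub M) R)"
  by (induction R) (simp_all add: psub.hom_mult hom_distribs del: mult_pCons_left)

definition puiseux_split :: "complex fps poly \<Rightarrow> bool" where
  "puiseux_split f \<longleftrightarrow> (\<exists>N>0. \<exists>R. psub N f = roots_poly R)"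

lemma puiseux_splitI: "N > 0 \<Longrightarrow> psub N f = roots_poly R \<Longrightarrow> puiseux_split f"
  by (auto simp: puiseux_split_def)

lemma puiseux_split_mult:
  assumes "puiseux_split f" "puiseux_split g"
  shows "puiseux_split (f * g)"
proof -
  obtain N R where N: "N > 0" "psub N f = roots_poly R" using assms by (auto simp: puiseux_split_def)
  obtain M S where M: "M > 0" "psub M g = roots_poly S" using assms by (auto simp: puiseux_split_def)
  have "psub (N * M) (f * g) = psub (N * M) f * psub (M * N) g"
    by (simp add: psub.hom_mult mult.commute)
  also have "\<dots> = psub M (psub N f) * psub N (psub M g)"
    by (simp only: psub_psub[OF N(1) M(1)] psub_psub[OF M(1) N(1)])
  also have "\<dots> = roots_poly (image_mset (fsub M) R + image_mset (fsub N) S)"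
    by (simp add: N M psub_roots_poly)
  finally show ?thesis using N M unfolding puiseux_split_def by (metis nat_0_less_mult_iff)
qed

lemma puiseux_split_pcompose:
  assumes "puiseux_split (pcompose f [:c, 1:])"
  shows "puiseux_split f"
proof -
  obtain N R where N: "N > 0" "psub N (pcompose f [:c, 1:]) = roots_poly R"
    using assms by (auto simp: puiseux_split_def)
  have tr: "pcompose (roots_poly R) [:- d, 1:] = roots_poly (image_mset (\<lambda>r. r + d) R)" for d :: "complex fps" and R
  proof (induction R)
    case (add r R)
    have "pcompose (roots_poly (add_mset r R)) [:- d, 1:] = pcompose [:- r, 1:] [:- d, 1:] * pcompose (roots_poly R) [:- d, 1:]"
      by (simp only: roots_poly_add pcompose_mult)
    also have "pcompose [:- r, 1:] [:- d, 1:] = [:- (r + d), 1:]" by (simp add: pcompose_pCons)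
    finally show ?case using add by (simp del: mult_pCons_left)
  qed (simp add: pcompose_1)
  have "psub N f = pcompose (psub N (pcompose f [:c, 1:])) [:- fsub N c, 1:]"
    by (simp add: fsub.map_poly_pcompose hom_distribs flip: pcompose_assoc)
  then show ?thesis using N tr unfolding puiseux_split_def by metis
qed

lemma coeff_roots_poly_scale:
  "i \<le> size R \<Longrightarrow> coeff (roots_poly (image_mset ((*) c) R)) i = c ^ (size R - i) * coeff (roots_poly R) i"
proof (induction R arbitrary: i)
  case (add r R)
  let ?P = "roots_poly (image_mset ((*) c) R)" and ?Q = "roots_poly R"
  have a: "coeff (roots_poly (image_mset ((*) c) (add_mset r R))) i =
      (case i of 0 \<Rightarrow> 0 | Suc j \<Rightarrow> coeff ?P j) - c * r * coeff ?P i"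
    by (cases i) (simp_all add: coeff_pCons)
  have b: "coeff (roots_poly (add_mset r R)) i =
      (case i of 0 \<Rightarrow> 0 | Suc j \<Rightarrow> coeff ?Q j) - r * coeff ?Q i"
    by (cases i) (simp_all add: coeff_pCons)
  have P: "c * coeff ?P i = c ^ (size (add_mset r R) - i) * coeff ?Q i"
  proof (cases "i \<le> size R")
    case True
    then show ?thesis using add.IH[of i] by (simp add: Suc_diff_le)
  next
    case False
    then have "coeff ?P i = 0" "coeff ?Q i = 0" by (auto intro!: coeff_eq_0)
    then show ?thesis by simp
  qed
  have "c * r * coeff ?P i = r * (c * coeff ?P i)" by simp
  then have "c * r * coeff ?P i = c ^ (size (add_mset r R) - i) * (r * coeff ?Q i)"
    unfolding P by simp
  then show ?case unfolding a b using add.IH[of "i - 1"] add.prems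
    by (cases i) (simp_all add: right_diff_distrib)
qed simp

lemma coeff_pcompose_shift:
  fixes f :: "'a::comm_ring_1 poly"
  assumes "degree f = Suc n"
  shows "coeff (pcompose f [:c, 1:]) n = coeff f n + of_nat (Suc n) * c * lead_coeff f"
proof -
  have "pcompose f [:c, 1:] = (\<Sum>i\<le>Suc n. [:coeff f i:] * [:c, 1:] ^ i)"
  proof -
    have "coeff f (Suc n) \<noteq> 0" using assms by (metis leading_coeff_0_iff degree_0 nat.distinct(1))
    then have "degree (map_poly (\<lambda>x. [:x:]) f) = Suc n" using assms by (subst degree_map_poly) auto
    then show ?thesis by (simp only: pcompose_altdef poly_altdef) (simp add: coeff_map_poly)
  qed
  then have "coeff (pcompose f [:c, 1:]) n = (\<Sum>i\<le>Suc n. coeff f i * coeff ([:c, 1:] ^ i) n)"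
    by (simp add: coeff_sum)
  also have "\<dots> = (\<Sum>i\<in>{n, Suc n}. coeff f i * coeff ([:c, 1:] ^ i) n)"
  proof (rule sum.mono_neutral_right)
    show "\<forall>i\<in>{..Suc n} - {n, Suc n}. coeff f i * coeff ([:c, 1:] ^ i) n = 0"
    proof
      fix i assume "i \<in> {..Suc n} - {n, Suc n}"
      then have "i < n" by auto
      moreover have "degree ([:c, 1:] ^ i) \<le> i" by (simp only: degree_linear_power order_refl)
      ultimately show "coeff f i * coeff ([:c, 1:] ^ i) n = 0" by (simp add: coeff_eq_0)
    qed
  qed auto
  also have "\<dots> = coeff f n + of_nat (Suc n) * c * lead_coeff f"
    using assms by (simp add: coeff_linear_poly_power algebra_simps del: power_Suc)
  finally show ?thesis .
qed

theorem puiseux: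
  assumes "lead_coeff f = 1"
  shows "puiseux_split f"
  using assms
proof (induction "degree f" arbitrary: f rule: less_induct)
  case less
  show ?case
  proof (cases "degree f")
    case 0
    then have "f = 1" using less.prems by (metis degree_0_id one_pCons)
    then have "psub 1 f = roots_poly {#}" by simp
    then show ?thesis by (rule puiseux_splitI[rotated]) simp
  next
    case (Suc n')
    define n where "n = Suc n'"
    define c where "c = - coeff f n' * fps_const (1 / of_nat n)"
    define f1 where "f1 = pcompose f [:c, 1:]"
    have d1: "degree f1 = n" by (simp add: f1_def degree_pcompose Suc n_def)
    have l1: "coeff f1 n = 1"
      using less.prems lead_coeff_comp[of "[:c, 1:]" f] d1 by (simp add: f1_def)
    have "of_nat n * c = - coeff f n'"
    proof -
      have "of_nat n * fps_const (1 / of_nat n) = (1 :: complex fps)"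
        by (simp add: n_def flip: fps_of_nat del: of_nat_Suc)
      then show ?thesis unfolding c_def by (metis mult.left_commute mult.right_neutral)
    qed
    then have t1: "coeff f1 n' = 0"
      unfolding f1_def using coeff_pcompose_shift[OF Suc, of c] less.prems Suc by (simp add: n_def)
    have "puiseux_split f1"
    proof (cases "\<forall>i<n. coeff f1 i = 0")
      case True
      have "f1 = monom 1 n"
        using True d1 l1 by (intro poly_eqI) (metis coeff_eq_0 coeff_monom linorder_neqE_nat)
      also have "\<dots> = roots_poly (replicate_mset n 0)"
        by (simp add: roots_poly_def monom_altdef)
      finally have "psub 1 f1 = roots_poly (image_mset (fsub 1) (replicate_mset n 0))"
        by (simp add: psub_roots_poly)
      then show ?thesis by (rule puiseux_splitI[rotated]) simp
    next
      case False
      define S where "S = {i. i < n \<and> coeff f1 i \<noteq> 0}"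
      let ?o = "\<lambda>i. subdegree (coeff f1 i)"
      have "finite S" "S \<noteq> {}" using False by (auto simp: S_def)
      then obtain i0 where "is_arg_min (\<lambda>i. real (?o i) / real (n - i)) (\<lambda>i. i \<in> S) i0"
        using ex_is_arg_min_if_finite by metis
      then have i0: "i0 \<in> S" and min: "\<And>i. i \<in> S \<Longrightarrow> real (?o i0) / real (n - i0) \<le> real (?o i) / real (n - i)"
        by (auto simp: is_arg_min_linorder)
      define q where "q = n - i0"
      define p where "p = ?o i0"
      have i0n: "i0 < n" and a0: "coeff f1 i0 \<noteq> 0" using i0 by (auto simp: S_def)
      have q0: "q > 0" using i0n by (simp add: q_def)
      have slope: "p * (n - i) \<le> q * ?o i" if "i \<in> S" for i
      proof -
        have "real p * real (n - i) \<le> real q * real (?o i)"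
          using min[OF that] that i0n by (simp add: S_def p_def q_def field_simps)
        then show ?thesis by (metis of_nat_le_iff of_nat_mult)
      qed
      define G where "G = (\<lambda>i. fps_shift (p * (n - i)) (fsub q (coeff f1 i)))"
      have G: "fsub q (coeff f1 i) = fps_X ^ (p * (n - i)) * G i" if "i \<le> n" for i
      proof (cases "i \<in> S")
        case True
        have "fps_nth (fsub q (coeff f1 i)) k = 0" if "k < p * (n - i)" for k
        proof (cases "q dvd k")
          case d: True
          then obtain l where l: "k = q * l" by blast
          have "q * l < q * ?o i" using slope[OF True] \<open>k < p * (n - i)\<close> unfolding l by (rule less_le_trans[rotated])
          then have "l < ?o i" using q0 by simp
          then have "fps_nth (coeff f1 i) l = 0" by (rule nth_less_subdegree_zero)
          moreover have "fps_nth (fsub q (coeff f1 i)) (q * l) = fps_nth (coeff f1 i) l"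
            using q0 by (simp only: fsub_nth) simp
          ultimately show ?thesis unfolding l by simp
        qed (use q0 in \<open>simp add: fsub_nth\<close>)
        then show ?thesis by (intro fps_ext) (auto simp: G_def fps_X_power_mult_nth)
      next
        case F: False
        then consider "i = n" | "coeff f1 i = 0" using \<open>i \<le> n\<close> by (force simp: S_def)
        then show ?thesis by cases (simp_all add: G_def)
      qed
      define g where "g = (\<Sum>i\<le>n. monom (G i) i)"
      have cg: "coeff g i = (if i \<le> n then G i else 0)" for i
        by (simp add: g_def coeff_sum)
      have Gn: "G n = 1" using G[of n] l1 by simp
      have dg: "degree g = n"
        using Gn cg by (intro antisym degree_le le_degree) auto
      have lg: "lead_coeff g = 1" using Gn cg dg by simp
      have r0: "coeff (red g) i0 \<noteq> 0"
      proof -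
        have "fps_nth (fsub q (coeff f1 i0)) (p * (n - i0)) = fps_nth (coeff f1 i0) p"
          using q0 by (simp add: fsub_nth q_def)
        also have "\<dots> \<noteq> 0" unfolding p_def using a0 by (rule nth_subdegree_nonzero)
        finally show ?thesis using i0n by (simp add: cg G_def)
      qed
      have rn': "coeff (red g) n' = 0" using t1 by (simp add: cg G_def n_def)
      have rn: "coeff (red g) n = 1" using Gn by (simp add: cg)
      have drg: "degree (red g) = n"
        using rn cg by (intro antisym degree_le le_degree) auto
      have rg0: "red g \<noteq> 0" using rn by (metis coeff_0 zero_neq_one)
      obtain z where z: "poly (red g) z = 0"
        using fundamental_theorem_of_algebra[of "red g"] drg by (auto simp: constant_degree n_def)
      define m where "m = order z (red g)"
      have m0: "m > 0" unfolding m_def using z rg0 by (simp add: order_root)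
      define A where "A = [:- z, 1:] ^ m"
      obtain B where AB: "red g = A * B" "\<not> [:- z, 1:] dvd B"
        using order_decomp[OF rg0, of z] by (auto simp: A_def m_def)
      have A: "lead_coeff A = 1" "degree A = m"
        by (simp_all only: A_def degree_linear_power coeff_linear_power)
      have B: "lead_coeff B = 1" using AB(1) A rn drg by (metis lead_coeff_mult mult_1)
      have dB: "degree A + degree B = n"
        using AB(1) drg A B by (metis degree_mult_eq leading_coeff_0_iff zero_neq_one)
      have "degree B \<noteq> 0"
      proof
        assume "degree B = 0"
        then have "B = 1" using B by (metis degree_0_id one_pCons)
        then have rg: "red g = [:- z, 1:] ^ n" using AB(1) dB A \<open>degree B = 0\<close> by (simp add: A_def)
        have "coeff ([:- z, 1:] ^ n) n' = of_nat n * (- z)"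
          by (simp add: coeff_linear_poly_power n_def del: power_Suc)
        then have "z = 0" using rn' rg by (simp add: n_def del: of_nat_Suc power_Suc)
        then have "red g = monom 1 n" using rg by (simp add: monom_altdef)
        then show False using r0 i0n by simp
      qed
      moreover have "coprime A B" using AB(2) unfolding A_def
        by (simp add: prime_elem_imp_coprime prime_elem_linear_field_poly)
      moreover have "degree A > 0" using A m0 by simp
      ultimately obtain G1 G2 where G12: "g = G1 * G2" "lead_coeff G1 = 1" "lead_coeff G2 = 1"
        "degree G1 = degree A" "degree G2 = degree B"
        using hensel[OF lg AB(1) _ A(1) _ B] by blast
      have "puiseux_split G1" using dB \<open>degree B \<noteq> 0\<close> G12 Suc n_def by (intro less.hyps) auto
      moreover have "puiseux_split G2" using dB A m0 G12 Suc n_def by (intro less.hyps) auto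
      ultimately have "puiseux_split g" using G12 puiseux_split_mult by simp
      then obtain N R where N: "N > 0" "psub N g = roots_poly R" by (auto simp: puiseux_split_def)
      have sR: "size R = n"
      proof -
        have "degree (psub N g) = n" using cg Gn
          by (intro antisym degree_le le_degree) (auto simp: coeff_map_poly)
        then show ?thesis using N by simp
      qed
      have fX: "fsub N (fps_X ^ k) = (fps_X ^ N) ^ k" for k
      proof -
        have "fps_X ^ k oo fps_X ^ N = (fps_X oo fps_X ^ N :: complex fps) ^ k"
          using N(1) by (intro fps_compose_power[symmetric]) simp
        also have "fps_X oo fps_X ^ N = (fps_X ^ N :: complex fps)"
          using N(1) by (intro fps_X_fps_compose_startby0) simp
        finally show ?thesis using N(1) by (simp add: fsub_def)
      qed
      have "psub (q * N) f1 = roots_poly (image_mset ((*) ((fps_X ^ N) ^ p)) R)"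
      proof (rule poly_eqI)
        fix i
        show "coeff (psub (q * N) f1) i = coeff (roots_poly (image_mset ((*) ((fps_X ^ N) ^ p)) R)) i"
        proof (cases "i \<le> n")
          case True
          have "coeff (psub (q * N) f1) i = fsub N (fsub q (coeff f1 i))"
            using q0 N(1) by (simp add: coeff_map_poly fsub_fsub)
          also have "\<dots> = ((fps_X ^ N) ^ p) ^ (n - i) * coeff (psub N g) i"
            using True by (simp add: G cg fsub_mult fX coeff_map_poly) (simp add: power_mult)
          also have "\<dots> = coeff (roots_poly (image_mset ((*) ((fps_X ^ N) ^ p)) R)) i"
            using True sR N(2) by (simp add: coeff_roots_poly_scale)
          finally show ?thesis .
        next
          case F: False
          then have "coeff f1 i = 0" using d1 by (intro coeff_eq_0) simp
          moreover have "coeff (roots_poly (image_mset ((*) ((fps_X ^ N) ^ p)) R)) i = 0"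
            using F sR by (intro coeff_eq_0) simp
          ultimately show ?thesis by (simp add: coeff_map_poly)
        qed
      qed
      then show ?thesis using q0 N(1) by (intro puiseux_splitI[of "q * N"]) simp_all
    qed
    then show ?thesis unfolding f1_def by (rule puiseux_split_pcompose)
  qed
qed

section \<open>Convergence of algebraic power series\<close>

definition tnorm :: "real \<Rightarrow> nat \<Rightarrow> complex fps \<Rightarrow> real" where
  "tnorm r M f = (\<Sum>m\<le>M. norm (fps_nth f m) * r ^ m)"

definition ftrunc :: "nat \<Rightarrow> complex fps \<Rightarrow> complex fps" where
  "ftrunc M f = Abs_fps (\<lambda>m. if m \<le> M then fps_nth f m else 0)"

lemma ftrunc_nth [simp]: "fps_nth (ftrunc M f) m = (if m \<le> M then fps_nth f m else 0)"
  by (simp add: ftrunc_def)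

lemma tnorm_nonneg: "r \<ge> 0 \<Longrightarrow> tnorm r M f \<ge> 0"
  by (auto simp: tnorm_def intro!: sum_nonneg)

lemma tnorm_cong: "(\<And>m. m \<le> M \<Longrightarrow> fps_nth f m = fps_nth g m) \<Longrightarrow> tnorm r M f = tnorm r M g"
  by (simp add: tnorm_def)

lemma tnorm_ftrunc: "M \<le> K \<Longrightarrow> tnorm r K (ftrunc M f) = tnorm r M f"
proof -
  assume "M \<le> K"
  then have "(\<Sum>m\<le>K. norm (fps_nth (ftrunc M f) m) * r ^ m) = (\<Sum>m\<le>M. norm (fps_nth (ftrunc M f) m) * r ^ m)"
    by (intro sum.mono_neutral_right) auto
  then show ?thesis by (simp add: tnorm_def)
qed

lemma tnorm_mono_radius: "0 \<le> r \<Longrightarrow> r \<le> s \<Longrightarrow> tnorm r M f \<le> tnorm s M f"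
  unfolding tnorm_def by (intro sum_mono mult_left_mono power_mono) auto

lemma tnorm_add: "r \<ge> 0 \<Longrightarrow> tnorm r M (f + g) \<le> tnorm r M f + tnorm r M g"
  unfolding tnorm_def sum.distrib[symmetric] fps_add_nth
  by (intro sum_mono) (simp add: mult_right_mono norm_triangle_ineq flip: distrib_right)

lemma tnorm_sum:
  assumes "r \<ge> 0"
  shows "tnorm r M (\<Sum>i\<in>A. f i) \<le> (\<Sum>i\<in>A. tnorm r M (f i))"
proof (induction A rule: infinite_finite_induct)
  case (insert i A)
  then show ?case using tnorm_add[OF assms, of M "f i" "\<Sum>i\<in>A. f i"] by simp
qed (simp_all add: tnorm_def)

lemma tnorm_mult:
  assumes r: "r \<ge> 0"
  shows "tnorm r M (f * g) \<le> tnorm r M f * tnorm r M g"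
proof -
  let ?t = "\<lambda>a b. (norm (fps_nth f a) * r ^ a) * (norm (fps_nth g b) * r ^ b)"
  have "tnorm r M (f * g) \<le> (\<Sum>m\<le>M. \<Sum>a\<le>m. ?t a (m - a))"
    unfolding tnorm_def
  proof (rule sum_mono)
    fix m assume "m \<in> {..M}"
    have "norm (fps_nth (f * g) m) * r ^ m \<le> (\<Sum>a\<le>m. norm (fps_nth f a * fps_nth g (m - a))) * r ^ m"
      unfolding fps_mult_nth atMost_atLeast0 using r by (intro mult_right_mono norm_sum) auto
    also have "\<dots> = (\<Sum>a\<le>m. ?t a (m - a))"
      unfolding sum_distrib_right
    proof (rule sum.cong)
      fix a assume "a \<in> {..m}"
      then have "r ^ m = r ^ a * r ^ (m - a)" by (simp flip: power_add)
      then show "norm (fps_nth f a * fps_nth g (m - a)) * r ^ m = ?t a (m - a)"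
        by (simp add: norm_mult)
    qed simp
    finally show "norm (fps_nth (f * g) m) * r ^ m \<le> (\<Sum>a\<le>m. ?t a (m - a))" .
  qed
  also have "\<dots> = (\<Sum>(a, b)\<in>{(i, j). i + j \<le> M}. ?t a b)"
    by (rule sum.triangle_reindex_eq[symmetric])
  also have "\<dots> \<le> (\<Sum>(a, b)\<in>{..M} \<times> {..M}. ?t a b)"
    using r by (intro sum_mono2) auto
  also have "\<dots> = tnorm r M f * tnorm r M g"
    by (simp add: tnorm_def sum_product sum.cartesian_product)
  finally show ?thesis .
qed

lemma tnorm_mult_Suc:
  assumes r: "r \<ge> 0" and f: "fps_nth f 0 = 0"
  shows "tnorm r (Suc M) (f * g) \<le> tnorm r (Suc M) f * tnorm r M g"
proof -
  have "tnorm r (Suc M) (f * g) = tnorm r (Suc M) (f * ftrunc M g)"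
  proof (rule tnorm_cong)
    fix m assume "m \<le> Suc M"
    then show "fps_nth (f * g) m = fps_nth (f * ftrunc M g) m"
      unfolding fps_mult_nth
    proof (intro sum.cong refl)
      fix a assume "m \<le> Suc M"
      then show "fps_nth f a * fps_nth g (m - a) = fps_nth f a * fps_nth (ftrunc M g) (m - a)"
        using f by (cases "a = 0") auto
    qed
  qed
  also have "\<dots> \<le> tnorm r (Suc M) f * tnorm r (Suc M) (ftrunc M g)" using r by (rule tnorm_mult)
  finally show ?thesis by (simp add: tnorm_ftrunc)
qed

lemma tnorm_mult_Suc2:
  assumes r: "r \<ge> 0" and f: "fps_nth f 0 = 0" and g: "fps_nth g 0 = 0"
  shows "tnorm r (Suc M) (f * g) \<le> tnorm r M f * tnorm r M g"
proof -
  have "tnorm r (Suc M) (f * g) = tnorm r (Suc M) (ftrunc M f * g)"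
  proof (rule tnorm_cong)
    fix m assume "m \<le> Suc M"
    then show "fps_nth (f * g) m = fps_nth (ftrunc M f * g) m"
      unfolding fps_mult_nth
    proof (intro sum.cong refl)
      fix a assume "a \<in> {0..m}" "m \<le> Suc M"
      then show "fps_nth f a * fps_nth g (m - a) = fps_nth (ftrunc M f) a * fps_nth g (m - a)"
        using g by (cases "a = m") auto
    qed
  qed
  also have "\<dots> \<le> tnorm r (Suc M) (ftrunc M f) * tnorm r M g" using r f by (intro tnorm_mult_Suc) auto
  finally show ?thesis by (simp add: tnorm_ftrunc)
qed

lemma tnorm_power: "r \<ge> 0 \<Longrightarrow> tnorm r M (f ^ i) \<le> tnorm r M f ^ i"
proof (induction i)
  case 0
  have "tnorm r M 1 = (\<Sum>m\<in>{0}. norm (fps_nth 1 m :: complex) * r ^ m)"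
    unfolding tnorm_def by (intro sum.mono_neutral_right) auto
  then show ?case by simp
next
  case (Suc i)
  have "tnorm r M (f ^ Suc i) \<le> tnorm r M f * tnorm r M (f ^ i)"
    using Suc.prems by (simp add: tnorm_mult)
  also have "\<dots> \<le> tnorm r M f * tnorm r M f ^ i"
    using Suc by (intro mult_left_mono tnorm_nonneg) auto
  finally show ?case by simp
qed

lemma tnorm_scale:
  assumes "0 \<le> s" "s \<le> 1" "r \<ge> 0" "fps_nth f 0 = 0"
  shows "tnorm (s * r) M f \<le> s * tnorm r M f"
  unfolding tnorm_def sum_distrib_left
proof (rule sum_mono)
  fix m
  show "norm (fps_nth f m) * (s * r) ^ m \<le> s * (norm (fps_nth f m) * r ^ m)"
  proof (cases m)
    case (Suc l)
    have "s ^ m \<le> s" using assms Suc by (metis One_nat_def le_simps(3) power_decreasing power_one_right zero_less_Suc)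
    then have "s ^ m * (norm (fps_nth f m) * r ^ m) \<le> s * (norm (fps_nth f m) * r ^ m)"
      using assms by (intro mult_right_mono) auto
    then show ?thesis by (simp add: power_mult_distrib ac_simps)
  qed (use assms in simp)
qed

definition conv1 :: "complex fps \<Rightarrow> bool" where
  "conv1 f \<longleftrightarrow> (\<exists>r>0. \<exists>B. \<forall>M. tnorm r M f \<le> B)"

lemma conv1_common:
  assumes "finite A" "\<And>i. i \<in> A \<Longrightarrow> conv1 (f i)"
  obtains r B where "r > 0" "B \<ge> 0" "\<And>i M. i \<in> A \<Longrightarrow> tnorm r M (f i) \<le> B"
  using assms
proof (induction A arbitrary: thesis rule: finite_induct)
  case empty
  show ?case by (rule empty(1)[of 1 0]) auto
next
  case (insert i A)
  obtain r B where r: "r > 0" "B \<ge> 0" "\<And>i M. i \<in> A \<Longrightarrow> tnorm r M (f i) \<le> B"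
    using insert.IH insert.prems(2) by (metis insertCI)
  obtain s C where s: "s > 0" "\<And>M. tnorm s M (f i) \<le> C"
    using insert.prems(2)[of i] by (auto simp: conv1_def)
  have "tnorm (min r s) M (f j) \<le> max B C" if "j \<in> insert i A" for j M
  proof (cases "j = i")
    case True
    have "tnorm (min r s) M (f j) \<le> tnorm s M (f j)" using r s by (intro tnorm_mono_radius) auto
    then show ?thesis using s(2)[of M] True by auto
  next
    case False
    have "tnorm (min r s) M (f j) \<le> tnorm r M (f j)" using r s by (intro tnorm_mono_radius) auto
    then show ?thesis using r(3)[of j M] False that by auto
  qed
  then show ?case using r s by (intro insert.prems(1)[of "min r s" "max B C"]) auto
qed

lemma conv1_add: "conv1 f \<Longrightarrow> conv1 g \<Longrightarrow> conv1 (f + g)"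
  and conv1_mult: "conv1 f \<Longrightarrow> conv1 g \<Longrightarrow> conv1 (f * g)"
proof -
  assume "conv1 f" "conv1 g"
  then obtain r B where r: "r > 0" "B \<ge> 0" "\<And>i M. i \<in> UNIV \<Longrightarrow> tnorm r M (if i then f else g) \<le> B"
    using conv1_common[of "UNIV :: bool set" "\<lambda>i. if i then f else g"] by (metis finite)
  from r(3)[of True] r(3)[of False] have fg: "\<And>M. tnorm r M f \<le> B" "\<And>M. tnorm r M g \<le> B" by auto
  have "tnorm r M (f + g) \<le> B + B" for M
    using tnorm_add[of r M f g] fg[of M] r(1) by linarith
  then show "conv1 (f + g)" unfolding conv1_def using r(1) by blast
  have "tnorm r M (f * g) \<le> B * B" for M
    by (rule order_trans[OF tnorm_mult mult_mono]) (use fg r in \<open>auto intro: tnorm_nonneg\<close>)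
  then show "conv1 (f * g)" unfolding conv1_def using r(1) by blast
qed

lemma conv1_finite: "(\<And>m. m > K \<Longrightarrow> fps_nth f m = 0) \<Longrightarrow> conv1 f"
proof -
  assume z: "\<And>m. m > K \<Longrightarrow> fps_nth f m = 0"
  have z': "m \<le> K" if "fps_nth f m \<noteq> 0" for m using z that not_le by blast
  have "tnorm 1 M f \<le> tnorm 1 K f" for M
  proof -
    have "tnorm 1 M f = (\<Sum>m\<in>{..M} \<inter> {..K}. norm (fps_nth f m) * 1 ^ m)"
      unfolding tnorm_def using z' by (intro sum.mono_neutral_right) auto
    also have "\<dots> \<le> tnorm 1 K f" unfolding tnorm_def by (intro sum_mono2) auto
    finally show ?thesis .
  qed
  then show ?thesis unfolding conv1_def by (intro exI[of _ 1]) auto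
qed

lemma conv1_const [simp]: "conv1 (fps_const c)" by (rule conv1_finite[of 0]) simp
lemma conv1_0 [simp]: "conv1 0" by (rule conv1_finite[of 0]) simp
lemma conv1_1 [simp]: "conv1 1" by (rule conv1_finite[of 0]) simp
lemma conv1_X_power [simp]: "conv1 (fps_X ^ k)" by (rule conv1_finite[of k]) simp
lemma conv1_ftrunc [simp]: "conv1 (ftrunc k f)" by (rule conv1_finite[of k]) simp

lemma conv1_uminus: "conv1 f \<Longrightarrow> conv1 (- f)"
  by (simp add: conv1_def tnorm_def)

lemma conv1_diff: "conv1 f \<Longrightarrow> conv1 g \<Longrightarrow> conv1 (f - g)"
  using conv1_add[of f "- g"] by (simp add: conv1_uminus)

lemma conv1_sum: "(\<And>i. i \<in> A \<Longrightarrow> conv1 (f i)) \<Longrightarrow> conv1 (sum f A)"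
  by (induction A rule: infinite_finite_induct) (auto intro: conv1_add)

lemma conv1_shift: "conv1 f \<Longrightarrow> conv1 (fps_shift k f)"
proof -
  assume "conv1 f"
  then obtain r B where r: "r > 0" "\<And>M. tnorm r M f \<le> B" by (auto simp: conv1_def)
  have "tnorm r M (fps_shift k f) \<le> B / r ^ k" for M
  proof -
    have "tnorm r M (fps_shift k f) * r ^ k = (\<Sum>m\<le>M. norm (fps_nth f (m + k)) * r ^ (m + k))"
      by (simp add: tnorm_def sum_distrib_right power_add mult.assoc)
    also have "\<dots> = (\<Sum>m\<in>(\<lambda>m. m + k) ` {..M}. norm (fps_nth f m) * r ^ m)"
      by (subst sum.reindex) auto
    also have "\<dots> \<le> tnorm r (M + k) f"
      unfolding tnorm_def using r by (intro sum_mono2) auto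
    also have "\<dots> \<le> B" by (rule r)
    finally show ?thesis using r by (simp add: field_simps)
  qed
  then show ?thesis unfolding conv1_def using r by blast
qed

text \<open>
  A majorant argument: with \<open>s\<close> small, the bound \<open>tnorm \<le> \<delta>\<close> reproduces itself, because the
  coefficients of the right-hand side up to degree \<open>M + 1\<close> only involve those of \<open>z\<close> up to \<open>M\<close>.
\<close>

lemma conv1_fixpoint:
  assumes z0: "fps_nth z 0 = 0" and eq: "z = (\<Sum>i\<le>d. A i * z ^ i)"
    and A0: "fps_nth (A 0) 0 = 0" and A1: "fps_nth (A 1) 0 = 0"
    and conv: "\<And>i. i \<le> d \<Longrightarrow> conv1 (A i)"
  shows "conv1 z"
proof -
  obtain r B where r: "r > 0" "B \<ge> 0" "\<And>i M. i \<in> {..d} \<Longrightarrow> tnorm r M (A i) \<le> B"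
    using conv1_common[of "{..d}" A] conv by (metis atMost_iff finite_atMost)
  define \<delta> where "\<delta> = 1 / (3 * real d * B + 3)"
  have den: "3 * real d * B + 3 > 0" using r by (intro add_nonneg_pos) auto
  have \<delta>: "\<delta> > 0" "\<delta> \<le> 1" "real d * B * \<delta> \<le> 1 / 3"
  proof -
    show "\<delta> > 0" unfolding \<delta>_def using den by simp
    show "\<delta> \<le> 1" unfolding \<delta>_def using r by (simp add: divide_le_eq)
    show "real d * B * \<delta> \<le> 1 / 3" unfolding \<delta>_def using den by (simp add: field_simps)
  qed
  define s where "s = \<delta> / (3 * B + 3)"
  have s: "s > 0" "s \<le> 1" "s * B \<le> \<delta> / 3" "s * B \<le> 1 / 3"
  proof -
    show "s > 0" unfolding s_def using r \<delta> by simp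
    have "\<delta> \<le> 3 * B + 3" using \<delta> r by linarith
    then show "s \<le> 1" unfolding s_def using r by (simp add: divide_le_eq)
    have "B / (3 * B + 3) \<le> 1 / 3" using r by (simp add: field_simps)
    then have "\<delta> * (B / (3 * B + 3)) \<le> \<delta> * (1 / 3)" using \<delta> by (intro mult_left_mono) auto
    then show "s * B \<le> \<delta> / 3" unfolding s_def by simp
    then show "s * B \<le> 1 / 3" using \<delta> by linarith
  qed
  let ?\<rho> = "s * r"
  have \<rho>: "?\<rho> > 0" using s r by simp
  have bA: "tnorm ?\<rho> M (A i) \<le> B" if "i \<le> d" for i M
  proof -
    have "tnorm ?\<rho> M (A i) \<le> tnorm r M (A i)" using s r by (intro tnorm_mono_radius) (auto simp: mult_le_cancel_right1)
    then show ?thesis using r(3)[of i M] that by simp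
  qed
  have bs: "tnorm ?\<rho> M (A i) \<le> s * B" if "i \<le> d" "fps_nth (A i) 0 = 0" for i M
  proof -
    have "tnorm ?\<rho> M (A i) \<le> s * tnorm r M (A i)" using that s r by (intro tnorm_scale) auto
    also have "\<dots> \<le> s * B" using that s r(3)[of i M] by (intro mult_left_mono) auto
    finally show ?thesis .
  qed
  have "tnorm ?\<rho> M z \<le> \<delta>" for M
  proof (induction M)
    case 0
    then show ?case using z0 \<delta> by (simp add: tnorm_def)
  next
    case (Suc M)
    let ?c = "\<lambda>i. if i = 0 then \<delta> / 3 else if i = 1 then \<delta> / 3 else B * \<delta> ^ 2"
    have term_le: "tnorm ?\<rho> (Suc M) (A i * z ^ i) \<le> ?c i" if "i \<le> d" for i
    proof -
      consider "i = 0" | "i = 1" | j where "i = Suc (Suc j)" by (cases i; cases "i - 1") auto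
      then show ?thesis
      proof cases
        case 1
        then show ?thesis using bs[of 0 "Suc M"] A0 s by simp
      next
        case 2
        have "tnorm ?\<rho> (Suc M) (A 1 * z) \<le> tnorm ?\<rho> (Suc M) (A 1) * tnorm ?\<rho> M z"
          using \<rho> A1 by (intro tnorm_mult_Suc) auto
        also have "\<dots> \<le> (1 / 3) * \<delta>"
          using bs[of 1 "Suc M"] A1 that 2 s Suc \<rho> by (intro mult_mono tnorm_nonneg) auto
        finally show ?thesis using 2 by simp
      next
        case 3
        have "tnorm ?\<rho> (Suc M) (A i * z ^ i) \<le> tnorm ?\<rho> (Suc M) (A i) * tnorm ?\<rho> (Suc M) (z ^ i)"
          using \<rho> by (intro tnorm_mult) auto
        also have "tnorm ?\<rho> (Suc M) (z ^ i) \<le> tnorm ?\<rho> M z * tnorm ?\<rho> M (z ^ Suc j)"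
          unfolding 3 power_Suc[of z "Suc j"] using \<rho> z0 by (intro tnorm_mult_Suc2) auto
        also have "\<dots> \<le> \<delta> * \<delta>"
        proof (intro mult_mono)
          have "tnorm ?\<rho> M (z ^ Suc j) \<le> tnorm ?\<rho> M z ^ Suc j" using \<rho> by (intro tnorm_power) auto
          also have "\<dots> \<le> \<delta> ^ Suc j" using Suc \<rho> by (intro power_mono tnorm_nonneg) auto
          also have "\<dots> \<le> \<delta>" using \<delta> by (simp add: mult_le_cancel_left1 power_le_one)
          finally show "tnorm ?\<rho> M (z ^ Suc j) \<le> \<delta>" .
        qed (use Suc \<delta> \<rho> tnorm_nonneg in auto)
        also have "tnorm ?\<rho> (Suc M) (A i) * (\<delta> * \<delta>) \<le> B * (\<delta> * \<delta>)"
          using bA[OF that] \<delta> by (intro mult_right_mono) auto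
        finally show ?thesis using 3 \<rho> tnorm_nonneg[of ?\<rho> "Suc M" "A i"]
          by (simp add: power2_eq_square mult_left_mono)
      qed
    qed
    have "tnorm ?\<rho> (Suc M) z = tnorm ?\<rho> (Suc M) (\<Sum>i\<le>d. A i * z ^ i)"
      using eq by simp
    also have "\<dots> \<le> (\<Sum>i\<le>d. tnorm ?\<rho> (Suc M) (A i * z ^ i))" using \<rho> by (intro tnorm_sum) auto
    also have "\<dots> \<le> (\<Sum>i\<le>d. ?c i)" using term_le by (intro sum_mono) auto
    also have "\<dots> \<le> 2 * (\<delta> / 3) + real d * (B * \<delta> ^ 2)"
    proof (cases d)
      case 0
      then show ?thesis using \<delta> by simp
    next
      case (Suc d')
      have "(\<Sum>i\<le>d. ?c i) = \<delta> / 3 + \<delta> / 3 + (\<Sum>i\<in>{2..d}. ?c i)"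
      proof -
        have "{..d} = insert 0 (insert 1 {2..d})" using Suc by auto
        then show ?thesis by simp
      qed
      also have "(\<Sum>i\<in>{2..d}. ?c i) = real (d - 1) * (B * \<delta> ^ 2)" by simp
      also have "\<dots> \<le> real d * (B * \<delta> ^ 2)" using r by (intro mult_right_mono) auto
      finally show ?thesis by simp
    qed
    also have "real d * (B * \<delta> ^ 2) = (real d * B * \<delta>) * \<delta>" by (simp add: power2_eq_square)
    also have "\<dots> \<le> (1 / 3) * \<delta>" using \<delta> by (intro mult_right_mono) auto
    finally show ?case by simp
  qed
  then show ?thesis unfolding conv1_def using \<rho> by blast
qed

lemma poly_diff_dvd: "x - y dvd poly p x - poly (p :: 'a::comm_ring_1 poly) y"
proof (induction p)
  case (pCons a p)
  have "poly (pCons a p) x - poly (pCons a p) y = (x - y) * poly p x + y * (poly p x - poly p y)"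
    by (simp add: algebra_simps)
  then show ?case using pCons by (simp add: dvd_add)
qed simp

lemma conv1_coeff_mult:
  "(\<And>i. conv1 (coeff F i)) \<Longrightarrow> (\<And>i. conv1 (coeff G i)) \<Longrightarrow> conv1 (coeff (F * G) i)"
  by (simp add: coeff_mult conv1_sum conv1_mult)

lemma conv1_coeff_pcompose:
  "(\<And>i. conv1 (coeff F i)) \<Longrightarrow> (\<And>i. conv1 (coeff q i)) \<Longrightarrow> conv1 (coeff (pcompose F q) i)"
proof (induction F arbitrary: i)
  case (pCons a F)
  have "conv1 (coeff F i)" for i using pCons.prems(1)[of "Suc i"] by simp
  then have "conv1 (coeff (q * pcompose F q) i)" for i using pCons by (intro conv1_coeff_mult) auto
  moreover have "conv1 a" using pCons.prems(1)[of 0] by simp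
  ultimately show ?case by (cases i) (simp_all add: pcompose_pCons conv1_add)
qed simp

theorem conv1_simple_root:
  assumes conv: "\<And>i. conv1 (coeff F i)" and root: "poly F y = 0" and simple: "poly (pderiv F) y \<noteq> 0"
  shows "conv1 y"
proof -
  define e where "e = subdegree (poly (pderiv F) y)"
  define q where "q = ftrunc e y"
  define z where "z = fps_shift e (y - q)"
  have yq: "y - q = fps_X ^ e * z"
    by (rule fps_ext) (simp add: z_def q_def fps_X_power_mult_nth)
  have z0: "fps_nth z 0 = 0" by (simp add: z_def q_def)
  define H where "H = pcompose F [:q, 1:]"
  define d where "d = degree F"
  have dH: "degree H \<le> d" unfolding H_def d_def using degree_pcompose_le[of F "[:q, 1:]"] by simp
  have cH: "conv1 (coeff H i)" for i
    unfolding H_def using conv by (intro conv1_coeff_pcompose) (auto simp: q_def coeff_pCons split: nat.splits)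
  have H1: "coeff H 1 = poly (pderiv F) q"
  proof -
    have "coeff H 1 = poly (pderiv H) 0" by (simp add: poly_0_coeff_0 coeff_pderiv)
    also have "\<dots> = poly (pderiv F) q" by (simp add: H_def pderiv_pcompose poly_pcompose pderiv_pCons)
    finally show ?thesis .
  qed
  have "fps_X ^ Suc e dvd poly (pderiv F) y - poly (pderiv F) q"
  proof -
    have "z = fps_X * fps_shift 1 z" using z0 by (intro fps_ext) auto
    then have "y - q = fps_X ^ Suc e * fps_shift 1 z" unfolding yq by (metis mult.assoc power_Suc2)
    then have "fps_X ^ Suc e dvd y - q" by (rule dvdI)
    then show ?thesis using poly_diff_dvd dvd_trans by blast
  qed
  then obtain w where w: "poly (pderiv F) y - poly (pderiv F) q = fps_X ^ Suc e * w" by blast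
  have near: "fps_nth (coeff H 1) k = fps_nth (poly (pderiv F) y) k" if "k \<le> e" for k
  proof -
    have "fps_nth (poly (pderiv F) y - poly (pderiv F) q) k = 0"
      unfolding w fps_X_power_mult_nth using that by simp
    then show ?thesis unfolding H1 by simp
  qed
  define u where "u = fps_shift e (coeff H 1)"
  have u: "coeff H 1 = fps_X ^ e * u"
  proof (rule fps_ext)
    fix k
    show "fps_nth (coeff H 1) k = fps_nth (fps_X ^ e * u) k"
    proof (cases "k < e")
      case True
      then have "fps_nth (poly (pderiv F) y) k = 0" unfolding e_def by (rule nth_less_subdegree_zero)
      then show ?thesis using near[of k] True by (simp only: fps_X_power_mult_nth if_True less_imp_le)
    next
      case False
      then show ?thesis by (simp add: u_def fps_X_power_mult_nth)
    qed
  qed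
  have u0: "fps_nth u 0 \<noteq> 0"
    using near[of e] nth_subdegree_nonzero[OF simple] by (simp add: u_def e_def)
  define D where "D = fps_shift (2 * e) (coeff H 0)"
  have sum0: "(\<Sum>i\<le>d. coeff H i * (fps_X ^ e * z) ^ i) = 0"
  proof -
    have "poly H (y - q) = 0" using root by (simp add: H_def poly_pcompose)
    moreover have "poly H (y - q) = (\<Sum>i\<le>d. coeff H i * (y - q) ^ i)"
      unfolding poly_altdef using dH by (intro sum.mono_neutral_left) (auto simp: coeff_eq_0)
    ultimately show ?thesis by (simp add: yq)
  qed
  have d1: "d \<ge> 1"
  proof (rule ccontr)
    assume "\<not> d \<ge> 1"
    then have "pderiv F = 0" by (simp add: d_def pderiv_eq_0_iff)
    then show False using simple by simp
  qed
  let ?R = "\<Sum>i\<in>{2..d}. coeff H i * fps_X ^ (e * (i - 2)) * z ^ i"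
  have split: "{..d} = insert 0 (insert 1 {2..d})" using d1 by auto
  have H0: "coeff H 0 = fps_X ^ (2 * e) * (- (u * z) - ?R)"
  proof -
    have "fps_X ^ (2 * e) * ?R = (\<Sum>i\<in>{2..d}. coeff H i * (fps_X ^ e * z) ^ i)"
      unfolding sum_distrib_left
    proof (rule sum.cong)
      fix i assume "i \<in> {2..d}"
      then have "e * i = 2 * e + e * (i - 2)" by (simp add: algebra_simps flip: add_mult_distrib2)
      then have "(fps_X ^ e) ^ i = (fps_X ^ (2 * e) * fps_X ^ (e * (i - 2)) :: complex fps)"
        by (simp flip: power_mult power_add)
      then show "fps_X ^ (2 * e) * (coeff H i * fps_X ^ (e * (i - 2)) * z ^ i) = coeff H i * (fps_X ^ e * z) ^ i"
        by (simp add: power_mult_distrib ac_simps)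
    qed simp
    moreover have "fps_X ^ (2 * e) * (u * z) = coeff H 1 * (fps_X ^ e * z)"
      unfolding u by (simp add: mult_2 power_add)
    moreover have "coeff H 0 + (coeff H 1 * (fps_X ^ e * z) + (\<Sum>i\<in>{2..d}. coeff H i * (fps_X ^ e * z) ^ i)) = 0"
      using sum0 unfolding split by simp
    ultimately have "coeff H 0 + (fps_X ^ (2 * e) * (u * z) + fps_X ^ (2 * e) * ?R) = 0" by (simp only:)
    then have "coeff H 0 = - (fps_X ^ (2 * e) * (u * z) + fps_X ^ (2 * e) * ?R)"
      by (simp only: eq_neg_iff_add_eq_0)
    also have "\<dots> = fps_X ^ (2 * e) * (- (u * z) - ?R)"
    proof -
      have "- (a * x + a * y) = a * (- x - y)" for a x y :: "complex fps" by (simp add: algebra_simps)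
      then show ?thesis .
    qed
    finally show ?thesis .
  qed
  have D: "D = - (u * z) - ?R" unfolding D_def H0 by (rule fps_ext) (simp add: fps_X_power_mult_nth)
  define c where "c = fps_const (1 / fps_nth u 0)"
  define A where "A = (\<lambda>i. if i = 0 then - (c * D) else if i = 1 then 1 - c * u
    else - (c * (coeff H i * fps_X ^ (e * (i - 2)))))"
  show ?thesis
  proof -
    have "conv1 z"
    proof (rule conv1_fixpoint[OF z0])
      have "(\<Sum>i\<in>{2..d}. A i * z ^ i) = - (c * ?R)"
        unfolding sum_distrib_left sum_negf[symmetric]
        by (intro sum.cong) (auto simp: A_def)
      then have "(\<Sum>i\<le>d. A i * z ^ i) = - (c * D) + (1 - c * u) * z - c * ?R"
        unfolding split by (simp add: A_def)
      then show "z = (\<Sum>i\<le>d. A i * z ^ i)" unfolding D by (simp add: algebra_simps)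
      have "fps_nth ?R 0 = 0"
        unfolding fps_sum_nth by (intro sum.neutral ballI) (use z0 in \<open>auto simp: fps_power_zeroth\<close>)
      then have "fps_nth D 0 = 0" using z0 by (simp add: D)
      then show "fps_nth (A 0) 0 = 0" by (simp add: A_def)
      show "fps_nth (A 1) 0 = 0" using u0 by (simp add: A_def c_def)
      fix i
      show "conv1 (A i)" unfolding A_def c_def D_def u_def
        using cH by (auto intro!: conv1_uminus conv1_mult conv1_diff conv1_shift)
    qed
    then have "conv1 (q + fps_X ^ e * z)" by (intro conv1_add conv1_mult) (auto simp: q_def)
    then show ?thesis using yq by (metis add_diff_cancel_left' diff_eq_eq add.commute)
  qed
qed

section \<open>Analytic irreducibility and conjugate roots\<close>

definition swap2 :: "'a fps fps \<Rightarrow> 'a fps fps" where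
  "swap2 g = Abs_fps (\<lambda>i. Abs_fps (\<lambda>j. fps_nth (fps_nth g j) i))"

lemma swap2_nth [simp]: "fps_nth (fps_nth (swap2 g) i) j = fps_nth (fps_nth g j) i"
  by (simp add: swap2_def)

lemma swap2_swap2 [simp]: "swap2 (swap2 g) = g"
  by (intro fps_ext) simp

lemma swap2_add: "swap2 (f + g) = swap2 f + swap2 g"
  by (intro fps_ext) simp

lemma swap2_0: "swap2 (0 :: 'a::zero fps fps) = 0"
  by (intro fps_ext) simp

lemma swap2_1: "swap2 (1 :: 'a::comm_ring_1 fps fps) = 1"
  by (intro fps_ext) simp

lemma swap2_mult: "swap2 (f * g) = swap2 f * swap2 (g :: 'a::comm_ring_1 fps fps)"
proof (intro fps_ext)
  fix i j
  have "fps_nth (fps_nth (swap2 (f * g)) i) j =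
      (\<Sum>l\<in>{0..j}. \<Sum>k\<in>{0..i}. fps_nth (fps_nth f l) k * fps_nth (fps_nth g (j - l)) (i - k))"
    by (simp add: fps_mult_nth fps_sum_nth)
  also have "\<dots> = (\<Sum>k\<in>{0..i}. \<Sum>l\<in>{0..j}. fps_nth (fps_nth f l) k * fps_nth (fps_nth g (j - l)) (i - k))"
    by (rule sum.swap)
  also have "\<dots> = fps_nth (fps_nth (swap2 f * swap2 g) i) j"
    by (simp add: fps_mult_nth fps_sum_nth)
  finally show "fps_nth (fps_nth (swap2 (f * g)) i) j = fps_nth (fps_nth (swap2 f * swap2 g) i) j" .
qed

definition sw :: "conv_series \<Rightarrow> complex fps fps" where
  "sw s = swap2 (Rep_conv_series s)"

lemma sw_add: "sw (s + t) = sw s + sw t"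
  by (simp add: sw_def plus_conv_series.rep_eq swap2_add)

lemma sw_mult: "sw (s * t) = sw s * sw t"
  by (simp add: sw_def times_conv_series.rep_eq swap2_mult)

lemma sw_0: "sw 0 = 0" by (simp add: sw_def zero_conv_series.rep_eq swap2_0)
lemma sw_1: "sw 1 = 1" by (simp add: sw_def one_conv_series.rep_eq swap2_1)

lemma sw_inject: "sw s = sw t \<longleftrightarrow> s = t"
  by (metis Rep_conv_series_inject sw_def swap2_swap2)

definition fps_eval :: "complex fps \<Rightarrow> complex fps fps \<Rightarrow> complex fps" where
  "fps_eval y g = Abs_fps (\<lambda>m. fps_nth (\<Sum>i\<le>m. fps_nth g i * y ^ i) m)"

context
  fixes y :: "complex fps"
  assumes y0: "fps_nth y 0 = 0"
begin

lemma power_nth_zero: "m < i \<Longrightarrow> fps_nth (y ^ i) m = 0"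
proof -
  assume "m < i"
  have "y = fps_X * fps_shift 1 y" using y0 by (intro fps_ext) auto
  then have "y ^ i = fps_X ^ i * fps_shift 1 y ^ i" by (metis power_mult_distrib)
  then show ?thesis using \<open>m < i\<close> by (simp add: fps_X_power_mult_nth)
qed

lemma mult_power_nth_zero: "m < i \<Longrightarrow> fps_nth (c * y ^ i) m = 0"
  unfolding fps_mult_nth by (intro sum.neutral ballI) (simp add: power_nth_zero)

lemma fps_eval_nth: "m \<le> K \<Longrightarrow> fps_nth (fps_eval y g) m = fps_nth (\<Sum>i\<le>K. fps_nth g i * y ^ i) m"
proof -
  assume "m \<le> K"
  then have "(\<Sum>i\<le>K. fps_nth (fps_nth g i * y ^ i) m) = (\<Sum>i\<le>m. fps_nth (fps_nth g i * y ^ i) m)"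
    by (intro sum.mono_neutral_right) (auto simp: mult_power_nth_zero)
  then show ?thesis by (simp add: fps_eval_def fps_sum_nth)
qed

lemma mult_nth_cong: "(\<And>j. j \<le> m \<Longrightarrow> fps_nth a j = fps_nth b j) \<Longrightarrow> fps_nth (c * a) m = fps_nth (c * b :: complex fps) m"
  unfolding fps_mult_nth by (intro sum.cong) auto

lemma fps_eval_rec: "fps_eval y g = fps_nth g 0 + y * fps_eval y (fps_shift 1 g)"
proof (rule fps_ext)
  fix m
  have "fps_nth (fps_eval y g) m = fps_nth (\<Sum>i\<le>Suc m. fps_nth g i * y ^ i) m" by (rule fps_eval_nth) simp
  also have "(\<Sum>i\<le>Suc m. fps_nth g i * y ^ i) = fps_nth g 0 + y * (\<Sum>i\<le>m. fps_nth (fps_shift 1 g) i * y ^ i)"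
    unfolding sum.atMost_Suc_shift by (simp add: sum_distrib_left ac_simps)
  also have "fps_nth (y * (\<Sum>i\<le>m. fps_nth (fps_shift 1 g) i * y ^ i)) m = fps_nth (y * fps_eval y (fps_shift 1 g)) m"
    by (rule mult_nth_cong) (simp add: fps_eval_nth)
  then have "fps_nth (fps_nth g 0 + y * (\<Sum>i\<le>m. fps_nth (fps_shift 1 g) i * y ^ i)) m = fps_nth (fps_nth g 0 + y * fps_eval y (fps_shift 1 g)) m"
    by simp
  finally show "fps_nth (fps_eval y g) m = fps_nth (fps_nth g 0 + y * fps_eval y (fps_shift 1 g)) m" .
qed

lemma fps_eval_diff: "fps_eval y (f - g) = fps_eval y f - fps_eval y g"
  by (rule fps_ext) (simp add: fps_eval_def fps_sum_nth left_diff_distrib sum_subtractf)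

lemma fps_eval_const_mult: "fps_eval y (fps_const c * g) = c * fps_eval y g"
proof (rule fps_ext)
  fix m
  have "fps_nth (fps_eval y (fps_const c * g)) m = fps_nth (c * (\<Sum>i\<le>m. fps_nth g i * y ^ i)) m"
    by (simp add: fps_eval_def sum_distrib_left mult.assoc)
  also have "\<dots> = fps_nth (c * fps_eval y g) m"
    by (rule mult_nth_cong) (simp add: fps_eval_nth)
  finally show "fps_nth (fps_eval y (fps_const c * g)) m = fps_nth (c * fps_eval y g) m" .
qed

lemma fps_eval_X_mult: "fps_eval y (fps_X * g) = y * fps_eval y g"
proof -
  have "fps_shift 1 (fps_X * g) = g" by (rule fps_ext) simp
  then show ?thesis by (subst fps_eval_rec) simp
qed

lemma fps_eval_mult: "fps_eval y (f * g) = fps_eval y f * fps_eval y g"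
proof (rule fps_ext)
  fix m
  let ?t = "\<lambda>i j. fps_nth (fps_nth f i * fps_nth g j * y ^ (i + j)) m"
  have "fps_nth (fps_eval y (f * g)) m = (\<Sum>k\<le>m. \<Sum>i\<le>k. ?t i (k - i))"
    by (simp add: fps_eval_def fps_mult_nth[of f g] fps_sum_nth sum_distrib_right atMost_atLeast0)
  also have "\<dots> = (\<Sum>(i, j)\<in>{(i, j). i + j \<le> m}. ?t i j)"
    by (rule sum.triangle_reindex_eq[symmetric])
  also have "\<dots> = (\<Sum>(i, j)\<in>{..m} \<times> {..m}. ?t i j)"
    by (intro sum.mono_neutral_left) (auto, metis mult_power_nth_zero not_le)
  also have "\<dots> = (\<Sum>i\<le>m. \<Sum>j\<le>m. ?t i j)"
    by (rule sum.cartesian_product[symmetric])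
  also have "\<dots> = fps_nth ((\<Sum>i\<le>m. fps_nth f i * y ^ i) * (\<Sum>j\<le>m. fps_nth g j * y ^ j)) m"
    by (simp add: sum_product fps_sum_nth power_add ac_simps)
  also have "\<dots> = fps_nth ((\<Sum>i\<le>m. fps_nth f i * y ^ i) * fps_eval y g) m"
    by (rule mult_nth_cong) (simp add: fps_eval_nth)
  also have "\<dots> = fps_nth (fps_eval y f * fps_eval y g) m"
    unfolding mult.commute[of _ "fps_eval y g"] by (rule mult_nth_cong) (simp add: fps_eval_nth)
  finally show "fps_nth (fps_eval y (f * g)) m = fps_nth (fps_eval y f * fps_eval y g) m" .
qed

lemma fps_eval_fps_of_poly: "fps_eval y (fps_of_poly F) = poly F y"
proof (rule fps_ext)
  fix m
  have "fps_nth (fps_eval y (fps_of_poly F)) m = fps_nth (\<Sum>i\<le>max m (degree F). coeff F i * y ^ i) m"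
    by (subst fps_eval_nth[of m "max m (degree F)"]) simp_all
  also have "(\<Sum>i\<le>max m (degree F). coeff F i * y ^ i) = poly F y"
    unfolding poly_altdef by (intro sum.mono_neutral_right) (auto simp: coeff_eq_0)
  finally show "fps_nth (fps_eval y (fps_of_poly F)) m = fps_nth (poly F y) m" .
qed

text \<open>The coefficients of the quotient are the values at \<open>y\<close> of the shifted series.\<close>

lemma fps_eval_root_division:
  assumes "fps_eval y g = 0"
  obtains q where "g = fps_X * q - fps_const y * q"
proof -
  define q where "q = Abs_fps (\<lambda>i. fps_eval y (fps_shift (Suc i) g))"
  have step: "fps_eval y (fps_shift i g) = fps_nth g i + y * fps_nth q i" for i
  proof -
    have "fps_shift 1 (fps_shift i g) = fps_shift (Suc i) g" by (rule fps_ext) simp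
    then show ?thesis by (subst fps_eval_rec) (simp add: q_def)
  qed
  have "g = fps_X * q - fps_const y * q"
  proof (rule fps_ext)
    fix i
    show "fps_nth g i = fps_nth (fps_X * q - fps_const y * q) i"
      using step[of i] assms by (cases i) (simp_all add: q_def eq_neg_iff_add_eq_0)
  qed
  then show thesis by (rule that)
qed

end

lemma fps_eval_many_roots:
  assumes "finite Y" "\<And>y. y \<in> Y \<Longrightarrow> fps_nth y 0 = 0" "\<And>y. y \<in> Y \<Longrightarrow> fps_eval y g = 0" "i < card Y"
  shows "fps_nth (fps_nth g i) 0 = 0"
  using assms
proof (induction Y arbitrary: g i rule: finite_induct)
  case (insert y Y)
  have y0: "fps_nth y 0 = 0" using insert.prems by simp
  obtain q where q: "g = fps_X * q - fps_const y * q"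
    using fps_eval_root_division[OF y0, of g] insert.prems by auto
  have root: "fps_eval x q = 0" if "x \<in> Y" for x
  proof -
    have x0: "fps_nth x 0 = 0" using insert.prems that by simp
    have "0 = fps_eval x g" using insert.prems that by simp
    also have "\<dots> = (x - y) * fps_eval x q"
      by (simp only: q fps_eval_diff[OF x0] fps_eval_X_mult[OF x0] fps_eval_const_mult[OF x0] left_diff_distrib)
    finally show ?thesis using that insert.hyps by auto
  qed
  have IH: "fps_nth (fps_nth q j) 0 = 0" if "j < card Y" for j
    using insert.IH[of q j] root insert.prems that by simp
  show ?case
  proof (cases i)
    case 0
    then show ?thesis by (simp add: q y0)
  next
    case (Suc j)
    then have "j < card Y" using insert.prems(3) insert.hyps by simp
    then show ?thesis using IH[of j] by (simp add: q y0 Suc)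
  qed
qed simp

lemma roots_poly_inject: "roots_poly R = roots_poly S \<Longrightarrow> R = S"
proof (induction R arbitrary: S)
  case empty
  then have "size S = 0" by (metis degree_roots_poly size_empty)
  then show ?case by simp
next
  case (add r R)
  have "poly (roots_poly (add_mset r R)) r = 0" by (simp add: poly_roots_poly)
  then have "poly (roots_poly S) r = 0" using add.prems by metis
  then have "r \<in># S" by (auto simp: poly_roots_poly prod_mset_zero_iff)
  then obtain S' where S: "S = add_mset r S'" by (metis multi_member_split)
  then have "[:- r, 1:] * roots_poly R = [:- r, 1:] * roots_poly S'" using add.prems by simp
  then have "roots_poly R = roots_poly S'" by (metis mult_left_cancel one_neq_zero pCons_eq_0_iff)
  then show ?case using add.IH S by simp
qed

lemma twist_mult: "twist z (f * g) = twist z f * twist z g"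
proof (rule fps_ext)
  fix k
  have e: "z ^ k * (fps_nth f i * fps_nth g (k - i)) = z ^ i * fps_nth f i * (z ^ (k - i) * fps_nth g (k - i))"
    if "i \<in> {0..k}" for i
  proof -
    have "z ^ k = z ^ i * z ^ (k - i)" using that by (simp flip: power_add)
    then show ?thesis by simp
  qed
  show "fps_nth (twist z (f * g)) k = fps_nth (twist z f * twist z g) k"
    unfolding twist_nth fps_mult_nth sum_distrib_left by (intro sum.cong refl e)
qed

interpretation twist: comm_ring_hom "twist z" for z
  by unfold_locales (auto intro!: fps_ext simp: twist_mult algebra_simps)

interpretation ptwist: map_poly_comm_ring_hom "twist z" for z ..

lemma ptwist_roots_poly: "map_poly (twist z) (roots_poly R) = roots_poly (image_mset (twist z) R)"
  by (induction R) (simp_all add: ptwist.hom_mult twist.hom_uminus del: mult_pCons_left)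

lemma twist_fsub:
  assumes "z ^ N = 1" "N > 0"
  shows "twist z (fsub N a) = fsub N a"
proof (rule fps_ext)
  fix k show "fps_nth (twist z (fsub N a)) k = fps_nth (fsub N a) k"
    using assms by (auto simp: fsub_nth power_mult elim!: dvdE)
qed

lemma fsub_inj: "N > 0 \<Longrightarrow> fsub N a = fsub N b \<Longrightarrow> a = b"
  by (intro fps_ext) (metis dvd_triv_left fsub_nth nonzero_mult_div_cancel_left less_numeral_extra(3))

lemma twist_invariant_fsub:
  assumes "N > 0" "\<And>k. \<zeta> ^ k = 1 \<longleftrightarrow> N dvd k" "twist \<zeta> g = g"
  shows "g = fsub N (Abs_fps (\<lambda>m. fps_nth g (N * m)))"
proof (rule fps_ext)
  fix k
  have "\<zeta> ^ k * fps_nth g k = fps_nth g k" using assms(3) by (metis twist_nth)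
  then have "fps_nth g k = 0" if "\<not> N dvd k" using that assms(2) by auto
  then show "fps_nth g k = fps_nth (fsub N (Abs_fps (\<lambda>m. fps_nth g (N * m)))) k"
    using assms(1) by (auto simp: fsub_nth)
qed

lemma geometric_sum_le:
  fixes x :: real
  assumes "0 \<le> x" "x \<le> 1 / 2"
  shows "(\<Sum>l\<le>j. x ^ l) \<le> 1 + 2 * x"
proof (induction j)
  case (Suc j)
  have "(\<Sum>l\<le>Suc j. x ^ l) = 1 + x * (\<Sum>l\<le>j. x ^ l)"
    unfolding sum.atMost_Suc_shift by (simp add: sum_distrib_left)
  also have "x * (\<Sum>l\<le>j. x ^ l) \<le> x * (1 + 2 * x)" using Suc assms by (intro mult_left_mono) auto
  also have "\<dots> \<le> x * 2" using assms by (intro mult_left_mono) auto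
  finally show ?case by simp
qed (use assms in simp)

lemma conv_series_unit:
  assumes s: "fps_nth (fps_nth (Rep_conv_series s) 0) 0 \<noteq> 0"
  shows "s dvd 1"
proof -
  let ?f = "Rep_conv_series s"
  let ?n = "\<lambda>h j i. fps_nth (fps_nth h j) i"
  define c where "c = ?n ?f 0 0"
  have c0: "norm c > 0" using s by (simp add: c_def)
  obtain C R where C: "C \<ge> 0" "R > 0" and b: "\<And>i j. norm (?n ?f j i) \<le> C * R ^ (i + j)"
    using Rep_conv_series[of s] unfolding mem_Collect_eq convergent2_iff_bound by blast
  define f0 where "f0 = fps_nth ?f 0"
  have "fps_nth f0 0 \<noteq> 0" using s by (simp add: f0_def)
  then have inv: "f0 * inverse f0 = 1" by (simp add: inverse_mult_eq_1')
  define g where "g = fps_right_inverse ?f (inverse f0)"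
  have fg: "?f * g = 1" unfolding g_def using inv by (intro fps_right_inverse) (simp add: f0_def)
  define x where "x = norm c / (6 * C + 2 * norm c)"
  have den: "6 * C + 2 * norm c > 0" using C c0 by linarith
  have x: "x > 0" "x \<le> 1 / 2" "C * (6 * x) \<le> norm c"
  proof -
    show "x > 0" unfolding x_def using den c0 by simp
    show "x \<le> 1 / 2" unfolding x_def using den C by (simp add: divide_le_eq)
    have "C * 6 / (6 * C + 2 * norm c) \<le> 1" using den c0 by (simp add: divide_le_eq)
    then have "(C * 6 / (6 * C + 2 * norm c)) * norm c \<le> 1 * norm c" using c0 by (intro mult_right_mono) auto
    then show "C * (6 * x) \<le> norm c" unfolding x_def by simp
  qed
  define S where "S = R / x"
  have S: "S > 0" "R = x * S" using C x by (auto simp: S_def)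
  define K where "K = 1 / norm c"
  have K: "K > 0" using c0 by (simp add: K_def)
  have conv: "?n (?f * g) j i = (\<Sum>(l, k)\<in>{..j} \<times> {..i}. ?n ?f l k * ?n g (j - l) (i - k))" for i j
    by (simp add: fps_mult_nth fps_sum_nth atMost_atLeast0 sum.cartesian_product)
  have "norm (?n g j i) \<le> K * S ^ (i + j)" for i j
  proof (induction "i + j" arbitrary: i j rule: less_induct)
    case less
    let ?A = "{..j} \<times> {..i} - {(0, 0)}"
    have "{..j} \<times> {..i} = insert (0, 0) ?A" by auto
    then have "?n (?f * g) j i = c * ?n g j i + (\<Sum>(l, k)\<in>?A. ?n ?f l k * ?n g (j - l) (i - k))"
      unfolding conv by (metis (no_types, lifting) c_def case_prod_conv diff_zero finite_SigmaI finite_atMost sum.remove[of "{..j} \<times> {..i}" "(0, 0)"] insertI1)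
    then have e: "?n 1 j i = c * ?n g j i + (\<Sum>(l, k)\<in>?A. ?n ?f l k * ?n g (j - l) (i - k))" by (simp only: fg)
    show ?case
    proof (cases "i + j = 0")
      case True
      then have "c * ?n g j i = 1" using e by simp
      then have "?n g j i = 1 / c" using s by (simp add: c_def field_simps)
      then show ?thesis using True by (simp add: K_def norm_divide)
    next
      case False
      then have "?n 1 j i = (0 :: complex)" by (cases j) auto
      then have "c * ?n g j i = - (\<Sum>(l, k)\<in>?A. ?n ?f l k * ?n g (j - l) (i - k))"
        using e by (simp add: eq_neg_iff_add_eq_0)
      then have "norm c * norm (?n g j i) = norm (\<Sum>(l, k)\<in>?A. ?n ?f l k * ?n g (j - l) (i - k))"
        by (simp only: norm_minus_cancel flip: norm_mult)
      also have "\<dots> \<le> (\<Sum>(l, k)\<in>?A. norm (?n ?f l k * ?n g (j - l) (i - k)))"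
        by (rule order_trans[OF norm_sum]) (simp add: case_prod_unfold)
      also have "\<dots> \<le> (\<Sum>(l, k)\<in>?A. C * K * S ^ (i + j) * (x ^ l * x ^ k))"
      proof (rule sum_mono)
        fix p assume pA: "p \<in> ?A"
        obtain l k where pl: "p = (l, k)" by (cases p)
        with pA have p: "p = (l, k)" "l \<le> j" "k \<le> i" "(l, k) \<noteq> (0, 0)" by auto
        have "norm (?n g (j - l) (i - k)) \<le> K * S ^ ((i - k) + (j - l))"
          using p by (intro less) auto
        then have "norm (?n ?f l k) * norm (?n g (j - l) (i - k)) \<le> (C * R ^ (k + l)) * (K * S ^ ((i - k) + (j - l)))"
          using b C by (intro mult_mono) auto
        also have "\<dots> = C * K * (x ^ (k + l) * (S ^ (k + l) * S ^ ((i - k) + (j - l))))"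
          by (simp add: S(2) power_mult_distrib)
        also have "S ^ (k + l) * S ^ ((i - k) + (j - l)) = S ^ (i + j)"
          using p by (simp flip: power_add)
        finally show "(case p of (l, k) \<Rightarrow> norm (?n ?f l k * ?n g (j - l) (i - k))) \<le>
            (case p of (l, k) \<Rightarrow> C * K * S ^ (i + j) * (x ^ l * x ^ k))"
          by (simp add: p norm_mult power_add ac_simps)
      qed
      also have "\<dots> = C * K * S ^ (i + j) * (\<Sum>(l, k)\<in>?A. x ^ l * x ^ k)"
        by (simp add: sum_distrib_left case_prod_unfold)
      also have "(\<Sum>(l, k)\<in>?A. x ^ l * x ^ k) \<le> 6 * x"
      proof -
        have "(\<Sum>(l, k)\<in>{..j} \<times> {..i}. x ^ l * x ^ k) = (\<Sum>l\<le>j. x ^ l) * (\<Sum>k\<le>i. x ^ k)"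
          by (simp add: sum_product sum.cartesian_product)
        also have "\<dots> \<le> (1 + 2 * x) * (1 + 2 * x)"
          using x by (intro mult_mono geometric_sum_le sum_nonneg) auto
        also have "\<dots> \<le> 1 + 6 * x"
          using mult_left_mono[OF x(2), of x] x(1) by (simp add: algebra_simps)
        finally have "(\<Sum>(l, k)\<in>{..j} \<times> {..i}. x ^ l * x ^ k) \<le> 1 + 6 * x" .
        moreover have "(\<Sum>(l, k)\<in>{..j} \<times> {..i}. x ^ l * x ^ k) = 1 + (\<Sum>(l, k)\<in>?A. x ^ l * x ^ k)"
          by (subst sum.remove[of _ "(0, 0)"]) auto
        ultimately show ?thesis by linarith
      qed
      also have "C * K * S ^ (i + j) * (6 * x) = (C * (6 * x)) * (K * S ^ (i + j))" by simp
      also have "\<dots> \<le> norm c * (K * S ^ (i + j))"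
        using x K S by (intro mult_right_mono) auto
      finally show ?thesis using C K S c0 by (simp add: mult_left_mono)
    qed
  qed
  then have "convergent2 g" using K S by (intro convergent2I[of K S]) auto
  then have "Rep_conv_series (Abs_conv_series g) = g" by (simp add: Abs_conv_series_inverse)
  then have "Rep_conv_series (s * Abs_conv_series g) = Rep_conv_series 1"
    using fg by (simp add: times_conv_series.rep_eq one_conv_series.rep_eq)
  then have "s * Abs_conv_series g = 1" by (simp add: Rep_conv_series_inject)
  then show ?thesis by (metis dvd_triv_left)
qed

lemma conv_series_unit_iff: "s dvd 1 \<longleftrightarrow> fps_nth (fps_nth (sw s) 0) 0 \<noteq> 0"
proof
  assume "s dvd 1"
  then obtain t where "s * t = 1" by (metis dvdE)
  then have "sw s * sw t = 1" by (metis sw_mult sw_1)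
  then have "fps_nth (fps_nth (sw s * sw t) 0) 0 = 1" by simp
  then show "fps_nth (fps_nth (sw s) 0) 0 \<noteq> 0" by auto
qed (simp add: sw_def conv_series_unit)

lemma twist_fps_eval:
  "twist z (fps_eval y g) = fps_eval (twist z y) (Abs_fps (\<lambda>i. twist z (fps_nth g i)))"
proof (rule fps_ext)
  fix m
  have "fps_nth (twist z (fps_eval y g)) m = fps_nth (twist z (\<Sum>i\<le>m. fps_nth g i * y ^ i)) m"
    by (simp add: fps_eval_def)
  also have "twist z (\<Sum>i\<le>m. fps_nth g i * y ^ i) = (\<Sum>i\<le>m. twist z (fps_nth g i) * twist z y ^ i)"
    by (simp add: hom_distribs)
  finally show "fps_nth (twist z (fps_eval y g)) m =
      fps_nth (fps_eval (twist z y) (Abs_fps (\<lambda>i. twist z (fps_nth g i)))) m"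
    by (simp add: fps_eval_def)
qed

definition fsub2 :: "nat \<Rightarrow> complex fps fps \<Rightarrow> complex fps fps" where
  "fsub2 N g = Abs_fps (\<lambda>i. fsub N (fps_nth g i))"

lemma fsub2_nth [simp]: "fps_nth (fsub2 N g) i = fsub N (fps_nth g i)"
  by (simp add: fsub2_def)

lemma fsub2_mult: "fsub2 N (f * g) = fsub2 N f * fsub2 N g"
  by (rule fps_ext) (simp add: fps_mult_nth hom_distribs)

lemma fsub2_fps_of_poly: "fsub2 N (fps_of_poly F) = fps_of_poly (psub N F)"
  by (rule fps_ext) (simp add: coeff_map_poly)

lemma red_roots_poly: "(\<And>r. r \<in># R \<Longrightarrow> fps_nth r 0 = 0) \<Longrightarrow> red (roots_poly R) = monom 1 (size R)"
proof (induction R)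
  case (add r R)
  have "red (roots_poly (add_mset r R)) = red [:- r, 1:] * red (roots_poly R)"
    by (simp only: roots_poly_add red_mult)
  also have "\<dots> = [:0, 1:] * monom 1 (size R)" using add by simp
  finally show ?case by (simp add: monom_Suc)
qed simp

lemma conv1_coeff_roots_poly: "(\<And>r. r \<in># R \<Longrightarrow> conv1 r) \<Longrightarrow> conv1 (coeff (roots_poly R) i)"
proof (induction R arbitrary: i)
  case (add r R)
  have "conv1 (coeff ([:- r, 1:] * roots_poly R) i)"
    using add by (intro conv1_coeff_mult) (auto simp: coeff_pCons conv1_uminus split: nat.splits)
  then show ?case by simp
qed (simp add: coeff_1)

lemma conv1_fsub_iff:
  assumes N: "N > 0" and "conv1 (fsub N a)"
  shows "conv1 a"
proof -
  obtain r B where r: "r > 0" "\<And>M. tnorm r M (fsub N a) \<le> B" using assms(2) by (auto simp: conv1_def)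
  have "tnorm (r ^ N) M a \<le> B" for M
  proof -
    have "tnorm (r ^ N) M a = (\<Sum>m\<in>(\<lambda>m. N * m) ` {..M}. norm (fps_nth (fsub N a) m) * r ^ m)"
      using N by (subst sum.reindex) (auto simp: tnorm_def fsub_nth power_mult inj_on_def)
    also have "\<dots> \<le> tnorm r (N * M) (fsub N a)"
      unfolding tnorm_def using r N by (intro sum_mono2) auto
    finally show ?thesis using r(2)[of "N * M"] by linarith
  qed
  then show ?thesis unfolding conv1_def using r by (metis zero_less_power)
qed

lemma conv_series_of_poly:
  assumes "\<And>i. conv1 (coeff G i)"
  obtains t where "sw t = fps_of_poly G"
proof -
  obtain r B where r: "r > 0" "B \<ge> 0" "\<And>i M. i \<in> {..degree G} \<Longrightarrow> tnorm r M (coeff G i) \<le> B"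
    using conv1_common[of "{..degree G}" "coeff G"] assms by (metis finite_atMost)
  define R where "R = max 1 (1 / r)"
  have R: "R \<ge> 1" "1 / r \<le> R" by (auto simp: R_def)
  have "norm (fps_nth (coeff G i) j) \<le> B * R ^ (i + j)" for i j
  proof (cases "i \<le> degree G")
    case True
    have "norm (fps_nth (coeff G i) j) * r ^ j \<le> tnorm r j (coeff G i)"
      unfolding tnorm_def using r by (intro member_le_sum) auto
    also have "\<dots> \<le> B" using r True by simp
    finally have "norm (fps_nth (coeff G i) j) \<le> B * (1 / r) ^ j"
      using r by (simp add: field_simps)
    also have "\<dots> \<le> B * (R ^ i * R ^ j)"
    proof (rule mult_left_mono)
      have "(1 / r) ^ j \<le> R ^ j" using R r by (intro power_mono) auto
      also have "\<dots> \<le> R ^ i * R ^ j" using R by (simp add: mult_le_cancel_right1)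
      finally show "(1 / r) ^ j \<le> R ^ i * R ^ j" .
    qed (use r in simp)
    finally show ?thesis by (simp add: power_add)
  next
    case False
    then show ?thesis using r R by (simp add: coeff_eq_0)
  qed
  then have "convergent2 (swap2 (fps_of_poly G))"
    using r R by (intro convergent2I[of B R]) auto
  then have "sw (Abs_conv_series (swap2 (fps_of_poly G))) = fps_of_poly G"
    by (simp add: sw_def Abs_conv_series_inverse)
  then show thesis by (rule that)
qed

lemma twist_roots_stable:
  assumes "z ^ N = 1" "N > 0" "psub N F = smult (fps_const a) (roots_poly R)" "a \<noteq> 0"
  shows "image_mset (twist z) R = R"
proof -
  have "map_poly (twist z) (psub N F) = psub N F"
    using assms(1,2) by (intro poly_eqI) (simp add: coeff_map_poly twist_fsub)
  then have "smult (twist z (fps_const a)) (roots_poly (image_mset (twist z) R)) = smult (fps_const a) (roots_poly R)"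
    using assms(3) by (simp add: twist.map_poly_hom_smult ptwist_roots_poly)
  also have "twist z (fps_const a) = fps_const a" by (rule fps_ext) simp
  finally have "smult (fps_const a) (roots_poly (image_mset (twist z) R) - roots_poly R) = 0"
    by (simp add: smult_diff_right)
  then have "roots_poly (image_mset (twist z) R) = roots_poly R" using assms(4) by (subst (asm) smult_eq_0_iff) simp
  then show ?thesis by (rule roots_poly_inject)
qed

lemma twist_invariant_poly:
  assumes N: "N > 0" and prim: "\<And>k. \<zeta> ^ k = 1 \<longleftrightarrow> N dvd k"
    and inv: "map_poly (twist \<zeta>) P = P"
  obtains G where "P = psub N G"
proof -
  define G where "G = (\<Sum>i\<le>degree P. monom (Abs_fps (\<lambda>m. fps_nth (coeff P i) (N * m))) i)"
  have "P = psub N G"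
  proof (rule poly_eqI)
    fix i
    have "twist \<zeta> (coeff P i) = coeff P i" using inv by (metis coeff_map_poly twist.hom_zero)
    then have "coeff P i = fsub N (Abs_fps (\<lambda>m. fps_nth (coeff P i) (N * m)))"
      by (rule twist_invariant_fsub[OF N prim])
    then show "coeff P i = coeff (psub N G) i"
      by (cases "i \<le> degree P") (simp_all add: coeff_map_poly G_def coeff_sum coeff_eq_0)
  qed
  then show thesis by (rule that)
qed

context
  fixes N :: nat and \<zeta> :: complex and s :: conv_series and F :: "complex fps poly"
    and F0 :: "complex poly poly" and a :: complex and Y :: "complex fps set"
  assumes N: "N > 0" and prim: "\<And>k. \<zeta> ^ k = 1 \<longleftrightarrow> N dvd k"
    and F: "F = map_poly fps_of_poly F0" and s: "sw s = fps_of_poly F"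
    and split: "psub N F = smult (fps_const a) (roots_poly (mset_set Y))" and a0: "a \<noteq> 0"
    and fin: "finite Y" and ne: "Y \<noteq> {}" and Y0: "\<And>y. y \<in> Y \<Longrightarrow> fps_nth y 0 = 0"
begin

lemma twist_Y: "twist \<zeta> ` Y = Y"
proof -
  have "image_mset (twist \<zeta>) (mset_set Y) = mset_set Y"
    using prim[of N] by (intro twist_roots_stable[OF _ N split a0]) simp
  then show ?thesis by (metis fin finite_set_mset_mset_set set_image_mset)
qed

lemma coeff_F_0: "fps_nth (coeff F i) 0 = (if i = card Y then a else 0)"
proof -
  have "fps_nth (coeff F i) 0 = coeff (red (psub N F)) i"
    using N by (simp add: coeff_map_poly fsub_nth)
  also have "red (psub N F) = smult a (monom 1 (card Y))"
    unfolding split using Y0 fin red_roots_poly[of "mset_set Y"] by simp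
  finally show ?thesis by simp
qed

lemma conv1_F: "conv1 (coeff (psub N F) i)"
proof (rule conv1_finite[of "N * degree (coeff F0 i)"])
  fix m assume m: "m > N * degree (coeff F0 i)"
  show "fps_nth (coeff (psub N F) i) m = 0"
  proof (cases "N dvd m")
    case True
    then obtain l where l: "m = N * l" by blast
    then have "l > degree (coeff F0 i)" using m by simp
    then show ?thesis using l N by (simp add: F coeff_map_poly fsub_nth coeff_eq_0)
  next
    case False
    then show ?thesis using N by (simp add: coeff_map_poly fsub_nth)
  qed
qed

lemma conv1_Y:
  assumes "y \<in> Y"
  shows "conv1 y"
proof (rule conv1_simple_root[OF conv1_F])
  have Y: "mset_set Y = add_mset y (mset_set (Y - {y}))"
    using assms fin by (simp add: mset_set.remove)
  show "poly (psub N F) y = 0"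
    using assms fin by (simp add: split poly_roots_poly Y)
  have "poly (pderiv (roots_poly (mset_set Y))) y = poly (roots_poly (mset_set (Y - {y}))) y"
    unfolding Y roots_poly_add by (simp add: pderiv_mult pderiv_pCons del: mult_pCons_left)
  also have "\<dots> \<noteq> 0" using fin by (auto simp: poly_roots_poly prod_mset_zero_iff)
  finally show "poly (pderiv (psub N F)) y \<noteq> 0"
    using a0 by (simp add: split pderiv_smult)
qed

lemma conjugate_no_factor:
  assumes conj: "conjugate_set \<zeta> Y" and st: "s = t * u" and u: "fps_nth (fps_nth (sw u) 0) 0 = 0"
    and y: "y \<in> Y" and ev: "fps_eval y (fsub2 N (sw t)) = 0"
  shows False
proof -
  have all: "fps_eval y' (fsub2 N (sw t)) = 0" if "y' \<in> Y" for y'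
  proof -
    obtain k where k: "y' = twist (\<zeta> ^ k) y" using conj y \<open>y' \<in> Y\<close> by (auto simp: conjugate_set_def)
    have z: "(\<zeta> ^ k) ^ N = 1" using prim[of N] by (simp flip: power_mult) (simp add: mult.commute power_mult)
    have "Abs_fps (\<lambda>i. twist (\<zeta> ^ k) (fps_nth (fsub2 N (sw t)) i)) = fsub2 N (sw t)"
      using twist_fsub[OF z N] by (intro fps_ext) simp
    then have "fps_eval y' (fsub2 N (sw t)) = twist (\<zeta> ^ k) (fps_eval y (fsub2 N (sw t)))"
      by (simp add: k twist_fps_eval)
    then show ?thesis by (simp add: ev)
  qed
  have t: "fps_nth (fps_nth (sw t) i) 0 = 0" if "i < card Y" for i
    using fps_eval_many_roots[OF fin Y0 all that] N by (simp add: fsub_nth)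
  have "a = fps_nth (fps_nth (sw s) (card Y)) 0"
    by (simp add: s coeff_F_0)
  also have "\<dots> = (\<Sum>j\<in>{0..card Y}. fps_nth (fps_nth (sw t) j) 0 * fps_nth (fps_nth (sw u) (card Y - j)) 0)"
    by (simp add: st sw_mult fps_mult_nth[of "sw t"] fps_sum_nth)
  also have "\<dots> = 0"
  proof (rule sum.neutral, rule ballI)
    fix j assume "j \<in> {0..card Y}"
    then show "fps_nth (fps_nth (sw t) j) 0 * fps_nth (fps_nth (sw u) (card Y - j)) 0 = 0"
      using t[of j] u by (cases "j = card Y") auto
  qed
  finally show False using a0 by simp
qed

theorem irreducible_iff_conjugate: "irreducible s \<longleftrightarrow> conjugate_set \<zeta> Y"
proof
  assume conj: "conjugate_set \<zeta> Y"
  have cY: "card Y > 0" using fin ne by (simp add: card_gt_0_iff)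
  show "irreducible s"
  proof (rule irreducibleI)
    show "s \<noteq> 0"
    proof
      assume "s = 0"
      then have "fps_nth (fps_nth (sw s) (card Y)) 0 = 0" by (simp add: sw_0)
      then show False using a0 by (simp add: s coeff_F_0)
    qed
    show "\<not> s dvd 1" using cY by (simp add: conv_series_unit_iff s coeff_F_0)
    fix t u assume st: "s = t * u"
    show "t dvd 1 \<or> u dvd 1"
    proof (rule ccontr)
      assume "\<not> (t dvd 1 \<or> u dvd 1)"
      then have tu: "fps_nth (fps_nth (sw t) 0) 0 = 0" "fps_nth (fps_nth (sw u) 0) 0 = 0"
        by (auto simp: conv_series_unit_iff)
      obtain y where y: "y \<in> Y" using ne by blast
      have "fps_eval y (fsub2 N (sw t)) * fps_eval y (fsub2 N (sw u)) = fps_eval y (fsub2 N (sw s))"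
        by (simp add: st sw_mult fsub2_mult fps_eval_mult Y0 y)
      also have "\<dots> = poly (psub N F) y" by (simp add: s fsub2_fps_of_poly fps_eval_fps_of_poly Y0 y)
      also have "\<dots> = 0" using y fin by (simp add: split poly_roots_poly prod_mset_zero_iff)
      finally have "fps_eval y (fsub2 N (sw t)) = 0 \<or> fps_eval y (fsub2 N (sw u)) = 0" by simp
      then show False
        using conjugate_no_factor[OF conj st tu(2) y] conjugate_no_factor[OF conj _ tu(1) y, of u] st
        by (auto simp: mult.commute)
    qed
  qed
next
  assume irr: "irreducible s"
  show "conjugate_set \<zeta> Y"
  proof (rule ccontr)
    assume "\<not> conjugate_set \<zeta> Y"
    then obtain x y where xy: "x \<in> Y" "y \<in> Y" "\<And>k. y \<noteq> twist (\<zeta> ^ k) x"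
      by (auto simp: conjugate_set_def)
    define Orb where "Orb = range (\<lambda>k. twist (\<zeta> ^ k) x)"
    have \<zeta>0: "\<zeta> \<noteq> 0" using prim[of N] N by (metis dvd_refl power_0_left not_gr0 zero_neq_one)
    have "twist (\<zeta> ^ k) x \<in> Y" for k
    proof (induction k)
      case (Suc k)
      have "twist (\<zeta> ^ Suc k) x = twist \<zeta> (twist (\<zeta> ^ k) x)" by (simp add: twist_twist)
      then show ?case using Suc twist_Y by blast
    qed (use xy in simp)
    then have OY: "Orb \<subseteq> Y" by (auto simp: Orb_def)
    have finO: "finite Orb" using OY fin by (rule finite_subset)
    have "x \<in> Orb" unfolding Orb_def by (rule range_eqI[of _ _ 0]) simp
    have "y \<notin> Orb" using xy by (auto simp: Orb_def)
    have tO: "twist \<zeta> ` Orb = Orb"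
    proof (rule card_subset_eq[OF finO])
      show "twist \<zeta> ` Orb \<subseteq> Orb"
      proof
        fix v assume "v \<in> twist \<zeta> ` Orb"
        then obtain k where "v = twist \<zeta> (twist (\<zeta> ^ k) x)" by (auto simp: Orb_def)
        then have "v = twist (\<zeta> ^ Suc k) x" by (simp add: twist_twist)
        then show "v \<in> Orb" unfolding Orb_def by (rule range_eqI)
      qed
      show "card (twist \<zeta> ` Orb) = card Orb"
        using inj_twist[OF \<zeta>0] by (intro card_image) (auto simp: inj_on_def inj_def)
    qed
    have tYO: "twist \<zeta> ` (Y - Orb) = Y - Orb"
      using tO twist_Y inj_twist[OF \<zeta>0] by (metis image_set_diff)
    have inv: "map_poly (twist \<zeta>) (roots_poly (mset_set A)) = roots_poly (mset_set A)"
      if "twist \<zeta> ` A = A" for A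
      using that inj_twist[OF \<zeta>0] by (simp add: ptwist_roots_poly image_mset_mset_set inj_on_def inj_def)
    obtain G1 where G1: "roots_poly (mset_set Orb) = psub N G1"
      using twist_invariant_poly[OF N prim inv[OF tO]] by blast
    obtain G2 where G2: "roots_poly (mset_set (Y - Orb)) = psub N G2"
      using twist_invariant_poly[OF N prim inv[OF tYO]] by blast
    have c1: "conv1 (coeff G1 i)" for i
    proof (rule conv1_fsub_iff[OF N])
      have "conv1 (coeff (roots_poly (mset_set Orb)) i)"
        using conv1_Y OY finO by (intro conv1_coeff_roots_poly) auto
      then show "conv1 (fsub N (coeff G1 i))" by (simp add: G1 coeff_map_poly)
    qed
    have c2: "conv1 (coeff (smult (fps_const a) G2) i)" for i
    proof -
      have "conv1 (coeff (roots_poly (mset_set (Y - Orb))) i)"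
        using conv1_Y fin by (intro conv1_coeff_roots_poly) auto
      then have "conv1 (fsub N (coeff G2 i))" by (simp add: G2 coeff_map_poly)
      then have "conv1 (coeff G2 i)" by (rule conv1_fsub_iff[OF N])
      then show ?thesis by (simp add: conv1_mult)
    qed
    obtain t where t: "sw t = fps_of_poly G1" using conv_series_of_poly[OF c1] by blast
    obtain u where u: "sw u = fps_of_poly (smult (fps_const a) G2)" using conv_series_of_poly[OF c2] by blast
    have fc: "fsub N (fps_const a) = fps_const a" using N by (intro fps_ext) (auto simp: fsub_nth)
    have "mset_set Y = mset_set Orb + mset_set (Y - Orb)"
      using OY fin finO by (metis Diff_disjoint Un_Diff_cancel finite_Diff mset_set_Union sup.absorb_iff2)
    then have "psub N F = psub N (G1 * smult (fps_const a) G2)"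
      by (simp add: split psub.hom_mult fsub.map_poly_hom_smult fc G1 G2)
    then have "F = G1 * smult (fps_const a) G2"
      using fsub_inj[OF N] by (intro poly_eqI) (metis coeff_map_poly fsub_0)
    then have "sw s = sw (t * u)" by (simp add: s sw_mult t u fps_of_poly_mult fps_of_poly_smult)
    then have "s = t * u" by (simp add: sw_inject)
    then have "t dvd 1 \<or> u dvd 1" using irr by (rule irreducibleD[rotated])
    moreover have z: "fps_nth (coeff (roots_poly (mset_set A)) 0) 0 = 0" if "A \<subseteq> Y" "A \<noteq> {}" for A
    proof -
      have "finite A" using that fin by (metis finite_subset)
      then have "red (roots_poly (mset_set A)) = monom 1 (card A)"
        using that Y0 by (subst red_roots_poly) auto
      then have "coeff (red (roots_poly (mset_set A))) 0 = coeff (monom 1 (card A)) 0" by simp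
      then show ?thesis using \<open>finite A\<close> that by simp
    qed
    have "fps_nth (coeff G1 0) 0 = 0"
    proof -
      have "fps_nth (coeff (psub N G1) 0) 0 = 0"
        unfolding G1[symmetric] using z[of Orb] OY \<open>x \<in> Orb\<close> by blast
      then show ?thesis using N by (simp add: coeff_map_poly fsub_nth)
    qed
    moreover have "fps_nth (coeff G2 0) 0 = 0"
    proof -
      have "fps_nth (coeff (psub N G2) 0) 0 = 0"
        unfolding G2[symmetric] using z[of "Y - Orb"] \<open>y \<in> Y\<close> \<open>y \<notin> Orb\<close> by blast
      then show ?thesis using N by (simp add: coeff_map_poly fsub_nth)
    qed
    ultimately show False by (simp add: conv_series_unit_iff t u)
  qed
qed

end

section \<open>The local equation at infinity\<close>

lemma (in comm_ring_hom) homog_eval_hom: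
  "hom (homog_eval \<kappa> p X Y Z) = homog_eval (\<lambda>z. hom (\<kappa> z)) p (hom X) (hom Y) (hom Z)"
  by (simp add: homog_eval_def hom_distribs case_prod_unfold)

lemma supp2_total_degree: "(i, j) \<in> supp2 p \<Longrightarrow> i + j \<le> total_degree p"
  unfolding total_degree_def by (rule Max_ge) (auto intro!: image_eqI[of _ _ "(i, j)"])

lemma coeff_total_degree: "i + j > total_degree p \<Longrightarrow> coeff (coeff p j) i = 0"
  using supp2_total_degree[of i j p] by (auto simp: supp2_def)

lemma sum_supp2_single:
  "(\<Sum>x\<in>supp2 p. if x = (i, j) then f else 0) = (if coeff (coeff p j) i \<noteq> 0 then f else 0)"
proof -
  have "(\<Sum>x\<in>supp2 p. if x = (i, j) then f else 0) = (if (i, j) \<in> supp2 p then f else 0)" by simp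
  then show ?thesis by (simp add: supp2_def)
qed

lemma homog_eval_scale:
  "homog_eval \<kappa> p (l * X) (l * Y) (l * Z) = l ^ total_degree p * homog_eval \<kappa> p X Y Z"
  unfolding homog_eval_def sum_distrib_left
proof (rule sum.cong)
  fix x assume x: "x \<in> supp2 p"
  obtain i j where ij: "x = (i, j)" by (cases x)
  have "l ^ total_degree p = l ^ i * l ^ j * l ^ (total_degree p - (i + j))"
    using supp2_total_degree[of i j p] x ij by (simp flip: power_add)
  then show "(case x of (i, j) \<Rightarrow> \<kappa> (coeff (coeff p j) i) * (l * X) ^ i * (l * Y) ^ j * (l * Z) ^ (total_degree p - (i + j)))
      = l ^ total_degree p * (case x of (i, j) \<Rightarrow> \<kappa> (coeff (coeff p j) i) * X ^ i * Y ^ j * Z ^ (total_degree p - (i + j)))"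
    by (simp add: ij power_mult_distrib ac_simps)
qed simp

lemma homog_eval_self:
  "homog_eval (\<lambda>z. [:[:z:]:]) p [:[:0, 1:]:] [:0, 1:] 1 = p"
proof (intro poly_eqI)
  fix i0 j0
  have t: "[:[:z:]:] * [:[:0, 1:]:] ^ i * [:0, 1:] ^ j = monom (monom z i) j" for z :: complex and i j
  proof -
    have a: "[:[:0, 1 :: complex:]:] ^ i = [:monom 1 i:]" by (simp add: poly_const_pow monom_altdef)
    have b: "[:0, 1 :: complex poly:] ^ j = monom 1 j" by (simp add: monom_altdef)
    show ?thesis unfolding a b by (simp add: smult_monom)
  qed
  have "coeff (coeff (homog_eval (\<lambda>z. [:[:z:]:]) p [:[:0, 1:]:] [:0, 1:] 1) j0) i0 =
      (\<Sum>x\<in>supp2 p. if x = (i0, j0) then coeff (coeff p j0) i0 else 0)"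
    unfolding homog_eval_def coeff_sum
  proof (rule sum.cong)
    fix x :: "nat \<times> nat"
    obtain i j where ij: "x = (i, j)" by (cases x)
    show "coeff (coeff (case x of (i, j) \<Rightarrow> [:[:coeff (coeff p j) i:]:] * [:[:0, 1:]:] ^ i * [:0, 1:] ^ j * 1 ^ (total_degree p - (i + j))) j0) i0
        = (if x = (i0, j0) then coeff (coeff p j0) i0 else 0)"
      by (simp only: ij prod.case power_one mult_1_right t) auto
  qed (simp add: coeff_sum)
  also have "\<dots> = coeff (coeff p j0) i0" unfolding sum_supp2_single by simp
  finally show "coeff (coeff (homog_eval (\<lambda>z. [:[:z:]:]) p [:[:0, 1:]:] [:0, 1:] 1) j0) i0 = coeff (coeff p j0) i0" .
qed

definition top_form :: "complex poly poly \<Rightarrow> complex poly" where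
  "top_form p = homog_eval (\<lambda>z. [:z:]) p 1 [:0, 1:] 0"

lemma coeff_top_form:
  "coeff (top_form p) j = (if j \<le> total_degree p then coeff (coeff p j) (total_degree p - j) else 0)"
proof -
  let ?n = "total_degree p"
  have "coeff (top_form p) j = (\<Sum>(i, j')\<in>supp2 p. if i + j' = ?n \<and> j' = j then coeff (coeff p j') i else 0)"
    unfolding top_form_def homog_eval_def coeff_sum
  proof (rule sum.cong)
    fix x assume x: "x \<in> supp2 p"
    obtain i j' where ij: "x = (i, j')" by (cases x)
    have "i + j' \<le> ?n" using x ij supp2_total_degree by blast
    moreover have "[:0, 1:] ^ j' = (monom 1 j' :: complex poly)"
      by (simp add: monom_altdef)
    ultimately show "coeff (case x of (i, j) \<Rightarrow> [:coeff (coeff p j) i:] * 1 ^ i * [:0, 1:] ^ j * 0 ^ (?n - (i + j))) j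
       = (case x of (i, j') \<Rightarrow> if i + j' = ?n \<and> j' = j then coeff (coeff p j') i else 0)"
      by (auto simp: ij power_0_left smult_monom)
  qed simp
  also have "\<dots> = (\<Sum>x\<in>supp2 p. if x = (?n - j, j) then (if j \<le> ?n then coeff (coeff p j) (?n - j) else 0) else 0)"
    by (intro sum.cong) (auto split: if_splits)
  also have "\<dots> = (if j \<le> ?n then coeff (coeff p j) (?n - j) else 0)"
    unfolding sum_supp2_single by auto
  finally show ?thesis .
qed

lemma poly_top_form: "poly (top_form p) y = homog_eval (\<lambda>c. c) p 1 y 0"
proof -
  have ch: "comm_ring_hom (\<lambda>f :: complex poly. poly f y)" by unfold_locales auto
  show ?thesis unfolding top_form_def comm_ring_hom.homog_eval_hom[OF ch] by simp
qed

lemma single_root_poly: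
  fixes f :: "complex poly"
  assumes "f \<noteq> 0" "\<And>y. poly f y = 0 \<Longrightarrow> y = c"
  shows "f = smult (lead_coeff f) ([:- c, 1:] ^ degree f)"
proof -
  define k where "k = order c f"
  obtain q where q: "f = [:- c, 1:] ^ k * q" "\<not> [:- c, 1:] dvd q"
    using order_decomp[OF assms(1)] unfolding k_def by blast
  have "degree q = 0"
  proof (rule ccontr)
    assume "degree q \<noteq> 0"
    then obtain y where y: "poly q y = 0"
      using fundamental_theorem_of_algebra[of q] by (auto simp: constant_degree)
    then have "poly f y = 0" by (subst q(1)) simp
    then have "y = c" by (rule assms(2))
    then show False using y q(2) by (simp add: poly_eq_0_iff_dvd)
  qed
  then obtain a where a: "q = [:a:]" by (rule degree_eq_zeroE)
  then have f: "f = smult a ([:- c, 1:] ^ k)" using q(1) by simp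
  have "a \<noteq> 0" using f assms(1) by auto
  then have d: "degree f = k" by (simp only: f degree_smult_eq degree_linear_power \<open>a \<noteq> 0\<close> if_False)
  have "coeff f k = a" by (simp only: f coeff_smult coeff_linear_power mult_1_right)
  then show ?thesis unfolding d using f by (simp only:)
qed

lemma hpoint_mem: "(x, y, z) \<in> hpoint x y z"
  unfolding hpoint_def by (rule CollectI, rule exI[of _ 1]) simp

lemma hpoint_eqD:
  assumes "hpoint 1 y 0 = hpoint 1 c 0"
  shows "y = c"
proof -
  have "(1, y, 0) \<in> hpoint 1 c 0" using hpoint_mem[of 1 y 0] assms by simp
  then show ?thesis by (auto simp: hpoint_def)
qed

lemma hpoint_scale: "k \<noteq> 0 \<Longrightarrow> hpoint (k * x) (k * y) (k * z) = hpoint x y z"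
proof -
  assume k: "k \<noteq> 0"
  have 1: "\<exists>d. (c * (k * x), c * (k * y), c * (k * z)) = (d * x, d * y, d * z) \<and> d \<noteq> 0" if "c \<noteq> 0" for c
    using that k by (intro exI[of _ "c * k"]) simp
  have 2: "\<exists>d. (c * x, c * y, c * z) = (d * (k * x), d * (k * y), d * (k * z)) \<and> d \<noteq> 0" if "c \<noteq> 0" for c
    using that k by (intro exI[of _ "c / k"]) simp
  show ?thesis unfolding hpoint_def using 1 2 by blast
qed

lemma proj_closureI:
  "homog_eval (\<lambda>c. c) p x y z = 0 \<Longrightarrow> (x, y, z) \<noteq> (0, 0, 0) \<Longrightarrow> hpoint x y z \<in> proj_closure p"
  unfolding proj_closure_def by blast

lemma line_at_infinityI: "(x, y) \<noteq> (0, 0) \<Longrightarrow> hpoint x y 0 \<in> line_at_infinity"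
  unfolding line_at_infinity_def by blast

lemma single_point_at_infinity:
  assumes n: "total_degree p = n" "n \<ge> 1"
    and Q: "proj_closure p \<inter> line_at_infinity = {Q}" "Q \<noteq> hpoint 0 1 0"
  obtains a c where "a \<noteq> 0" "top_form p = smult a ([:- c, 1:] ^ n)" "Q = hpoint 1 c 0"
proof -
  define a where "a = coeff (coeff p n) 0"
  have homog01: "homog_eval (\<lambda>c. c) p 0 1 0 = a"
  proof -
    have "homog_eval (\<lambda>c. c) p 0 1 0 = (\<Sum>x\<in>supp2 p. if x = (0, n) then a else 0)"
      unfolding homog_eval_def
    proof (rule sum.cong)
      fix x assume x: "x \<in> supp2 p"
      obtain i j where ij: "x = (i, j)" by (cases x)
      have "i + j \<le> n" using x ij supp2_total_degree n by blast
      then show "(case x of (i, j) \<Rightarrow> coeff (coeff p j) i * 0 ^ i * 1 ^ j * 0 ^ (total_degree p - (i + j))) = (if x = (0, n) then a else 0)"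
        by (auto simp: ij power_0_left n a_def)
    qed simp
    also have "\<dots> = a" unfolding sum_supp2_single by (simp add: a_def)
    finally show ?thesis .
  qed
  have a0: "a \<noteq> 0"
  proof
    assume "a = 0"
    then have "hpoint 0 1 0 \<in> proj_closure p" using homog01 by (intro proj_closureI) simp_all
    moreover have "hpoint 0 1 0 \<in> line_at_infinity" by (rule line_at_infinityI) simp
    ultimately show False using Q by blast
  qed
  have "Q \<in> line_at_infinity" using Q by blast
  then obtain x y where xy: "Q = hpoint x y 0" "(x, y) \<noteq> (0, 0)" by (auto simp: line_at_infinity_def)
  have "x \<noteq> 0"
  proof
    assume "x = 0"
    then have "Q = hpoint 0 1 0" using xy hpoint_scale[of y 0 1 0] by simp
    then show False using Q by blast
  qed
  define c where "c = y / x"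
  have Qc: "Q = hpoint 1 c 0" using xy \<open>x \<noteq> 0\<close> hpoint_scale[of x 1 c 0] by (simp add: c_def)
  have cn: "coeff (top_form p) n = a" by (simp add: coeff_top_form n a_def)
  have dn: "degree (top_form p) = n"
    using cn a0 by (intro antisym degree_le le_degree) (auto simp: coeff_top_form n)
  have "top_form p = smult (lead_coeff (top_form p)) ([:- c, 1:] ^ degree (top_form p))"
  proof (rule single_root_poly)
    show "top_form p \<noteq> 0" using cn a0 by auto
    fix y assume "poly (top_form p) y = 0"
    then have "homog_eval (\<lambda>c. c) p 1 y 0 = 0" by (simp add: poly_top_form)
    then have "hpoint 1 y 0 \<in> proj_closure p" by (rule proj_closureI) simp
    moreover have "hpoint 1 y 0 \<in> line_at_infinity" by (rule line_at_infinityI) simp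
    ultimately have "hpoint 1 y 0 = hpoint 1 c 0" using Q Qc by blast
    then show "y = c" by (rule hpoint_eqD)
  qed
  then show thesis using that[OF a0 _ Qc] dn cn by simp
qed

definition loc_poly :: "complex poly poly \<Rightarrow> complex \<Rightarrow> complex poly poly" where
  "loc_poly p c = homog_eval (\<lambda>z. [:[:z:]:]) p 1 [:[:c:], 1:] [:[:0, 1:]:]"

interpretation sw: comm_ring_hom sw
  by unfold_locales (simp_all add: sw_add sw_mult sw_0 sw_1)

interpretation fops: comm_ring_hom "fps_of_poly :: 'a::comm_ring_1 poly \<Rightarrow> _"
  by unfold_locales (simp_all add: fps_of_poly_add fps_of_poly_mult)

interpretation pfops: map_poly_comm_ring_hom "fps_of_poly :: 'a::comm_ring_1 poly \<Rightarrow> _" ..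

lemma sw_local_equation:
  "sw (local_equation p (1, c, 0)) = fps_of_poly (map_poly fps_of_poly (loc_poly p c))"
proof -
  have k: "sw (cs_const z) = fps_const (fps_const z)" for z
    unfolding sw_def cs_const.rep_eq by (intro fps_ext) simp
  have U: "sw cs_U = fps_X" unfolding sw_def cs_U.rep_eq by (intro fps_ext) (simp add: fps_X_def)
  have V: "sw cs_V = fps_const fps_X" unfolding sw_def cs_V.rep_eq by (intro fps_ext) (simp add: fps_X_def)
  have m: "map_poly fps_of_poly [:q:] = [:fps_of_poly q:]" for q :: "complex poly"
    by (rule poly_eqI) (simp add: coeff_map_poly coeff_pCons split: nat.splits)
  have "sw (local_equation p (1, c, 0)) =
     homog_eval (\<lambda>z. fps_const (fps_const z)) p 1 (fps_const (fps_const c) + fps_X) (fps_const fps_X)"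
    unfolding local_equation_def by (simp add: sw.homog_eval_hom sw.hom_add k U V)
  also have "\<dots> = fps_of_poly (map_poly fps_of_poly (loc_poly p c))"
    unfolding loc_poly_def pfops.homog_eval_hom fops.homog_eval_hom
    by (simp add: map_poly_pCons m fps_of_poly_const fps_of_poly_pCons)
  finally show ?thesis .
qed

lemma analytically_irreducible_hpoint:
  "analytically_irreducible_at p (hpoint 1 c 0) \<longleftrightarrow> irreducible (local_equation p (1, c, 0))"
proof -
  have "local_equation p v = local_equation p (1, c, 0)" if "v \<in> hpoint 1 c 0" for v
  proof -
    obtain k where "k \<noteq> 0" "v = (k, k * c, 0)" using \<open>v \<in> hpoint 1 c 0\<close> by (auto simp: hpoint_def)
    then show ?thesis using local_equation_scale[of k p 1 c 0] by simp
  qed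
  then show ?thesis unfolding analytically_irreducible_at_def using hpoint_mem by metis
qed

lemma map_poly_const_term_loc_poly:
  assumes "top_form p = smult a ([:- c, 1:] ^ n)"
  shows "map_poly (\<lambda>q. poly q 0) (loc_poly p c) = monom a n"
proof -
  interpret h: comm_ring_hom "\<lambda>q :: complex poly. poly q 0" by unfold_locales auto
  interpret ph: map_poly_comm_ring_hom "\<lambda>q :: complex poly. poly q 0" ..
  have pc: "comm_ring_hom (\<lambda>f :: complex poly. pcompose f [:c, 1:])"
    by unfold_locales (simp_all add: pcompose_add pcompose_mult pcompose_1)
  have pw: "pcompose (q ^ n) [:c, 1:] = pcompose q [:c, 1:] ^ n" for q
    by (induction n) (simp_all add: pcompose_mult pcompose_1)
  have m: "map_poly (\<lambda>q. poly q 0) [:q:] = [:poly q 0:]" for q :: "complex poly"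
    by (rule poly_eqI) (simp add: coeff_map_poly coeff_pCons split: nat.splits)
  have "map_poly (\<lambda>q. poly q 0) (loc_poly p c) = homog_eval (\<lambda>z. [:z:]) p 1 [:c, 1:] 0"
    unfolding loc_poly_def ph.homog_eval_hom by (simp add: map_poly_pCons m)
  also have "\<dots> = pcompose (top_form p) [:c, 1:]"
    unfolding top_form_def comm_ring_hom.homog_eval_hom[OF pc] by (simp add: pcompose_pCons)
  also have "\<dots> = smult a ((pcompose [:- c, 1:] [:c, 1:]) ^ n)"
    by (simp only: assms pcompose_smult pw)
  also have "pcompose [:- c, 1:] [:c, 1:] = [:0, 1:]" by (simp add: pcompose_pCons)
  finally show ?thesis by (simp add: monom_altdef)
qed

lemma degree_loc_poly: "degree (loc_poly p c) \<le> total_degree p"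
  and coeff_loc_poly: "coeff (loc_poly p c) (total_degree p) = [:coeff (coeff p (total_degree p)) 0:]"
proof -
  let ?n = "total_degree p"
  let ?t = "\<lambda>i j. [:[:coeff (coeff p j) i:]:] * 1 ^ i * [:[:c:], 1:] ^ j * [:[:0, 1:]:] ^ (?n - (i + j))"
  have t: "?t i j = smult ([:coeff (coeff p j) i:] * [:0, 1:] ^ (?n - (i + j))) ([:[:c:], 1:] ^ j)" for i j
    by (simp add: poly_const_pow ac_simps)
  have dt: "degree (?t i j) \<le> j" for i j
    unfolding t by (rule order_trans[OF degree_smult_le]) (simp only: degree_linear_power order_refl)
  have F: "loc_poly p c = (\<Sum>(i, j)\<in>supp2 p. ?t i j)" by (simp add: loc_poly_def homog_eval_def)
  show "degree (loc_poly p c) \<le> ?n"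
    unfolding F
  proof (rule degree_sum_le)
    fix x assume "x \<in> supp2 p"
    then show "degree (case x of (i, j) \<Rightarrow> ?t i j) \<le> ?n"
      using dt[of "snd x" "fst x"] supp2_total_degree[of "fst x" "snd x" p] by (cases x) auto
  qed simp
  have "coeff (loc_poly p c) ?n = (\<Sum>x\<in>supp2 p. if x = (0, ?n) then [:coeff (coeff p ?n) 0:] else 0)"
    unfolding F coeff_sum
  proof (rule sum.cong)
    fix x assume x: "x \<in> supp2 p"
    obtain i j where ij: "x = (i, j)" by (cases x)
    have le: "i + j \<le> ?n" using x ij supp2_total_degree by blast
    show "coeff (case x of (i, j) \<Rightarrow> ?t i j) ?n = (if x = (0, ?n) then [:coeff (coeff p ?n) 0:] else 0)"
    proof (cases "j = ?n")
      case True
      then have "i = 0" using le by simp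
      then show ?thesis unfolding ij prod.case t using True by (simp add: coeff_linear_power)
    next
      case False
      then have "degree (?t i j) < ?n" using dt[of j i] le by linarith
      then have "coeff (?t i j) ?n = 0" by (rule coeff_eq_0)
      then show ?thesis using False by (simp add: ij)
    qed
  qed simp
  also have "\<dots> = [:coeff (coeff p ?n) 0:]" unfolding sum_supp2_single by simp
  finally show "coeff (loc_poly p c) ?n = [:coeff (coeff p ?n) 0:]" .
qed

lemma roots_poly_factor:
  fixes A B :: "'a::idom poly"
  assumes "A * B = roots_poly R" "lead_coeff A = 1" "lead_coeff B = 1"
  obtains S where "A = roots_poly S"
  using assms
proof (induction R arbitrary: A B thesis)
  case empty
  have "A \<noteq> 0" "B \<noteq> 0" using empty.prems by auto
  then have "degree A + degree B = 0" using empty.prems(2) by (metis degree_1 degree_mult_eq roots_poly_empty)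
  then have "A = 1" using empty.prems(3) by (metis add_is_0 degree_0_id one_pCons)
  then show ?case using empty.prems(1)[of "{#}"] by simp
next
  case (add r R)
  have "poly (A * B) r = 0" by (simp add: add.prems(2) poly_roots_poly)
  then consider "poly A r = 0" | "poly B r = 0" by auto
  then show ?case
  proof cases
    case 1
    then obtain A' where A': "A = [:- r, 1:] * A'" by (auto simp: poly_eq_0_iff_dvd)
    have "[:- r, 1:] * (A' * B) = [:- r, 1:] * roots_poly R"
      using add.prems(2) by (simp only: A' roots_poly_add mult.assoc)
    then have "A' * B = roots_poly R" by (metis mult_left_cancel one_neq_zero pCons_eq_0_iff)
    moreover have "lead_coeff A' = 1" using add.prems(3) unfolding A' by (subst (asm) lead_coeff_mult) simp
    ultimately obtain S where "A' = roots_poly S" using add.IH add.prems(4) by blast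
    then have "A = roots_poly (add_mset r S)" by (simp only: A' roots_poly_add)
    then show ?thesis by (rule add.prems(1))
  next
    case 2
    then obtain B' where B': "B = [:- r, 1:] * B'" by (auto simp: poly_eq_0_iff_dvd)
    have "[:- r, 1:] * (A * B') = [:- r, 1:] * roots_poly R"
      using add.prems(2) by (simp only: B' roots_poly_add mult.left_commute)
    then have "A * B' = roots_poly R" by (metis mult_left_cancel one_neq_zero pCons_eq_0_iff)
    moreover have "lead_coeff B' = 1" using add.prems(4) unfolding B' by (subst (asm) lead_coeff_mult) simp
    ultimately show ?thesis using add.IH add.prems(1,3) by blast
  qed
qed

lemma puiseux_with_derivative:
  fixes F :: "complex fps poly"
  assumes lc: "coeff F n = fps_const a" and a: "a \<noteq> 0" and deg: "degree F = n" and n: "n \<ge> 1"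
  obtains N R G where "N > 0" "psub N F = smult (fps_const a) (roots_poly R)"
    "pderiv (roots_poly R) = smult (of_nat n) (roots_poly G)" "size R = n"
proof -
  define F1 where "F1 = smult (fps_const (1 / a)) F"
  define F2 where "F2 = smult (fps_const (1 / of_nat n)) (pderiv F1)"
  have d1: "degree F1 = n" using a deg by (simp add: F1_def)
  have l1: "lead_coeff F1 = 1" unfolding d1 using lc a by (simp add: F1_def)
  have d2: "degree F2 = n - 1" using n by (simp add: F2_def degree_pderiv d1)
  have l2: "lead_coeff F2 = 1"
  proof -
    have "coeff F2 (n - 1) = fps_const (1 / of_nat n) * (of_nat n * coeff F1 n)"
      using n by (simp add: F2_def coeff_pderiv)
    then show ?thesis unfolding d2 using l1 d1 n by (simp flip: fps_of_nat)
  qed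
  have "lead_coeff (F1 * F2) = 1" by (simp only: lead_coeff_mult l1 l2 mult_1)
  then obtain N T where N: "N > 0" "psub N (F1 * F2) = roots_poly T"
    using puiseux unfolding puiseux_split_def by blast
  have prod: "psub N F1 * psub N F2 = roots_poly T" using N by (simp add: psub.hom_mult)
  have m: "lead_coeff (psub N f) = 1 \<and> degree (psub N f) = degree f" if "lead_coeff f = 1" for f
  proof -
    have "degree (psub N f) = degree f"
      by (rule degree_map_poly) (use that in auto)
    then show ?thesis using that by (simp add: coeff_map_poly)
  qed
  obtain R where R: "psub N F1 = roots_poly R"
    using roots_poly_factor[OF prod] m[OF l1] m[OF l2] by metis
  obtain G where G: "psub N F2 = roots_poly G"
    using roots_poly_factor[of "psub N F2" "psub N F1" T] prod m[OF l1] m[OF l2] by (metis mult.commute)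
  have c: "fsub N (fps_const z) = fps_const z" for z using N(1) by (intro fps_ext) (auto simp: fsub_nth)
  have "F = smult (fps_const a) F1" using a by (simp add: F1_def)
  then have 1: "psub N F = smult (fps_const a) (roots_poly R)"
    by (simp add: fsub.map_poly_hom_smult c R)
  have "pderiv F1 = smult (of_nat n) F2" using n by (simp add: F2_def flip: fps_of_nat)
  then have "psub N (pderiv F1) = smult (fsub N (of_nat n)) (roots_poly G)"
    by (simp add: fsub.map_poly_hom_smult G)
  moreover have "fsub N (of_nat n) = of_nat n" using c[of "of_nat n"] by (simp add: fps_of_nat)
  moreover have "psub N (pderiv F1) = pderiv (psub N F1)"
    by (rule poly_eqI) (simp add: coeff_map_poly coeff_pderiv hom_distribs)
  ultimately have 2: "pderiv (roots_poly R) = smult (of_nat n) (roots_poly G)" using R by metis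
  have "size R = n" using R m[OF l1] d1 by (metis degree_roots_poly)
  with that[OF N(1) 1 2] show thesis .
qed

declare pCons_one [simp]

section \<open>The resultant as a product over roots\<close>

definition eq_sgn :: "'a::comm_ring_1 \<Rightarrow> 'a \<Rightarrow> bool" (infix "\<doteq>" 50) where
  "a \<doteq> b \<longleftrightarrow> a = b \<or> a = - b"

lemma eq_sgn_refl [simp]: "a \<doteq> a" and eq_sgn_sym: "a \<doteq> b \<Longrightarrow> b \<doteq> a"
  and eq_sgn_trans: "a \<doteq> b \<Longrightarrow> b \<doteq> c \<Longrightarrow> a \<doteq> c"
  and eq_sgn_mult: "a \<doteq> b \<Longrightarrow> c \<doteq> d \<Longrightarrow> a * c \<doteq> b * d"
  and eq_sgn_power_minus: "(- 1) ^ k * a \<doteq> a"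
  by (auto simp: eq_sgn_def minus_one_power_iff)

lemma resultant_swap_sgn: "resultant f g \<doteq> resultant g (f :: 'a::idom poly)"
  using resultant_swap[of f g] eq_sgn_power_minus by metis

lemma resultant_swap_left: "resultant f g \<doteq> a \<Longrightarrow> resultant g (f :: 'a::idom poly) \<doteq> a"
  and resultant_swap_right: "a \<doteq> c * resultant f g \<Longrightarrow> a \<doteq> c * resultant g f"
  using resultant_swap_sgn eq_sgn_trans eq_sgn_mult[OF eq_sgn_refl resultant_swap_sgn] by blast+

lemma resultant_euclid:
  fixes F G H :: "'a::idom poly"
  assumes FGH: "F + B * G = H" and deg: "degree F \<ge> degree G" "degree G > degree H"
  shows "resultant F G \<doteq> lead_coeff G ^ (degree F - degree H) * resultant G H"
proof -
  have *: "degree F \<ge> degree G" "degree G > degree H \<or> H = 0 \<and> F \<noteq> 0 \<and> G \<noteq> 0" using deg by auto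
  show ?thesis
  proof (cases "degree H = 0")
    case False
    have "subresultant 0 F G = smult ((-1) ^ ((degree F - 0) * (degree G - 0)) * lead_coeff G ^ (degree F - degree H)) (subresultant 0 G H)"
      using False by (intro BT_lemma_1_12[OF FGH *]) auto
    then have "resultant F G = (-1) ^ (degree F * degree G) * (lead_coeff G ^ (degree F - degree H) * resultant G H)"
      by (simp add: subresultant_resultant mult.assoc)
    then show ?thesis by (metis eq_sgn_power_minus)
  next
    case True
    then obtain c where H: "H = [:c:]" by (rule degree_eq_zeroE)
    show ?thesis
    proof (cases "c = 0")
      case False
      have "subresultant 0 F G = smult ((-1) ^ ((degree F - degree H) * (degree G - degree H)) * lead_coeff G ^ (degree F - degree H) * lead_coeff H ^ (degree G - degree H - 1)) H"
        using BT_lemma_1_13[OF FGH *] True deg by auto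
      then have "resultant F G = (-1) ^ (degree F * degree G) * (lead_coeff G ^ degree F * (c ^ (degree G - 1) * c))"
        by (simp add: subresultant_resultant H mult.assoc)
      also have "c ^ (degree G - 1) * c = c ^ degree G" using deg by (metis gr_implies_not0 gr0I power_minus_mult)
      finally show ?thesis using eq_sgn_power_minus by (metis H True degree_pCons_0 diff_zero resultant_const(2))
    next
      case c: True
      then have "F = (- B) * G" using FGH H by (simp add: add_eq_0_iff2)
      then have "subresultant 0 F G = 0" using subresultant_product[of F "- B" G 0] deg by simp
      then have "resultant F G = 0" by (simp add: subresultant_resultant)
      moreover have "resultant G H = 0" using deg c H by simp
      ultimately show ?thesis by simp
    qed
  qed
qed

lemma resultant_mod:
  fixes f G :: "'a::field poly"
  assumes f: "degree f > 0"
  shows "resultant f G \<doteq> lead_coeff f ^ (degree G - degree (G mod f)) * resultant f (G mod f)"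
proof (cases "degree G < degree f")
  case True
  then show ?thesis by (simp add: mod_poly_less)
next
  case False
  have f0: "f \<noteq> 0" using f by auto
  have "degree (G mod f) < degree f" using f f0 degree_mod_less'[of f G] by (cases "G mod f = 0") auto
  moreover have "G + (- (G div f)) * f = G mod f" by (simp add: minus_div_mult_eq_mod[symmetric])
  ultimately have "resultant G f \<doteq> lead_coeff f ^ (degree G - degree (G mod f)) * resultant f (G mod f)"
    using False by (intro resultant_euclid[where B = "- (G div f)"]) auto
  then show ?thesis by (rule resultant_swap_left)
qed

lemma resultant_mod_cong:
  fixes f G1 G2 :: "'a::field poly"
  assumes f: "degree f > 0" and "G1 mod f = G2 mod f" "degree G1 \<ge> degree G2"
  shows "resultant f G1 \<doteq> lead_coeff f ^ (degree G1 - degree G2) * resultant f G2"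
proof -
  let ?r = "G2 mod f"
  have r: "degree ?r \<le> degree G2"
  proof (cases "degree G2 < degree f")
    case False
    have "f \<noteq> 0" using f by auto
    then have "degree ?r < degree f" using f degree_mod_less'[of f G2] by (cases "?r = 0") auto
    then show ?thesis using False by simp
  qed (simp add: mod_poly_less)
  have "degree G1 - degree ?r = (degree G1 - degree G2) + (degree G2 - degree ?r)" using r assms(3) by simp
  then have "resultant f G1 \<doteq> lead_coeff f ^ (degree G1 - degree G2) * (lead_coeff f ^ (degree G2 - degree ?r) * resultant f ?r)"
    using resultant_mod[OF f, of G1] assms(2) by (simp add: power_add mult.assoc)
  also have "\<dots> \<doteq> lead_coeff f ^ (degree G1 - degree G2) * resultant f G2"
    by (rule eq_sgn_mult[OF eq_sgn_refl eq_sgn_sym[OF resultant_mod[OF f]]])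
  finally (eq_sgn_trans) show ?thesis .
qed

lemma resultant_linear_factor:
  fixes f g :: "'a::field poly"
  assumes "g \<noteq> 0"
  shows "resultant f ([:- x, 1:] * g) \<doteq> poly f x * resultant f g"
  using assms
proof (induction "degree f" arbitrary: f g rule: less_induct)
  case less
  let ?X = "[:- x, 1:]"
  have Xg: "degree (?X * g) = Suc (degree g)" if "g \<noteq> 0" for g :: "'a poly"
    using that by (subst degree_mult_eq) (auto simp del: mult_pCons_left)
  show ?case
  proof (cases "degree f = 0")
    case True
    then obtain a where "f = [:a:]" by (rule degree_eq_zeroE)
    then show ?thesis using Xg[OF less.prems] by (simp del: mult_pCons_left)
  next
    case False
    then have f: "degree f > 0" by simp
    have main: "resultant f (?X * g) \<doteq> poly f x * resultant f g" if g: "g \<noteq> 0" "degree g < degree f" for g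
    proof -
      let ?r = "f mod (?X * g)"
      have dX: "degree (?X * g) > 0" using Xg[OF g(1)] by simp
      have lX: "lead_coeff (?X * g) = lead_coeff g" by (subst lead_coeff_mult) simp
      have r1: "resultant f (?X * g) \<doteq> lead_coeff g ^ (degree f - degree ?r) * resultant ?r (?X * g)"
        using resultant_swap_right[OF resultant_swap_left[OF resultant_mod[OF dX, of f]]] unfolding lX .
      have fr: "poly f x = poly ?r x"
      proof -
        have "f = (?X * g) * (f div (?X * g)) + ?r" by simp
        then have "poly f x = poly ((?X * g) * (f div (?X * g)) + ?r) x" by (rule arg_cong)
        also have "\<dots> = poly ?X x * poly g x * poly (f div (?X * g)) x + poly ?r x"
          by (simp only: poly_add poly_mult)
        also have "poly ?X x = 0" by simp
        finally show ?thesis by simp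
      qed
      have dr: "degree ?r < degree f"
      proof -
        have "?X * g \<noteq> 0" using g by (simp del: mult_pCons_left)
        then have "degree ?r < degree (?X * g)" using dX degree_mod_less'[of "?X * g" f] by (cases "?r = 0") auto
        then show ?thesis using Xg[OF g(1)] g(2) by simp
      qed
      have r2: "resultant ?r (?X * g) \<doteq> poly f x * resultant ?r g"
        unfolding fr using dr g(1) by (intro less.hyps)
      have r3: "resultant f g \<doteq> lead_coeff g ^ (degree f - degree ?r) * resultant ?r g"
      proof (cases "degree g = 0")
        case True
        then obtain c where "g = [:c:]" by (rule degree_eq_zeroE)
        then show ?thesis using dr by (simp flip: power_add del: mult_pCons_left)
      next
        case False
        have "f mod g = ?r mod g" by (simp add: mod_mult2_eq' mod_mod_cancel del: mult_pCons_left)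
        then have "resultant g f \<doteq> lead_coeff g ^ (degree f - degree ?r) * resultant g ?r"
          using False dr by (intro resultant_mod_cong) auto
        then show ?thesis using resultant_swap_right resultant_swap_left by blast
      qed
      have "resultant f (?X * g) \<doteq> lead_coeff g ^ (degree f - degree ?r) * (poly f x * resultant ?r g)"
        by (rule eq_sgn_trans[OF r1 eq_sgn_mult[OF eq_sgn_refl r2]])
      also have "\<dots> = poly f x * (lead_coeff g ^ (degree f - degree ?r) * resultant ?r g)" by simp
      also have "\<dots> \<doteq> poly f x * resultant f g"
        by (rule eq_sgn_mult[OF eq_sgn_refl eq_sgn_sym[OF r3]])
      finally (eq_sgn_trans) show ?thesis .
    qed
    let ?s = "g mod f"
    have f0: "f \<noteq> 0" using f by auto
    have ds: "degree ?s < degree f" using f f0 degree_mod_less'[of f g] by (cases "?s = 0") auto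
    show ?thesis
    proof (cases "?s = 0")
      case True
      have "(?X * g) mod f = 0" using True by (metis mod_mult_right_eq mod_0 mult_zero_right)
      then have "resultant f (?X * g) = 0" "resultant f g = 0"
        using resultant_mod[OF f, of g] resultant_mod[OF f, of "?X * g"] True f
        by (auto simp: eq_sgn_def simp del: mult_pCons_left)
      then show ?thesis by simp
    next
      case s: False
      have dg: "degree ?s \<le> degree g" using ds by (cases "degree g < degree f") (auto simp: mod_poly_less)
      have m: "(?X * g) mod f = (?X * ?s) mod f" by (metis mod_mult_right_eq)
      have "resultant f (?X * g) \<doteq> lead_coeff f ^ (degree g - degree ?s) * resultant f (?X * ?s)"
        using resultant_mod_cong[OF f m] dg Xg[OF s] Xg[OF less.prems] by (simp del: mult_pCons_left)
      also have "\<dots> \<doteq> lead_coeff f ^ (degree g - degree ?s) * (poly f x * resultant f ?s)"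
        by (rule eq_sgn_mult[OF eq_sgn_refl main[OF s ds]])
      also (eq_sgn_trans) have "\<dots> = poly f x * (lead_coeff f ^ (degree g - degree ?s) * resultant f ?s)" by simp
      also have "\<dots> \<doteq> poly f x * resultant f g"
        by (rule eq_sgn_mult[OF eq_sgn_refl eq_sgn_sym[OF resultant_mod_cong[OF f _ dg]]]) simp
      finally (eq_sgn_trans) show ?thesis .
    qed
  qed
qed

lemma resultant_roots_poly_field:
  fixes f :: "'a::field poly"
  shows "resultant f (roots_poly R) \<doteq> (\<Prod>r\<in>#R. poly f r)"
proof (induction R)
  case (add r R)
  have "resultant f (roots_poly (add_mset r R)) \<doteq> poly f r * resultant f (roots_poly R)"
    unfolding roots_poly_add by (rule resultant_linear_factor) simp
  also have "\<dots> \<doteq> poly f r * (\<Prod>r\<in>#R. poly f r)" by (rule eq_sgn_mult[OF eq_sgn_refl add])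
  finally (eq_sgn_trans) show ?case by simp
qed simp

section \<open>The discriminant at infinity\<close>

interpretation flc: comm_ring_hom "fls_const :: complex \<Rightarrow> complex fls"
  by unfold_locales (auto intro!: fls_eqI simp: fls_const_mult_const)

interpretation fps_fls: inj_comm_ring_hom "fps_to_fls :: complex fps \<Rightarrow> complex fls"
  by unfold_locales (auto simp: fls_times_fps_to_fls)

interpretation pfps_fls: map_poly_comm_ring_hom "fps_to_fls :: complex fps \<Rightarrow> complex fls" ..


definition xp :: "int \<Rightarrow> complex fls" where "xp i = fls_X_intpow i"

lemma xp_mult: "xp i * xp j = xp (i + j)"
  by (simp only: xp_def fls_X_intpow_times_fls_X_intpow)

lemma xp_0 [simp]: "xp 0 = 1" by (simp add: xp_def)

lemma xp_neq_0 [simp]: "xp i \<noteq> 0" unfolding xp_def by (rule fls_X_intpow_nonzero)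

lemma xp_power: "xp i ^ n = xp (int n * i)"
  by (simp only: xp_def fls_X_intpow_power)

lemma xp_times_nth: "fls_nth (xp i * f) k = fls_nth f (k - i)"
  by (simp add: xp_def fls_X_intpow_times_conv_shift)

lemma xp_nth: "fls_nth (xp i) k = (if k = i then 1 else 0)"
  using xp_times_nth[of i 1 k] by simp

definition evN :: "nat \<Rightarrow> complex poly \<Rightarrow> complex fls" where
  "evN N q = poly (map_poly fls_const q) (xp (- int N))"

interpretation pflc: map_poly_comm_ring_hom "fls_const :: complex \<Rightarrow> complex fls" ..

interpretation evN: comm_ring_hom "evN N" for N
  by unfold_locales (simp_all add: evN_def pflc.hom_add pflc.hom_mult)

interpretation pevN: map_poly_comm_ring_hom "evN N" for N ..

lemma evN_const [simp]: "evN N [:z:] = fls_const z"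
proof -
  have "map_poly fls_const [:z:] = [:fls_const z:]"
    by (rule poly_eqI) (simp add: coeff_map_poly coeff_pCons split: nat.splits)
  then show ?thesis by (simp add: evN_def)
qed

lemma evN_X [simp]: "evN N [:0, 1:] = xp (- int N)"
  by (simp add: evN_def map_poly_pCons)

lemma evN_nth: "fls_nth (evN N q) l = (\<Sum>i\<le>degree q. if l = - (int N * int i) then coeff q i else 0)"
proof -
  have dm: "degree (map_poly fls_const q) = degree q" by (rule degree_map_poly) simp
  have "evN N q = (\<Sum>i\<le>degree q. xp (int i * - int N) * fls_const (coeff q i))"
    unfolding evN_def poly_altdef dm by (simp add: coeff_map_poly xp_power mult.commute)
  then have "fls_nth (evN N q) l = (\<Sum>i\<le>degree q. fls_nth (xp (int i * - int N) * fls_const (coeff q i)) l)"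
    by (simp add: fls_nth_sum)
  also have "\<dots> = (\<Sum>i\<le>degree q. if l = - (int N * int i) then coeff q i else 0)"
    by (intro sum.cong) (auto simp: xp_nth mult.commute)
  finally show ?thesis .
qed

lemma evN_nth_mult: "N > 0 \<Longrightarrow> fls_nth (evN N q) (- (int N * int i)) = coeff q i"
proof -
  assume N: "N > 0"
  have "fls_nth (evN N q) (- (int N * int i)) = (\<Sum>j\<le>degree q. if j = i then coeff q j else 0)"
    unfolding evN_nth using N by (intro sum.cong) auto
  then show ?thesis by (simp add: coeff_eq_0)
qed

lemma evN_nth_nonzero: "fls_nth (evN N q) l \<noteq> 0 \<Longrightarrow> \<exists>i. l = - (int N * int i)"
proof (rule ccontr)
  assume nz: "fls_nth (evN N q) l \<noteq> 0" and "\<nexists>i. l = - (int N * int i)"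
  then have "(\<Sum>i\<le>degree q. if l = - (int N * int i) then coeff q i else 0) = 0"
    by (intro sum.neutral) auto
  then show False using nz by (simp add: evN_nth)
qed

lemma evN_eq_0: "N > 0 \<Longrightarrow> evN N q = 0 \<Longrightarrow> q = 0"
  by (rule poly_eqI) (metis coeff_0 evN_nth_mult fls_zero_nth)

lemma resultant_roots_poly:
  fixes f :: "'a::idom poly"
  assumes "b \<noteq> 0"
  shows "resultant f (smult b (roots_poly R)) \<doteq> b ^ degree f * (\<Prod>r\<in>#R. poly f r)"
proof -
  have inj: "inj_comm_ring_hom (to_fract :: 'a \<Rightarrow> 'a fract)" by unfold_locales auto
  interpret tf: map_poly_inj_comm_ring_hom "to_fract :: 'a \<Rightarrow> 'a fract" by unfold_locales
  have rp: "map_poly to_fract (roots_poly R) = roots_poly (image_mset to_fract R)" for R :: "'a multiset"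
  proof (induction R)
    case (add r R)
    have "map_poly to_fract (roots_poly (add_mset r R)) = map_poly to_fract [:- r, 1:] * map_poly to_fract (roots_poly R)"
      by (simp only: roots_poly_add tf.hom_mult)
    also have "map_poly to_fract [:- r, 1:] = [:- to_fract r, 1:]" by (simp add: map_poly_pCons)
    finally show ?case by (simp only: add image_mset_add_mset roots_poly_add)
  qed simp
  have "to_fract (resultant f (roots_poly R)) = resultant (map_poly to_fract f) (map_poly to_fract (roots_poly R))"
    by (rule inj_comm_ring_hom.resultant_hom[OF inj, symmetric])
  also have "\<dots> = resultant (map_poly to_fract f) (roots_poly (image_mset to_fract R))" by (simp only: rp)
  also have "\<dots> \<doteq> (\<Prod>r\<in>#image_mset to_fract R. poly (map_poly to_fract f) r)"
    by (rule resultant_roots_poly_field)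
  also have "\<dots> = to_fract (\<Prod>r\<in>#R. poly f r)"
    by (induction R) (simp_all add: hom_distribs)
  finally have "resultant f (roots_poly R) \<doteq> (\<Prod>r\<in>#R. poly f r)"
    unfolding eq_sgn_def by (metis to_fract_eq_iff to_fract_uminus)
  then have "b ^ degree f * resultant f (roots_poly R) \<doteq> b ^ degree f * (\<Prod>r\<in>#R. poly f r)"
    by (rule eq_sgn_mult[OF eq_sgn_refl])
  then show ?thesis using resultant_smult_right[OF assms, of f "roots_poly R"] by simp
qed

lemma pcompose_roots_poly_linear:
  fixes W :: "'a::field"
  assumes "W \<noteq> 0"
  shows "pcompose (roots_poly R) [:- C, W:] = smult (W ^ size R) (roots_poly (image_mset (\<lambda>r. (r + C) / W) R))"
proof (induction R)
  case (add r R)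
  have "pcompose (roots_poly (add_mset r R)) [:- C, W:] = pcompose [:- r, 1:] [:- C, W:] * pcompose (roots_poly R) [:- C, W:]"
    by (simp only: roots_poly_add pcompose_mult)
  also have "pcompose [:- r, 1:] [:- C, W:] = smult W [:- ((r + C) / W), 1:]"
    using assms by (simp add: pcompose_pCons field_simps)
  also have "smult W [:- ((r + C) / W), 1:] * pcompose (roots_poly R) [:- C, W:] =
      smult (W ^ size (add_mset r R)) (roots_poly (image_mset (\<lambda>r. (r + C) / W) (add_mset r R)))"
    by (simp only: add mult_smult_left mult_smult_right smult_smult size_add_mset power_Suc
        image_mset_add_mset roots_poly_add) (simp only: mult.commute)
  finally show ?case .
qed (simp add: pcompose_1)

lemma squarefree_resultant:
  fixes p :: "complex poly poly"
  assumes sq: "squarefree p" and lc: "lead_coeff p dvd 1" and deg: "degree p > 0"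
  shows "resultant p (pderiv p) \<noteq> 0"
proof
  assume "resultant p (pderiv p) = 0"
  then have d: "degree (gcd p (pderiv p)) \<noteq> 0" by (simp add: resultant_0_gcd)
  then have "gcd p (pderiv p) \<noteq> 0" "\<not> is_unit (gcd p (pderiv p))"
    by (auto simp: is_unit_poly_iff)
  then obtain q where q: "prime q" "q dvd gcd p (pderiv p)"
    using prime_divisor_exists by blast
  obtain s where s: "p = q * s" using q by (meson dvd_def dvd_trans gcd_dvd1)
  have dq: "degree q > 0"
  proof (rule ccontr)
    assume "\<not> degree q > 0"
    then obtain b where b: "q = [:b:]" by (metis degree_eq_zeroE gr0I)
    have "b dvd lead_coeff p" unfolding s lead_coeff_mult by (simp add: b)
    then have "b dvd 1" using lc dvd_trans by blast
    then have "is_unit q" by (simp add: b is_unit_const_poly_iff)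
    then show False using q(1) by (auto simp: prime_def)
  qed
  have "q dvd pderiv p" using q(2) by (meson dvd_trans gcd_dvd2)
  then have "q dvd pderiv q * s" unfolding s pderiv_mult by (simp add: dvd_add_right_iff mult.commute)
  moreover have "\<not> q dvd pderiv q"
  proof
    assume "q dvd pderiv q"
    moreover have "pderiv q \<noteq> 0" using dq by (simp add: pderiv_eq_0_iff)
    ultimately have "degree q \<le> degree (pderiv q)" by (rule dvd_imp_degree_le)
    then show False using dq by (simp add: degree_pderiv)
  qed
  ultimately have "q dvd s" using q(1) by (simp add: prime_dvd_mult_iff)
  then have "q ^ 2 dvd p" unfolding s power2_eq_square by (rule mult_dvd_mono[OF dvd_refl])
  then have "is_unit q" using sq by (simp add: squarefree_def)
  then show False using q(1) by (auto simp: prime_def)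
qed

context
  fixes p :: "complex poly poly" and n N :: nat and a c :: complex and R G :: "complex fps multiset"
    and F :: "complex fps poly"
  assumes tdeg: "total_degree p = n" and n1: "n \<ge> 1" and lc0: "coeff (coeff p n) 0 = a" and a0: "a \<noteq> 0"
    and N0: "N > 0" and F: "F = map_poly fps_of_poly (loc_poly p c)"
    and split: "psub N F = smult (fps_const a) (roots_poly R)"
    and der: "pderiv (roots_poly R) = smult (of_nat n) (roots_poly G)" and sizeR: "size R = n"
begin

lemma coeff_p_n: "coeff p n = [:a:]"
proof (rule poly_eqI)
  fix i show "coeff (coeff p n) i = coeff [:a:] i"
    using lc0 coeff_total_degree[of p i n] tdeg by (cases i) auto
qed

lemma degree_p: "degree p = n"
proof (rule antisym)
  show "degree p \<le> n"
    using coeff_total_degree[of p _ _] tdeg by (intro degree_le allI impI poly_eqI) simp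
  show "n \<le> degree p" using coeff_p_n a0 by (intro le_degree) simp
qed

lemma size_G: "size G = n - 1"
proof -
  have "degree (pderiv (roots_poly R)) = n - 1" by (simp add: degree_pderiv sizeR)
  moreover have "complex_of_nat n \<noteq> 0" using n1 by simp
  ultimately show ?thesis using der by (simp flip: fps_of_nat)
qed

definition pl :: "complex fls poly" where "pl = map_poly (evN N) p"
definition Fl :: "complex fls poly" where "Fl = map_poly fps_to_fls (psub N F)"
abbreviation "W \<equiv> xp (int N)"
abbreviation "nd \<equiv> fps_to_fls"
abbreviation "th \<equiv> (\<lambda>r. (fps_to_fls r + fls_const c) / xp (int N))"

lemma map_roots_poly_fls:
  "map_poly fps_to_fls (roots_poly (R' :: complex fps multiset)) = roots_poly (image_mset fps_to_fls R')"
proof (induction R')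
  case (add r R')
  have "map_poly fps_to_fls (roots_poly (add_mset r R')) = map_poly fps_to_fls [:- r, 1:] * map_poly fps_to_fls (roots_poly R')"
    by (simp only: roots_poly_add pfps_fls.hom_mult)
  also have "map_poly fps_to_fls [:- r, 1:] = [:- fps_to_fls r, 1:]" by (simp add: map_poly_pCons)
  finally show ?case by (simp only: add image_mset_add_mset roots_poly_add)
qed simp

lemma Fl_pcompose: "pcompose Fl [:- fls_const c, W:] = smult (W ^ n) pl"
proof -
  define e where "e = (\<lambda>q :: complex poly. fps_to_fls (fsub N (fps_of_poly q)))"
  have ce: "comm_ring_hom e"
    unfolding e_def by unfold_locales (simp_all add: fops.hom_add fops.hom_mult fsub_add fsub_mult fls_times_fps_to_fls)
  interpret e: comm_ring_hom e by (rule ce)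
  interpret pe: map_poly_comm_ring_hom e ..
  have eX: "e [:0, 1:] = W"
  proof (rule fls_eqI)
    fix k
    have "fps_of_poly [:0, 1 :: complex:] = fps_X" by (simp add: fps_of_poly_pCons)
    moreover have "fsub N fps_X = fps_X ^ N" using N0 by (simp add: fsub_def)
    ultimately have "e [:0, 1:] = fps_to_fls (fps_X ^ N)" by (simp only: e_def)
    then show "fls_nth (e [:0, 1:]) k = fls_nth W k"
      by (auto simp: xp_nth nat_eq_iff)
  qed
  have ec: "e [:z:] = fls_const z" for z
    unfolding e_def fps_of_poly_const using N0 by (intro fls_eqI) (auto simp: fsub_nth)
  have mc: "map_poly e [:q:] = [:e q:]" for q
    by (rule poly_eqI) (simp add: coeff_map_poly coeff_pCons split: nat.splits)
  have Fl: "Fl = map_poly e (loc_poly p c)"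
    unfolding Fl_def by (rule poly_eqI) (simp add: F e_def coeff_map_poly)
  have pc: "comm_ring_hom (\<lambda>f :: complex fls poly. pcompose f [:- fls_const c, W:])"
    by unfold_locales (simp_all add: pcompose_add pcompose_mult pcompose_1)
  have mc': "map_poly (evN N) [:q:] = [:evN N q:]" for q
    by (rule poly_eqI) (simp add: coeff_map_poly coeff_pCons split: nat.splits)
  have "pcompose Fl [:- fls_const c, W:] = homog_eval (\<lambda>z. [:fls_const z:]) p 1 [:0, W:] [:W:]"
    unfolding Fl loc_poly_def pe.homog_eval_hom comm_ring_hom.homog_eval_hom[OF pc]
    by (simp add: mc ec eX eX[folded one_pCons] map_poly_pCons pcompose_pCons)
  also have "\<dots> = homog_eval (\<lambda>z. [:fls_const z:]) p ([:W:] * [:xp (- int N):]) ([:W:] * [:0, 1:]) ([:W:] * 1)"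
    by (simp add: xp_mult)
  also have "\<dots> = [:W:] ^ n * homog_eval (\<lambda>z. [:fls_const z:]) p [:xp (- int N):] [:0, 1:] 1"
    unfolding homog_eval_scale tdeg ..
  also have "homog_eval (\<lambda>z. [:fls_const z:]) p [:xp (- int N):] [:0, 1:] 1 = pl"
  proof -
    have "pl = map_poly (evN N) (homog_eval (\<lambda>z. [:[:z:]:]) p [:[:0, 1:]:] [:0, 1:] 1)"
      unfolding pl_def homog_eval_self ..
    also have "\<dots> = homog_eval (\<lambda>z. [:fls_const z:]) p [:xp (- int N):] [:0, 1:] 1"
      unfolding pevN.homog_eval_hom by (simp add: mc' map_poly_pCons evN_X[folded one_pCons])
    finally show ?thesis by simp
  qed
  finally show ?thesis by (simp add: poly_const_pow)
qed

lemma Fl_roots: "Fl = smult (fls_const a) (roots_poly (image_mset fps_to_fls R))"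
  by (simp add: Fl_def split fps_fls.map_poly_hom_smult map_roots_poly_fls)

lemma pderiv_pl: "pderiv pl = smult (of_nat n * fls_const a) (roots_poly (image_mset th G))"
proof -
  have dR: "pderiv (roots_poly (image_mset fps_to_fls R)) = smult (of_nat n) (roots_poly (image_mset fps_to_fls G))"
  proof -
    have "pderiv (map_poly fps_to_fls (roots_poly R)) = map_poly fps_to_fls (pderiv (roots_poly R))"
      by (rule poly_eqI) (simp add: coeff_map_poly coeff_pderiv fls_times_fps_to_fls fps_to_fls_of_nat flip: of_nat_Suc)
    then show ?thesis by (simp add: der map_roots_poly_fls fps_fls.map_poly_hom_smult fps_to_fls_of_nat)
  qed
  have "smult (W ^ n) (pderiv pl) = pderiv (pcompose Fl [:- fls_const c, W:])"
    by (simp add: Fl_pcompose pderiv_smult)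
  also have "\<dots> = pcompose (pderiv Fl) [:- fls_const c, W:] * [:W:]"
    by (simp add: pderiv_pcompose pderiv_pCons)
  also have "\<dots> = smult (W * W ^ size G) (smult (of_nat n * fls_const a) (roots_poly (image_mset th G)))"
    by (simp add: Fl_roots pderiv_smult dR pcompose_smult pcompose_roots_poly_linear multiset.map_comp o_def ac_simps)
  also have "W * W ^ size G = W ^ n" using n1 by (simp add: size_G flip: power_Suc)
  finally have "smult (W ^ n) (pderiv pl - smult (of_nat n * fls_const a) (roots_poly (image_mset th G))) = 0"
    by (simp only: smult_diff_right) simp
  then show ?thesis by (subst (asm) smult_eq_0_iff) simp
qed

lemma poly_pl_th: "poly pl (th r) = xp (- (int n * int N)) * fps_to_fls (poly (psub N F) r)"
proof -
  have "W ^ n * poly pl (th r) = poly (pcompose Fl [:- fls_const c, W:]) (th r)"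
    by (simp add: Fl_pcompose)
  also have "\<dots> = poly Fl (fps_to_fls r)" by (simp add: poly_pcompose)
  also have "\<dots> = fps_to_fls (poly (psub N F) r)" unfolding Fl_def by (simp add: fps_fls.poly_map_poly)
  finally have "xp (- (int n * int N)) * (W ^ n * poly pl (th r)) = xp (- (int n * int N)) * fps_to_fls (poly (psub N F) r)"
    by simp
  then show ?thesis by (simp add: xp_power xp_mult flip: mult.assoc)
qed

lemma of_nat_fls_neq_0: "of_nat n \<noteq> (0 :: complex fls)"
  using n1 by (simp add: fps_to_fls_of_nat[symmetric] flip: fps_of_nat)

lemma map_evN_resultant: "resultant pl (pderiv pl) = evN N (resultant p (pderiv p))"
proof -
  have e: "pderiv pl = map_poly (evN N) (pderiv p)"
    unfolding pl_def by (rule poly_eqI) (simp add: coeff_map_poly coeff_pderiv hom_distribs)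
  have "degree pl = degree p" unfolding pl_def by (rule degree_map_poly) (use degree_p coeff_p_n a0 in auto)
  then have "degree (pderiv pl) = degree (pderiv p)" using n1 of_nat_fls_neq_0 a0
    by (simp add: pderiv_pl degree_pderiv degree_p size_G)
  then show ?thesis using \<open>degree pl = degree p\<close>
    unfolding e unfolding pl_def by (intro evN.resultant_map_poly)
qed

lemma distinct_roots:
  assumes "squarefree p"
  shows "R = mset_set (set_mset R)"
proof -
  have "count R r \<le> 1" for r
  proof (rule ccontr)
    assume c2: "\<not> count R r \<le> 1"
    then have "r \<in># R - {#r#}" by (simp flip: count_greater_zero_iff)
    then obtain S where S: "R - {#r#} = add_mset r S" by (metis multi_member_split)
    moreover have "r \<in># R" using c2 by (simp flip: count_greater_zero_iff)
    ultimately have R: "R = add_mset r (add_mset r S)" by (metis insert_DiffM)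
    have "poly (pderiv (roots_poly R)) r = 0"
      by (simp only: R roots_poly_add pderiv_mult) simp
    then have "poly (roots_poly G) r = 0" using der n1 by (simp flip: fps_of_nat)
    then have rG: "r \<in># G" by (auto simp: poly_roots_poly prod_mset_zero_iff)
    have "poly (psub N F) r = 0" by (simp add: split poly_roots_poly R)
    then have "poly pl (th r) = 0" by (simp add: poly_pl_th)
    then have z: "(\<Prod>r\<in>#image_mset th G. poly pl r) = 0" using rG by (auto simp: prod_mset_zero_iff)
    have "resultant pl (pderiv pl) \<doteq> (of_nat n * fls_const a) ^ degree pl * (\<Prod>r\<in>#image_mset th G. poly pl r)"
      unfolding pderiv_pl using of_nat_fls_neq_0 a0 by (intro resultant_roots_poly) simp
    then have "evN N (resultant p (pderiv p)) = 0"
      unfolding z map_evN_resultant by (simp add: eq_sgn_def)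
    then have "resultant p (pderiv p) = 0" by (rule evN_eq_0[OF N0])
    moreover have "lead_coeff p dvd 1" using a0 by (simp add: degree_p coeff_p_n is_unit_const_poly_iff)
    ultimately show False using squarefree_resultant[OF assms] n1 degree_p by auto
  qed
  then show ?thesis
    by (intro multiset_eqI) (metis count_eq_zero_iff count_mset_set(1) count_mset_set(3) finite_set_mset le_antisym less_one not_le)
qed

definition crit :: "complex fps poly" where
  "crit = (\<Prod>g\<in>#G. [:poly (psub N F) g, - 1:])"

lemma D_infinity_eq:
  obtains \<kappa> where "\<kappa> \<noteq> 0" "\<And>k. evN N (coeff (D_infinity p) k) * xp (- (int n * int N * int k)) =
     fls_const \<kappa> * (xp (- (int n * int N * int (n - 1))) * fps_to_fls (coeff crit k))"
proof -
  let ?V = "xp (- (int n * int N))"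
  define P where "P = map_poly (\<lambda>c. [:c:]) p - [:[:0, 1:]:]"
  define Phi where "Phi = (\<lambda>g. pcompose (map_poly (evN N) g) [:0, ?V:])"
  have cPhi: "comm_ring_hom Phi"
    unfolding Phi_def by unfold_locales (simp_all add: pevN.hom_add pevN.hom_mult pcompose_add pcompose_mult pcompose_1)
  interpret Phi: comm_ring_hom Phi by (rule cPhi)
  have mc: "map_poly (evN N) [:q:] = [:evN N q:]" for q
    by (rule poly_eqI) (simp add: coeff_map_poly coeff_pCons split: nat.splits)
  have Phi_c: "Phi [:q:] = [:evN N q:]" for q by (simp add: Phi_def mc)
  have Phi_T: "Phi [:0, 1:] = [:0, ?V:]" by (simp add: Phi_def map_poly_pCons pcompose_pCons)
  note Phi_T' = Phi_T[folded one_pCons]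
  have coeff_Phi: "coeff (Phi g) k = ?V ^ k * evN N (coeff g k)" for g k
    by (simp add: Phi_def coeff_pcompose_linear coeff_map_poly)
  have coeff_P: "coeff P j = [:coeff p j:] - (if j = 0 then [:0, 1:] else 0)" for j
    by (simp add: P_def coeff_map_poly coeff_pCons split: nat.splits)
  have cPn: "coeff P n = [:[:a:]:]" using n1 by (simp add: coeff_P coeff_p_n)
  have dP: "degree P = n"
    using cPn a0 degree_p n1 by (intro antisym degree_le le_degree) (auto simp: coeff_P coeff_eq_0)
  define f where "f = map_poly Phi P"
  have f: "f = map_poly (\<lambda>x. [:x:]) pl - [:[:0, ?V:]:]"
    by (rule poly_eqI) (simp add: f_def coeff_map_poly coeff_P Phi.hom_minus Phi_c Phi_T Phi_T' pl_def coeff_pCons split: nat.splits)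
  have cfn: "coeff f n = [:fls_const a:]" by (simp add: f_def coeff_map_poly cPn Phi_c)
  have df: "degree f = n"
    using cfn a0 dP by (intro antisym degree_le le_degree) (auto simp: f_def coeff_map_poly coeff_eq_0)
  define B where "B = of_nat n * fls_const a"
  have B0: "B \<noteq> 0" using of_nat_fls_neq_0 a0 by (simp add: B_def)
  have mr: "map_poly (\<lambda>x. [:x:]) (roots_poly S) = roots_poly (image_mset (\<lambda>x. [:x:]) S)" for S :: "complex fls multiset"
  proof (induction S)
    case (add x S)
    have "map_poly (\<lambda>x. [:x:]) ([:- x, 1:] * q) = map_poly (\<lambda>x. [:x:]) [:- x, 1:] * map_poly (\<lambda>x. [:x:]) q" for q :: "complex fls poly"
    proof -
      have k: "comm_ring_hom (\<lambda>x :: complex fls. [:x:])" by unfold_locales auto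
      interpret pk: map_poly_comm_ring_hom "\<lambda>x :: complex fls. [:x:]"
        by (rule map_poly_comm_ring_hom.intro[OF k])
      show ?thesis by (rule pk.hom_mult)
    qed
    moreover have "map_poly (\<lambda>x. [:x:]) [:- x, 1:] = [:- [:x:], 1:]"
      by (simp add: map_poly_pCons)
    ultimately show ?case using add by (simp only: roots_poly_add image_mset_add_mset)
  qed simp
  have pf: "pderiv f = smult [:B:] (roots_poly (image_mset (\<lambda>x. [:x:]) (image_mset th G)))"
  proof -
    have "pderiv f = map_poly (\<lambda>x. [:x:]) (pderiv pl)"
      by (rule poly_eqI) (simp add: f coeff_pderiv coeff_map_poly coeff_pCons of_nat_poly)
    also have "\<dots> = smult [:B:] (map_poly (\<lambda>x. [:x:]) (roots_poly (image_mset th G)))"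
      unfolding pderiv_pl B_def[symmetric] by (rule poly_eqI) (simp add: coeff_map_poly)
    finally show ?thesis by (simp only: mr)
  qed
  have "resultant f (pderiv f) \<doteq> [:B:] ^ n * (\<Prod>r\<in>#image_mset (\<lambda>x. [:x:]) (image_mset th G). poly f r)"
    unfolding pf df[symmetric] using B0 by (intro resultant_roots_poly) simp
  also have "(\<Prod>r\<in>#image_mset (\<lambda>x. [:x:]) (image_mset th G). poly f r) = (\<Prod>g\<in>#G. smult ?V [:fps_to_fls (poly (psub N F) g), - 1:])"
  proof -
    have "poly f [:th g:] = smult ?V [:fps_to_fls (poly (psub N F) g), - 1:]" for g
    proof -
      have "poly (map_poly (\<lambda>x. [:x:]) q) [:y:] = [:poly q y:]" for q :: "complex fls poly" and y
        by (induction q) (simp_all add: map_poly_pCons)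
      then have "poly f [:th g:] = [:poly pl (th g):] - [:0, ?V:]" by (simp add: f)
      then show ?thesis by (simp add: poly_pl_th)
    qed
    then show ?thesis by (simp add: multiset.map_comp o_def)
  qed
  also have "\<dots> = smult (?V ^ (n - 1)) (map_poly fps_to_fls crit)"
  proof -
    have "(\<Prod>g\<in>#S. smult ?V [:fps_to_fls (poly (psub N F) g), - 1:]) =
        smult (?V ^ size S) (map_poly fps_to_fls (\<Prod>g\<in>#S. [:poly (psub N F) g, - 1:]))" for S
    proof (induction S)
      case (add g S)
      have "map_poly fps_to_fls ([:poly (psub N F) g, - 1:] * q) = [:fps_to_fls (poly (psub N F) g), - 1:] * map_poly fps_to_fls q" for q
        by (simp only: pfps_fls.hom_mult) (simp add: map_poly_pCons)
      then show ?case
        by (simp only: add prod_mset.add_mset image_mset_add_mset size_add_mset power_Suc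
            mult_smult_left mult_smult_right smult_smult) (simp only: mult.commute)
    qed simp
    then show ?thesis by (simp add: crit_def size_G)
  qed
  finally have res: "resultant f (pderiv f) \<doteq> [:B:] ^ n * smult (?V ^ (n - 1)) (map_poly fps_to_fls crit)" .
  have "Phi (resultant P (pderiv P)) = resultant f (pderiv f)"
  proof -
    have e: "pderiv f = map_poly Phi (pderiv P)"
      unfolding f_def by (rule poly_eqI) (simp add: coeff_map_poly coeff_pderiv Phi.hom_mult Phi.hom_of_nat flip: of_nat_Suc)
    have "degree (pderiv P) = n - 1" by (simp add: degree_pderiv dP)
    moreover have "degree (pderiv f) = n - 1" using B0 unfolding pf by (simp add: size_G)
    ultimately show ?thesis
      unfolding e unfolding f_def using df dP by (intro Phi.resultant_map_poly[symmetric]) (simp_all add: f_def e)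
  qed
  moreover have "lead_coeff P * D_infinity p \<doteq> resultant P (pderiv P)"
  proof -
    have dv: "lead_coeff P dvd resultant P (pderiv P)"
      using dP n1 by (intro lead_coeff_dvd_resultant_pderiv) simp
    have "D_infinity p = (- 1) ^ (degree P * (degree P - 1) div 2) * (resultant P (pderiv P) div lead_coeff P)"
      by (simp add: D_infinity_def discriminant_def P_def)
    then have "lead_coeff P * D_infinity p = (- 1) ^ (degree P * (degree P - 1) div 2) * (lead_coeff P * (resultant P (pderiv P) div lead_coeff P))"
      by simp
    also have "lead_coeff P * (resultant P (pderiv P) div lead_coeff P) = resultant P (pderiv P)"
      using dv by (rule dvd_mult_div_cancel)
    finally show ?thesis using eq_sgn_power_minus by metis
  qed
  ultimately have "Phi (lead_coeff P * D_infinity p) \<doteq> resultant f (pderiv f)"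
    unfolding eq_sgn_def by (auto simp: Phi.hom_uminus)
  then have "Phi (lead_coeff P * D_infinity p) \<doteq> [:B:] ^ n * smult (?V ^ (n - 1)) (map_poly fps_to_fls crit)"
    using res by (rule eq_sgn_trans)
  moreover have "Phi (lead_coeff P * D_infinity p) = smult (fls_const a) (Phi (D_infinity p))"
    by (simp only: Phi.hom_mult dP cPn Phi_c evN_const) simp
  ultimately have main: "smult (fls_const a) (Phi (D_infinity p)) \<doteq> smult (B ^ n * ?V ^ (n - 1)) (map_poly fps_to_fls crit)"
    by (simp add: poly_const_pow mult.commute)
  have Bc: "B = fls_const (of_nat n * a)"
    by (rule fls_eqI) (simp add: B_def fls_of_nat_nth flip: fls_of_nat)
  obtain s :: complex where s: "s = 1 \<or> s = - 1"
    "smult (fls_const a) (Phi (D_infinity p)) = smult (fls_const s * (B ^ n * ?V ^ (n - 1))) (map_poly fps_to_fls crit)"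
  proof (cases "smult (fls_const a) (Phi (D_infinity p)) = smult (B ^ n * ?V ^ (n - 1)) (map_poly fps_to_fls crit)")
    case True
    then show ?thesis using that[of 1] by simp
  next
    case False
    then have e: "smult (fls_const a) (Phi (D_infinity p)) = - smult (B ^ n * ?V ^ (n - 1)) (map_poly fps_to_fls crit)"
      using main by (simp add: eq_sgn_def)
    have "- smult x q = smult (fls_const (- 1) * x) q" for x :: "complex fls" and q by simp
    then show ?thesis using that[of "- 1"] e by simp
  qed
  define \<kappa> where "\<kappa> = s * (of_nat n * a) ^ n / a"
  show thesis
  proof (rule that)
    show "\<kappa> \<noteq> 0" using s(1) a0 n1 by (auto simp: \<kappa>_def)
    fix k
    have "fls_const a * (?V ^ k * evN N (coeff (D_infinity p) k)) = coeff (smult (fls_const a) (Phi (D_infinity p))) k"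
      by (simp add: coeff_Phi)
    also have "\<dots> = fls_const s * (B ^ n * ?V ^ (n - 1)) * fps_to_fls (coeff crit k)"
      unfolding s(2) by (simp add: coeff_map_poly)
    finally have e: "fls_const (1 / a) * (fls_const a * (?V ^ k * evN N (coeff (D_infinity p) k))) =
      fls_const (1 / a) * (fls_const s * (B ^ n * ?V ^ (n - 1)) * fps_to_fls (coeff crit k))" by simp
    have "fls_const (1 / a) * fls_const a = 1" using a0 by simp
    then have "?V ^ k * evN N (coeff (D_infinity p) k) =
      fls_const (1 / a) * (fls_const s * (B ^ n * ?V ^ (n - 1)) * fps_to_fls (coeff crit k))"
      using e by (simp only: mult.assoc[symmetric] mult_1)
    also have "\<dots> = fls_const \<kappa> * (?V ^ (n - 1) * fps_to_fls (coeff crit k))"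
      unfolding Bc fls_const_power[symmetric] \<kappa>_def by (simp add: mult.assoc[symmetric] fls_const_mult_const)
    finally show "evN N (coeff (D_infinity p) k) * xp (- (int n * int N * int k)) =
     fls_const \<kappa> * (xp (- (int n * int N * int (n - 1))) * fps_to_fls (coeff crit k))"
      by (simp add: xp_power ac_simps)
  qed
qed

text \<open>The monomial \<open>x^i t^k\<close> becomes \<open>X^(N (n (n - 1) - i - n k)) T^k\<close>.\<close>

lemma supp_D_infinity:
  "coeff (coeff (D_infinity p) k) i \<noteq> 0 \<Longrightarrow>
     \<exists>m. fps_nth (coeff crit k) m \<noteq> 0 \<and> int m = int N * (int n * (int n - 1) - int i - int n * int k)"
  "fps_nth (coeff crit k) m \<noteq> 0 \<Longrightarrow>
     \<exists>i. coeff (coeff (D_infinity p) k) i \<noteq> 0 \<and> int m = int N * (int n * (int n - 1) - int i - int n * int k)"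
proof -
  obtain \<kappa> where k: "\<kappa> \<noteq> 0" "\<And>k. evN N (coeff (D_infinity p) k) * xp (- (int n * int N * int k)) =
     fls_const \<kappa> * (xp (- (int n * int N * int (n - 1))) * fps_to_fls (coeff crit k))"
    using D_infinity_eq by blast
  have nth: "fls_nth (evN N (coeff (D_infinity p) k)) (l + int n * int N * int k) =
      \<kappa> * fls_nth (fps_to_fls (coeff crit k)) (l + int n * int N * int (n - 1))" for l k
  proof -
    have "fls_nth (evN N (coeff (D_infinity p) k)) (l + int n * int N * int k) =
        fls_nth (xp (- (int n * int N * int k)) * evN N (coeff (D_infinity p) k)) l"
      unfolding xp_times_nth by simp
    also have "\<dots> = fls_nth (xp (- (int n * int N * int (n - 1))) * (fls_const \<kappa> * fps_to_fls (coeff crit k))) l"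
      using k(2)[of k] by (simp only: ac_simps)
    also have "\<dots> = \<kappa> * fls_nth (fps_to_fls (coeff crit k)) (l + int n * int N * int (n - 1))"
      unfolding xp_times_nth by simp
    finally show ?thesis .
  qed
  have n1': "int (n - 1) = int n - 1" using n1 by simp
  note nth = nth[unfolded n1']
  { assume "coeff (coeff (D_infinity p) k) i \<noteq> 0"
    then have "fls_nth (evN N (coeff (D_infinity p) k)) (- (int N * int i)) \<noteq> 0"
      using N0 by (simp add: evN_nth_mult)
    then have nz: "fls_nth (fps_to_fls (coeff crit k)) (- (int N * int i) - int n * int N * int k + int n * int N * (int n - 1)) \<noteq> 0"
      using nth[of k "- (int N * int i) - int n * int N * int k"] by simp
    define l where "l = - (int N * int i) - int n * int N * int k + int n * int N * (int n - 1)"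
    have "l \<ge> 0" using nz unfolding l_def[symmetric] by (auto split: if_splits)
    then have "fps_nth (coeff crit k) (nat l) \<noteq> 0" "int (nat l) = int N * (int n * (int n - 1) - int i - int n * int k)"
      using nz \<open>l \<ge> 0\<close> unfolding l_def[symmetric] by (simp_all add: l_def algebra_simps)
    then show "\<exists>m. fps_nth (coeff crit k) m \<noteq> 0 \<and> int m = int N * (int n * (int n - 1) - int i - int n * int k)"
      by blast }
  { assume nz: "fps_nth (coeff crit k) m \<noteq> 0"
    define l where "l = int m - int n * int N * (int n - 1)"
    have "fls_nth (evN N (coeff (D_infinity p) k)) (l + int n * int N * int k) \<noteq> 0"
      using nth[of k l] nz k(1) by (simp add: l_def)
    moreover from this obtain i where i: "l + int n * int N * int k = - (int N * int i)"
      using evN_nth_nonzero by blast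
    ultimately have "coeff (coeff (D_infinity p) k) i \<noteq> 0" using N0 by (simp add: evN_nth_mult)
    moreover have "int m = int N * (int n * (int n - 1) - int i - int n * int k)"
      using i by (simp add: l_def algebra_simps)
    ultimately show "\<exists>i. coeff (coeff (D_infinity p) k) i \<noteq> 0 \<and> int m = int N * (int n * (int n - 1) - int i - int n * int k)"
      by blast }
qed

end

section \<open>Newton diagrams and their support functions\<close>

definition nset :: "(real \<times> real) set \<Rightarrow> (real \<times> real) set" where
  "nset A = convex hull A + quadrant"

definition phi :: "(real \<times> real) set \<Rightarrow> real \<Rightarrow> real" where
  "phi A \<tau> = Min ((\<lambda>z. fst z + \<tau> * snd z) ` A)"

lemma quadrant_iff: "z \<in> quadrant \<longleftrightarrow> 0 \<le> fst z \<and> 0 \<le> snd z"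
  by (cases z) (simp add: quadrant_def)

lemma convex_quadrant: "convex quadrant"
  unfolding convex_def by (auto simp: quadrant_iff)

lemma closed_quadrant: "closed quadrant"
proof -
  have e: "quadrant = {z. 0 \<le> fst z} \<inter> {z. 0 \<le> snd z}" by (auto simp: quadrant_iff)
  show ?thesis unfolding e by (intro closed_Int closed_Collect_le continuous_intros)
qed

lemma quadrant_plus_quadrant: "quadrant + quadrant = quadrant"
proof
  show "quadrant + quadrant \<subseteq> quadrant" by (auto simp: set_plus_def quadrant_iff)
  show "quadrant \<subseteq> quadrant + quadrant"
    using set_plus_intro[of 0 quadrant _ quadrant] by (force simp: quadrant_iff)
qed

lemma nset_up:
  assumes "z \<in> nset A" "fst z \<le> fst w" "snd z \<le> snd w"
  shows "w \<in> nset A"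
proof -
  obtain x q where "x \<in> convex hull A" "q \<in> quadrant" "z = x + q" using assms(1) by (auto simp: nset_def set_plus_def)
  moreover have "w = x + (q + (w - z))" using calculation by simp
  moreover have "q + (w - z) \<in> quadrant" using calculation assms by (auto simp: quadrant_iff)
  ultimately show ?thesis unfolding nset_def by (metis set_plus_intro)
qed

lemma convex_nset: "convex (nset A)"
  unfolding nset_def by (intro convex_set_plus convex_convex_hull convex_quadrant)

lemma closed_nset: "finite A \<Longrightarrow> closed (nset A)"
proof -
  assume "finite A"
  then have "compact (convex hull A)" by (intro finite_imp_compact_convex_hull)
  then have "closed (\<Union>x\<in>convex hull A. \<Union>y\<in>quadrant. {x + y})" using closed_quadrant by (rule compact_closed_sums)
  also have "(\<Union>x\<in>convex hull A. \<Union>y\<in>quadrant. {x + y}) = nset A" by (auto simp: nset_def set_plus_def)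
  finally show ?thesis .
qed

lemma subset_nset: "A \<subseteq> nset A"
proof
  fix x assume "x \<in> A"
  then have "x + 0 \<in> nset A" unfolding nset_def by (intro set_plus_intro hull_inc) (auto simp: quadrant_iff)
  then show "x \<in> nset A" by simp
qed

lemma nset_subset_quadrant: "A \<subseteq> quadrant \<Longrightarrow> nset A \<subseteq> quadrant"
proof -
  assume "A \<subseteq> quadrant"
  then have "convex hull A \<subseteq> quadrant" by (intro hull_minimal convex_quadrant)
  then have "convex hull A + quadrant \<subseteq> quadrant + quadrant" by (rule set_plus_mono2) simp
  then show ?thesis by (simp add: nset_def quadrant_plus_quadrant)
qed

lemma phi_le: "finite A \<Longrightarrow> z \<in> A \<Longrightarrow> phi A \<tau> \<le> fst z + \<tau> * snd z"
  unfolding phi_def by (intro Min_le) auto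

lemma phi_attained:
  assumes "finite A" "A \<noteq> {}"
  obtains z where "z \<in> A" "fst z + \<tau> * snd z = phi A \<tau>"
proof -
  have "phi A \<tau> \<in> (\<lambda>z. fst z + \<tau> * snd z) ` A" unfolding phi_def using assms by (intro Min_in) auto
  then show thesis using that by auto
qed

lemma phi_eqI:
  assumes "finite A" "z \<in> A" "fst z + \<tau> * snd z = \<mu>" "\<And>w. w \<in> A \<Longrightarrow> fst w + \<tau> * snd w \<ge> \<mu>"
  shows "phi A \<tau> = \<mu>"
  unfolding phi_def using assms by (intro Min_eqI) auto

lemma nset_phi_le:
  assumes "finite A" "\<tau> \<ge> 0" "z \<in> nset A"
  shows "phi A \<tau> \<le> fst z + \<tau> * snd z"
proof -
  let ?H = "{z. phi A \<tau> \<le> fst z + \<tau> * snd z}"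
  have "?H = {z. inner (1, \<tau>) z \<ge> phi A \<tau>}" by (auto simp: inner_prod_def)
  then have "convex ?H" by (simp add: convex_halfspace_ge)
  moreover have "A \<subseteq> ?H" using phi_le[OF assms(1)] by auto
  ultimately have "convex hull A \<subseteq> ?H" by (rule hull_minimal[rotated])
  moreover obtain x q where "x \<in> convex hull A" "q \<in> quadrant" "z = x + q"
    using assms(3) by (auto simp: nset_def set_plus_def)
  moreover have "\<tau> * snd q \<ge> 0" using assms(2) \<open>q \<in> quadrant\<close> by (simp add: quadrant_iff)
  ultimately show ?thesis by (auto simp: quadrant_iff algebra_simps)
qed

lemma nset_eq:
  assumes A: "finite A" "A \<subseteq> quadrant" and z0: "z0 \<in> A" "snd z0 = 0"
  shows "nset A = {z \<in> quadrant. \<forall>\<tau>\<ge>0. phi A \<tau> \<le> fst z + \<tau> * snd z}"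
proof
  show "nset A \<subseteq> {z \<in> quadrant. \<forall>\<tau>\<ge>0. phi A \<tau> \<le> fst z + \<tau> * snd z}"
    using nset_phi_le[OF A(1)] nset_subset_quadrant[OF A(2)] by auto
  show "{z \<in> quadrant. \<forall>\<tau>\<ge>0. phi A \<tau> \<le> fst z + \<tau> * snd z} \<subseteq> nset A"
  proof
    fix z assume "z \<in> {z \<in> quadrant. \<forall>\<tau>\<ge>0. phi A \<tau> \<le> fst z + \<tau> * snd z}"
    then have z: "z \<in> quadrant" and ph: "\<And>\<tau>. \<tau> \<ge> 0 \<Longrightarrow> phi A \<tau> \<le> fst z + \<tau> * snd z" by auto
    show "z \<in> nset A"
    proof (rule ccontr)
      assume "z \<notin> nset A"
      then obtain v \<beta> where sep: "inner v z < \<beta>" "\<And>x. x \<in> nset A \<Longrightarrow> inner v x > \<beta>"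
        using separating_hyperplane_closed_point[OF convex_nset closed_nset[OF A(1)]] by metis
      have z0n: "z0 \<in> nset A" using z0 subset_nset by blast
      have nn: "u \<ge> 0" if u: "\<And>t. t \<ge> 0 \<Longrightarrow> inner v z0 + t * u > \<beta>" for u
      proof (rule ccontr)
        assume "\<not> u \<ge> 0"
        then have u0: "u < 0" by simp
        define t where "t = (inner v z0 - \<beta>) / (- u)"
        have "t \<ge> 0" unfolding t_def using u0 sep(2)[OF z0n] by (intro divide_nonneg_pos) auto
        moreover have "inner v z0 + t * u = \<beta>" using u0 by (simp add: t_def field_simps)
        ultimately show False using u[of t] by simp
      qed
      have v1: "fst v \<ge> 0"
      proof (rule nn)
        fix t :: real assume "t \<ge> 0"
        then have "z0 + (t, 0) \<in> nset A" by (intro nset_up[OF z0n]) auto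
        then have "inner v (z0 + (t, 0)) > \<beta>" by (rule sep(2))
        then show "inner v z0 + t * fst v > \<beta>" by (simp add: inner_prod_def algebra_simps)
      qed
      have v2: "snd v \<ge> 0"
      proof (rule nn)
        fix t :: real assume "t \<ge> 0"
        then have "z0 + (0, t) \<in> nset A" by (intro nset_up[OF z0n]) auto
        then have "inner v (z0 + (0, t)) > \<beta>" by (rule sep(2))
        then show "inner v z0 + t * snd v > \<beta>" by (simp add: inner_prod_def algebra_simps)
      qed
      show False
      proof (cases "fst v = 0")
        case True
        have "inner v z0 = 0" using True z0 by (simp add: inner_prod_def)
        then have "\<beta> < 0" using sep(2)[OF z0n] by simp
        moreover have "inner v z \<ge> 0" using True v2 z by (simp add: inner_prod_def quadrant_iff)
        ultimately show False using sep(1) by simp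
      next
        case False
        then have v1': "fst v > 0" using v1 by simp
        define \<tau> where "\<tau> = snd v / fst v"
        have fv: "fst v * \<tau> = snd v" using v1' by (simp add: \<tau>_def)
        have iv: "inner v x = fst v * (fst x + \<tau> * snd x)" for x
        proof -
          have "fst v * (fst x + \<tau> * snd x) = fst v * fst x + (fst v * \<tau>) * snd x"
            by (simp only: distrib_left mult.assoc)
          then show ?thesis by (simp add: fv inner_prod_def)
        qed
        obtain x where x: "x \<in> A" "fst x + \<tau> * snd x = phi A \<tau>"
          by (rule phi_attained[OF A(1), of \<tau>]) (use z0 in auto)
        have "inner v x > inner v z" using sep(1) sep(2)[OF subsetD[OF subset_nset x(1)]] by linarith
        then have "phi A \<tau> > fst z + \<tau> * snd z" using v1' x(2) by (simp add: iv)
        then show False using ph[of \<tau>] v1' v2 by (simp add: \<tau>_def)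
      qed
    qed
  qed
qed

lemma nset_plus: "nset A + nset B = nset (A + B)"
proof -
  have "nset A + nset B = (convex hull A + convex hull B) + (quadrant + quadrant)"
    by (simp only: nset_def ac_simps)
  then show ?thesis by (simp add: nset_def quadrant_plus_quadrant convex_hull_set_plus)
qed

lemma phi_plus:
  assumes "finite A" "A \<noteq> {}" "finite B" "B \<noteq> {}"
  shows "phi (A + B) \<tau> = phi A \<tau> + phi B \<tau>"
proof -
  obtain x y where xy: "x \<in> A" "fst x + \<tau> * snd x = phi A \<tau>" "y \<in> B" "fst y + \<tau> * snd y = phi B \<tau>"
    using phi_attained[OF assms(1,2)] phi_attained[OF assms(3,4)] by metis
  show ?thesis
  proof (rule phi_eqI)
    show "finite (A + B)" using assms by (simp add: finite_set_plus)
    show "x + y \<in> A + B" using xy by (intro set_plus_intro)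
    show "fst (x + y) + \<tau> * snd (x + y) = phi A \<tau> + phi B \<tau>" using xy by (simp add: algebra_simps)
    fix w assume "w \<in> A + B"
    then obtain a b where "a \<in> A" "b \<in> B" "w = a + b" by (auto simp: set_plus_def)
    then show "phi A \<tau> + phi B \<tau> \<le> fst w + \<tau> * snd w"
      using phi_le[OF assms(1), of a \<tau>] phi_le[OF assms(3), of b \<tau>] by (simp add: algebra_simps)
  qed
qed

lemma frontier_of_iff_eventually:
  fixes Q K :: "'a::metric_space set"
  assumes "closed K" "K \<subseteq> Q"
  shows "z \<in> top_of_set Q frontier_of K \<longleftrightarrow> z \<in> K \<and> \<not> eventually (\<lambda>w. w \<in> Q \<longrightarrow> w \<in> K) (nhds z)"
proof -
  have cl: "top_of_set Q closure_of K = K"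
    using assms by (intro closure_of_closedin) (auto simp: closedin_closed_eq closedin_closed)
  have int: "z \<in> top_of_set Q interior_of K \<longleftrightarrow> eventually (\<lambda>w. w \<in> Q \<longrightarrow> w \<in> K) (nhds z)" if "z \<in> K"
  proof
    assume "z \<in> top_of_set Q interior_of K"
    then obtain T where T: "openin (top_of_set Q) T" "z \<in> T" "T \<subseteq> K" by (auto simp: interior_of_def)
    then obtain U where "open U" "T = Q \<inter> U" by (auto simp: openin_open)
    then show "eventually (\<lambda>w. w \<in> Q \<longrightarrow> w \<in> K) (nhds z)"
      using T by (auto simp: eventually_nhds intro!: exI[of _ U])
  next
    assume "eventually (\<lambda>w. w \<in> Q \<longrightarrow> w \<in> K) (nhds z)"
    then obtain U where "open U" "z \<in> U" "\<And>w. w \<in> U \<Longrightarrow> w \<in> Q \<longrightarrow> w \<in> K" by (auto simp: eventually_nhds)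
    moreover from this have "openin (top_of_set Q) (Q \<inter> U)" by (intro openin_open_Int)
    moreover have "z \<in> Q" using that assms by blast
    ultimately show "z \<in> top_of_set Q interior_of K" unfolding interior_of_def by blast
  qed
  show ?thesis unfolding frontier_of_def cl using int by blast
qed

definition dec :: "real \<Rightarrow> real \<times> real \<Rightarrow> real \<times> real" where
  "dec \<delta> z = (max 0 (fst z - \<delta>), max 0 (snd z - \<delta>))"

lemma dec_tendsto: "z \<in> quadrant \<Longrightarrow> ((\<lambda>\<delta>. dec \<delta> z) \<longlongrightarrow> z) (at_right 0)"
proof -
  assume z: "z \<in> quadrant"
  have "((\<lambda>\<delta>. dec \<delta> z) \<longlongrightarrow> (max 0 (fst z - 0), max 0 (snd z - 0))) (at_right 0)"
    unfolding dec_def by (intro tendsto_intros)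
  then show ?thesis using z by (simp add: quadrant_iff)
qed

lemma eventually_fst_gt: "c < fst z \<Longrightarrow> eventually (\<lambda>w. c < fst w) (nhds (z :: real \<times> real))"
  and eventually_snd_gt: "c < snd z \<Longrightarrow> eventually (\<lambda>w. c < snd w) (nhds (z :: real \<times> real))"
  by (rule order_tendstoD(1)[OF tendsto_fst[OF filterlim_ident]] order_tendstoD(1)[OF tendsto_snd[OF filterlim_ident]], assumption)+

lemma eventually_nset_iff:
  assumes z: "z \<in> quadrant"
  shows "eventually (\<lambda>w. w \<in> quadrant \<longrightarrow> w \<in> nset A) (nhds z) \<longleftrightarrow> (\<exists>\<delta>>0. dec \<delta> z \<in> nset A)"
proof
  assume "eventually (\<lambda>w. w \<in> quadrant \<longrightarrow> w \<in> nset A) (nhds z)"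
  then have "eventually (\<lambda>\<delta>. dec \<delta> z \<in> quadrant \<longrightarrow> dec \<delta> z \<in> nset A) (at_right 0)"
    using dec_tendsto[OF z] by (rule eventually_compose_filterlim)
  then have "eventually (\<lambda>\<delta>. dec \<delta> z \<in> nset A) (at_right 0)" by eventually_elim (auto simp: dec_def quadrant_iff)
  then have "eventually (\<lambda>\<delta>. \<delta> > 0 \<and> dec \<delta> z \<in> nset A) (at_right (0::real))"
    using eventually_at_right_less[of 0] by eventually_elim auto
  then show "\<exists>\<delta>>0. dec \<delta> z \<in> nset A"
    by (metis (mono_tags, lifting) eventually_happens trivial_limit_at_right_real)
next
  assume "\<exists>\<delta>>0. dec \<delta> z \<in> nset A"
  then obtain \<delta> where d: "\<delta> > 0" "dec \<delta> z \<in> nset A" by blast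
  have "eventually (\<lambda>w. fst w > fst z - \<delta>) (nhds z)"
    using d by (intro eventually_fst_gt) simp
  moreover have "eventually (\<lambda>w. snd w > snd z - \<delta>) (nhds z)"
    using d by (intro eventually_snd_gt) simp
  ultimately show "eventually (\<lambda>w. w \<in> quadrant \<longrightarrow> w \<in> nset A) (nhds z)"
    by eventually_elim (auto simp: dec_def quadrant_iff intro!: nset_up[OF d(2)])
qed

lemma newton_polygon_at_zero_iff:
  assumes "finite A" "A \<subseteq> quadrant"
  shows "z \<in> newton_polygon_at_zero (nset A) \<longleftrightarrow>
    z \<in> nset A \<and> \<not> eventually (\<lambda>w. w \<in> quadrant \<longrightarrow> w \<in> nset A) (nhds z)"
  unfolding newton_polygon_at_zero_def
  using closed_nset[OF assms(1)] nset_subset_quadrant[OF assms(2)] by (rule frontier_of_iff_eventually)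

lemma newton_polygon_phi:
  assumes A: "finite A" "A \<subseteq> quadrant" "A \<noteq> {}" and \<tau>: "\<tau> > 0" "phi A \<tau> > 0"
  shows "\<And>z. z \<in> newton_polygon_at_zero (nset A) \<Longrightarrow> phi A \<tau> \<le> fst z + \<tau> * snd z"
    and "\<exists>z\<in>newton_polygon_at_zero (nset A). fst z + \<tau> * snd z = phi A \<tau>"
proof -
  show "phi A \<tau> \<le> fst z + \<tau> * snd z" if "z \<in> newton_polygon_at_zero (nset A)" for z
    using that nset_phi_le[OF A(1)] \<tau> by (simp add: newton_polygon_at_zero_iff[OF A(1,2)])
  obtain z where z: "z \<in> A" "fst z + \<tau> * snd z = phi A \<tau>" using phi_attained[OF A(1,3)] by blast
  have zq: "z \<in> quadrant" using z A by blast
  have "dec \<delta> z \<notin> nset A" if "\<delta> > 0" for \<delta>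
  proof
    assume "dec \<delta> z \<in> nset A"
    then have "phi A \<tau> \<le> fst (dec \<delta> z) + \<tau> * snd (dec \<delta> z)" using nset_phi_le[OF A(1)] \<tau> by simp
    moreover have "fst (dec \<delta> z) \<le> fst z" "snd (dec \<delta> z) \<le> snd z" using zq that by (auto simp: dec_def quadrant_iff)
    moreover have "fst (dec \<delta> z) < fst z \<or> snd (dec \<delta> z) < snd z"
    proof (rule ccontr)
      assume "\<not> (fst (dec \<delta> z) < fst z \<or> snd (dec \<delta> z) < snd z)"
      then have "fst z = 0" "snd z = 0" using that zq by (auto simp: dec_def quadrant_iff)
      then show False using z \<tau> by simp
    qed
    moreover have "\<tau> * snd (dec \<delta> z) \<le> \<tau> * snd z" using calculation(3) \<tau> by (intro mult_left_mono) auto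
    moreover have "snd (dec \<delta> z) < snd z \<Longrightarrow> \<tau> * snd (dec \<delta> z) < \<tau> * snd z" using \<tau> by simp
    ultimately show False using z(2) by linarith
  qed
  then have "z \<in> newton_polygon_at_zero (nset A)"
    using z subset_nset[of A] by (auto simp: newton_polygon_at_zero_iff[OF A(1,2)] eventually_nset_iff[OF zq])
  then show "\<exists>z\<in>newton_polygon_at_zero (nset A). fst z + \<tau> * snd z = phi A \<tau>" using z by blast
qed

section \<open>The Newton polygon at infinity\<close>

lemma affine_L_involution [simp]: "affine_L n (affine_L n z) = z"
  by (cases z) (simp add: affine_L_def)

lemma fst_affine_L [simp]: "fst (affine_L n z) = real n * (real n - 1) - fst z - real n * snd z"
  and snd_affine_L [simp]: "snd (affine_L n z) = snd z"
  by (simp_all add: affine_L_def case_prod_unfold)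

lemma isCont_affine_L: "isCont (affine_L n) z"
  unfolding affine_L_def case_prod_unfold by (intro continuous_intros)

lemma convex_hull_affine_L: "convex hull (affine_L n ` S) = affine_L n ` (convex hull S)"
proof -
  define T where "T = (\<lambda>z :: real \<times> real. (- fst z - real n * snd z, snd z))"
  have T: "linear T" by (rule linearI) (auto simp: T_def algebra_simps)
  have "affine_L n z = (real n * (real n - 1), 0) + T z" for z
    by (cases z) (simp add: affine_L_def T_def)
  then have L: "affine_L n ` S = (+) (real n * (real n - 1), 0) ` T ` S" for S
    by (simp add: image_image)
  show ?thesis unfolding L convex_hull_translation convex_hull_linear_image[OF T] ..
qed

lemma affine_L_quadrant_iff:
  "affine_L n z \<in> quadrant \<longleftrightarrow> 0 \<le> snd z \<and> fst z + real n * snd z \<le> real n * (real n - 1)"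
  by (cases z) (auto simp: affine_L_def quadrant_iff)

text \<open>
  The half-line at which the images of the two coordinate systems differ meets the diagram only in
  \<open>(0, n - 1)\<close>, which lies on both polygons.
\<close>

lemma newton_polygon_at_infinity_image:
  assumes n: "n \<ge> 2" and A_def: "A = affine_L n ` rsupp g" and Aq: "A \<subseteq> quadrant"
    and top: "(0, real n - 1) \<in> A" and wd: "(wd, 0) \<in> A"
    and \<tau>: "\<tau> > 0" "phi A \<tau> = \<tau> * (real n - 1)"
  shows "affine_L n ` newton_polygon_at_infinity g = newton_polygon_at_zero (nset A)"
proof -
  define M where "M = real n * (real n - 1)"
  have M: "M > 0" using n by (simp add: M_def)
  have finA: "finite A" unfolding A_def rsupp_def by simp
  define K where "K = convex hull (insert (M, 0) A)"
  have KL: "affine_L n ` (convex hull (insert (0, 0) (rsupp g))) = K"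
    unfolding K_def A_def convex_hull_affine_L[symmetric] by (simp add: affine_L_def M_def)
  have K0: "z \<in> convex hull (insert (0, 0) (rsupp g)) \<longleftrightarrow> affine_L n z \<in> K" for z
    using KL by (metis (no_types, lifting) affine_L_involution image_iff)
  have rq: "rsupp g \<subseteq> quadrant" by (auto simp: rsupp_def quadrant_iff)
  have AL: "affine_L n z \<in> quadrant" if "z \<in> A" for z using that rq by (auto simp: A_def)
  have WM: "0 \<le> wd" "wd \<le> M" using AL[OF wd] wd Aq by (auto simp: affine_L_quadrant_iff M_def quadrant_iff)
  have MD: "(M, 0) \<in> nset A" by (rule nset_up[of "(wd, 0)"]) (use wd subset_nset WM in auto)
  have topD: "(0, real n - 1) \<in> nset A" using top subset_nset by blast
  have seg: "w \<in> nset A" if "w \<in> quadrant" "fst w + real n * snd w \<ge> M" for w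
  proof -
    define s where "s = fst w + real n * snd w"
    have s: "s \<ge> M" "s > 0" using that M by (auto simp: s_def)
    define x where "x = ((fst w / s) * M, (real n * snd w / s) * (real n - 1))"
    have "x = (fst w / s) *\<^sub>R (M, 0) + (real n * snd w / s) *\<^sub>R (0, real n - 1)" by (simp add: x_def)
    moreover have "fst w / s + real n * snd w / s = 1" using s by (simp add: s_def flip: add_divide_distrib)
    ultimately have "x \<in> nset A"
      using convexD[OF convex_nset MD topD, of "fst w / s" "real n * snd w / s"] that s by (simp add: quadrant_iff)
    moreover have "fst x \<le> fst w"
    proof -
      have "fst w * M \<le> fst w * s" using that s by (intro mult_left_mono) (auto simp: quadrant_iff)
      then show ?thesis using s by (simp add: x_def field_simps)
    qed
    moreover have "snd x \<le> snd w"
    proof -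
      have "snd w * M \<le> snd w * s" using that s by (intro mult_left_mono) (auto simp: quadrant_iff)
      then show ?thesis using s by (simp add: x_def M_def field_simps)
    qed
    ultimately show ?thesis by (rule nset_up)
  qed
  have KD: "K = {z \<in> nset A. affine_L n z \<in> quadrant}"
  proof
    show "K \<subseteq> {z \<in> nset A. affine_L n z \<in> quadrant}"
    proof -
      have "K \<subseteq> nset A" unfolding K_def using MD subset_nset by (intro hull_minimal convex_nset) auto
      moreover have "convex hull (insert (0, 0) (rsupp g)) \<subseteq> quadrant"
        using rq by (intro hull_minimal convex_quadrant) (auto simp: quadrant_iff)
      ultimately show ?thesis using KL by auto
    qed
    show "{z \<in> nset A. affine_L n z \<in> quadrant} \<subseteq> K"
    proof
      fix z assume "z \<in> {z \<in> nset A. affine_L n z \<in> quadrant}"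
      then have zA: "z \<in> nset A" and zL: "snd z \<ge> 0" "fst z + real n * snd z \<le> M"
        by (auto simp: affine_L_quadrant_iff M_def)
      obtain k q where kq: "k \<in> convex hull A" "q \<in> quadrant" "z = k + q"
        using zA by (auto simp: nset_def set_plus_def)
      have kK: "k \<in> K" unfolding K_def using kq(1) hull_mono[of A "insert (M, 0) A"] by blast
      have MK: "(M, 0) \<in> K" and tK: "(0, real n - 1) \<in> K" unfolding K_def using top by (auto intro: hull_inc)
      have convK: "convex K" unfolding K_def by (rule convex_convex_hull)
      have kq': "k \<in> quadrant" using kq(1) hull_minimal[of A quadrant convex] Aq convex_quadrant by blast
      have segK: "w \<in> K" if "w \<in> quadrant" "fst w + real n * snd w = M" for w
      proof -
        have "w = (fst w / M) *\<^sub>R (M, 0) + (real n * snd w / M) *\<^sub>R (0, real n - 1)"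
          using M n by (cases w) (auto simp: M_def)
        moreover have "fst w / M + real n * snd w / M = 1" using that M by (simp flip: add_divide_distrib)
        ultimately show ?thesis
          using convexD[OF convK MK tK, of "fst w / M" "real n * snd w / M"] that M by (simp add: quadrant_iff)
      qed
      define c where "c = M - fst k - real n * snd k"
      have q0: "fst q \<ge> 0" "real n * snd q \<ge> 0" using kq(2) by (auto simp: quadrant_iff)
      have c2: "fst q + real n * snd q \<le> c"
        using zL kq(3) by (simp add: c_def algebra_simps)
      then have c: "c \<ge> 0" "fst q + real n * snd q \<le> c" using q0 by linarith+
      show "z \<in> K"
      proof (cases "c = 0")
        case True
        then have "fst q = 0" "real n * snd q = 0" using c(2) q0 by linarith+
        then have "q = 0" using n by (cases q) (simp add: zero_prod_def)
        then show ?thesis using kK kq by simp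
      next
        case False
        then have c0: "c > 0" using c by simp
        define x where "x = k + (c, 0)"
        define y where "y = k + (0, c / real n)"
        have xK: "x \<in> K" by (rule segK) (use kq' c0 in \<open>auto simp: x_def c_def quadrant_iff\<close>)
        have yK: "y \<in> K" by (rule segK) (use kq' c0 n in \<open>auto simp: y_def c_def quadrant_iff algebra_simps\<close>)
        define s where "s = fst q / c"
        define t where "t = real n * snd q / c"
        have st: "s \<ge> 0" "t \<ge> 0" using kq(2) c0 by (auto simp: s_def t_def quadrant_iff)
        have "s + t = (fst q + real n * snd q) / c" by (simp add: s_def t_def add_divide_distrib)
        then have st1: "s + t \<le> 1" using c c0 by simp
        have "z = (1 - s - t) *\<^sub>R k + s *\<^sub>R x + t *\<^sub>R y"
          using c0 n by (cases k; cases q) (simp add: kq(3) x_def y_def s_def t_def algebra_simps)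
        also have "\<dots> \<in> convex hull K"
        proof -
          have "(1 - s - t) *\<^sub>R k + s *\<^sub>R x + t *\<^sub>R y \<in> convex hull {k, x, y}"
            unfolding convex_hull_3 using st st1 by (intro CollectI exI[of _ "1 - s - t"] exI[of _ s] exI[of _ t]) simp
          moreover have "convex hull {k, x, y} \<subseteq> convex hull K" using kK xK yK by (intro hull_mono) auto
          ultimately show ?thesis by blast
        qed
        finally show ?thesis using hull_same[of convex K] convK by simp
      qed
    qed
  qed
  have finK: "finite (insert (0, 0) (rsupp g))" by (simp add: rsupp_def)
  have "compact (convex hull (insert (0, 0) (rsupp g)))" using finK by (intro finite_imp_compact_convex_hull)
  then have "closed (convex hull (insert (0, 0) (rsupp g)))" by (rule compact_imp_closed)
  moreover have "convex hull (insert (0, 0) (rsupp g)) \<subseteq> quadrant"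
    using rq by (intro hull_minimal convex_quadrant) (auto simp: quadrant_iff)
  ultimately have Pinf: "z \<in> newton_polygon_at_infinity g \<longleftrightarrow>
      affine_L n z \<in> K \<and> \<not> eventually (\<lambda>w. w \<in> quadrant \<longrightarrow> affine_L n w \<in> K) (nhds z)" for z
    unfolding newton_polygon_at_infinity_def by (simp add: frontier_of_iff_eventually K0)
  have ev_L: "eventually P (nhds (affine_L n z)) \<longleftrightarrow> eventually (\<lambda>w. P (affine_L n w)) (nhds z)" for P z
  proof -
    have lim: "filterlim (affine_L n) (nhds (affine_L n z)) (nhds z)" for z
      using isCont_affine_L[where n = n and z = z] by (simp add: isCont_def tendsto_at_iff_tendsto_nhds)
    show ?thesis
    proof
      assume "eventually P (nhds (affine_L n z))"
      then show "eventually (\<lambda>w. P (affine_L n w)) (nhds z)" using lim by (rule eventually_compose_filterlim)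
    next
      assume P: "eventually (\<lambda>w. P (affine_L n w)) (nhds z)"
      have "filterlim (affine_L n) (nhds z) (nhds (affine_L n z))"
        using lim[of "affine_L n z"] by simp
      from eventually_compose_filterlim[OF P this] show "eventually P (nhds (affine_L n z))" by simp
    qed
  qed
  have PL: "z \<in> affine_L n ` newton_polygon_at_infinity g \<longleftrightarrow>
      z \<in> K \<and> \<not> eventually (\<lambda>w. affine_L n w \<in> quadrant \<longrightarrow> w \<in> K) (nhds z)" for z
  proof -
    have "z \<in> affine_L n ` newton_polygon_at_infinity g \<longleftrightarrow> affine_L n z \<in> newton_polygon_at_infinity g"
      by (metis (no_types, lifting) affine_L_involution image_iff)
    then show ?thesis unfolding Pinf ev_L by simp
  qed
  have axis: "snd z \<ge> real n - 1" if "z \<in> nset A" "fst z = 0" for z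
    using nset_phi_le[OF finA _ that(1), of \<tau>] \<tau> that(2) by simp
  have "z \<in> affine_L n ` newton_polygon_at_infinity g \<longleftrightarrow> z \<in> newton_polygon_at_zero (nset A)" for z
    proof (cases "z \<in> K")
      case False
      have "z \<notin> newton_polygon_at_zero (nset A)"
      proof
        assume "z \<in> newton_polygon_at_zero (nset A)"
        then have zA: "z \<in> nset A" and nev: "\<not> eventually (\<lambda>w. w \<in> quadrant \<longrightarrow> w \<in> nset A) (nhds z)"
          by (auto simp: newton_polygon_at_zero_iff[OF finA Aq])
        have "z \<in> quadrant" using zA nset_subset_quadrant[OF Aq] by blast
        then have "fst z + real n * snd z > M" using False zA
          unfolding KD by (auto simp: affine_L_quadrant_iff M_def quadrant_iff)
        moreover have "((\<lambda>w. fst w + real n * snd w) \<longlongrightarrow> fst z + real n * snd z) (nhds z)"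
          by (intro tendsto_intros) (auto simp: filterlim_ident)
        ultimately have "eventually (\<lambda>w. fst w + real n * snd w > M) (nhds z)" by (rule order_tendstoD(1)[rotated])
        then have "eventually (\<lambda>w. w \<in> quadrant \<longrightarrow> w \<in> nset A) (nhds z)"
          by eventually_elim (auto intro: seg)
        then show False using nev by blast
      qed
      then show ?thesis using False PL by blast
    next
      case True
      then have zA: "z \<in> nset A" and zL: "affine_L n z \<in> quadrant" by (auto simp: KD)
      have zq: "z \<in> quadrant" using zA nset_subset_quadrant[OF Aq] by blast
      have "eventually (\<lambda>w. affine_L n w \<in> quadrant \<longrightarrow> w \<in> K) (nhds z) \<longleftrightarrow>
          eventually (\<lambda>w. w \<in> quadrant \<longrightarrow> w \<in> nset A) (nhds z)" (is "?l \<longleftrightarrow> ?r")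
      proof (cases "fst z = 0")
        case z0: True
        have "\<not> ?l"
        proof
          assume l: ?l
          have "((\<lambda>\<delta>. (- \<delta>, snd z)) \<longlongrightarrow> (- 0, snd z)) (at_right (0::real))" by (intro tendsto_intros)
          then have "filterlim (\<lambda>\<delta>. (- \<delta>, snd z)) (nhds z) (at_right (0::real))" using z0 by (cases z) simp
          then have "eventually (\<lambda>\<delta>. affine_L n (- \<delta>, snd z) \<in> quadrant \<longrightarrow> (- \<delta>, snd z) \<in> K) (at_right (0::real))"
            using l by (rule eventually_compose_filterlim[rotated])
          then have "eventually (\<lambda>\<delta>. False) (at_right (0::real))"
            using eventually_at_right_less[of "0::real"]
          proof eventually_elim
            case (elim \<delta>)
            then have "(- \<delta>, snd z) \<in> K" using zL z0 by (auto simp: affine_L_quadrant_iff)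
            then have "(- \<delta>, snd z) \<in> quadrant" using KD nset_subset_quadrant[OF Aq] by blast
            then show False using elim by (simp add: quadrant_iff)
          qed
          then show False by simp
        qed
        moreover have "\<not> ?r"
        proof
          assume ?r
          then obtain \<delta> where d: "\<delta> > 0" "dec \<delta> z \<in> nset A" unfolding eventually_nset_iff[OF zq] by blast
          have "snd (dec \<delta> z) \<ge> real n - 1" using axis[OF d(2)] z0 d by (simp add: dec_def)
          moreover have "real n * snd z \<le> real n * (real n - 1)" using zL z0 by (simp add: affine_L_quadrant_iff)
          then have "snd z \<le> real n - 1" using n by (simp add: mult_le_cancel_left)
          ultimately show False using d n by (auto simp: dec_def max_def split: if_splits)
        qed
        ultimately show ?thesis by blast
      next
        case z0: False
        then have zp: "fst z > 0" using zq by (simp add: quadrant_iff)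
        show ?thesis
        proof
          assume r: ?r
          have "eventually (\<lambda>w. fst w > 0) (nhds z)"
            using zp by (rule eventually_fst_gt)
          with r show ?l
          proof eventually_elim
            case (elim w)
            then show ?case by (auto simp: KD affine_L_quadrant_iff quadrant_iff)
          qed
        next
          assume l: ?l
          then have "eventually (\<lambda>\<delta>. affine_L n (dec \<delta> z) \<in> quadrant \<longrightarrow> dec \<delta> z \<in> K) (at_right 0)"
            using dec_tendsto[OF zq] by (rule eventually_compose_filterlim)
          then have "eventually (\<lambda>\<delta>. \<delta> > 0 \<and> dec \<delta> z \<in> nset A) (at_right 0)"
            using eventually_at_right_less[of "0::real"]
          proof eventually_elim
            case (elim \<delta>)
            have le: "fst (dec \<delta> z) \<le> fst z" "snd (dec \<delta> z) \<le> snd z" "snd (dec \<delta> z) \<ge> 0"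
              using elim zq by (auto simp: dec_def quadrant_iff)
            have "real n * snd (dec \<delta> z) \<le> real n * snd z" using le by (intro mult_left_mono) auto
            then have "affine_L n (dec \<delta> z) \<in> quadrant" using zL le by (simp add: affine_L_quadrant_iff)
            then show ?case using elim KD by blast
          qed
          then have "\<exists>\<delta>>0. dec \<delta> z \<in> nset A"
            by (metis (mono_tags, lifting) eventually_happens trivial_limit_at_right_real)
          then show ?r unfolding eventually_nset_iff[OF zq] .
        qed
      qed
      then show ?thesis using PL newton_polygon_at_zero_iff[OF finA Aq] True zA by blast
    qed
  then show ?thesis by blast
qed

section \<open>Weights of a product\<close>

definition wt_min :: "real \<Rightarrow> complex fps poly \<Rightarrow> real \<Rightarrow> bool" where
  "wt_min \<tau> E \<mu> \<longleftrightarrow> (\<forall>k m. fps_nth (coeff E k) m \<noteq> 0 \<longrightarrow> real m + \<tau> * real k \<ge> \<mu>) \<and>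
     (\<exists>k m. fps_nth (coeff E k) m \<noteq> 0 \<and> real m + \<tau> * real k = \<mu>)"

text \<open>Among the monomials of minimal weight, those of least degree in \<open>T\<close> cannot cancel in a product.\<close>

lemma wt_min_mult:
  assumes E1: "wt_min \<tau> E1 \<mu>1" and E2: "wt_min \<tau> E2 \<mu>2"
  shows "wt_min \<tau> (E1 * E2) (\<mu>1 + \<mu>2)"
proof -
  let ?c = "\<lambda>E k m. fps_nth (coeff E k) m"
  let ?w = "\<lambda>k m. real m + \<tau> * real k"
  have prod: "?c (E1 * E2) k m = (\<Sum>i\<le>k. \<Sum>j\<in>{0..m}. ?c E1 i j * ?c E2 (k - i) (m - j))" for k m
    by (simp add: coeff_mult fps_sum_nth fps_mult_nth)
  have ge1: "?c E1 k m \<noteq> 0 \<Longrightarrow> ?w k m \<ge> \<mu>1" and ge2: "?c E2 k m \<noteq> 0 \<Longrightarrow> ?w k m \<ge> \<mu>2" for k m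
    using E1 E2 by (auto simp: wt_min_def)
  have lower: "?w k m \<ge> \<mu>1 + \<mu>2" if nz: "?c (E1 * E2) k m \<noteq> 0" for k m
  proof -
    obtain i where i: "i \<le> k" "(\<Sum>j\<in>{0..m}. ?c E1 i j * ?c E2 (k - i) (m - j)) \<noteq> 0"
      using nz unfolding prod by (metis (mono_tags, lifting) atMost_iff sum.neutral)
    then obtain j where j: "j \<in> {0..m}" "?c E1 i j * ?c E2 (k - i) (m - j) \<noteq> 0"
      by (metis (mono_tags, lifting) sum.neutral)
    have "?w k m = ?w i j + ?w (k - i) (m - j)" using i j by (simp add: of_nat_diff algebra_simps)
    then show ?thesis using ge1[of i j] ge2[of "k - i" "m - j"] j by auto
  qed
  define P1 where "P1 = (\<lambda>k. \<exists>m. ?c E1 k m \<noteq> 0 \<and> ?w k m = \<mu>1)"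
  define P2 where "P2 = (\<lambda>k. \<exists>m. ?c E2 k m \<noteq> 0 \<and> ?w k m = \<mu>2)"
  define k1 where "k1 = (LEAST k. P1 k)"
  define k2 where "k2 = (LEAST k. P2 k)"
  have "\<exists>k. P1 k" "\<exists>k. P2 k" using E1 E2 by (auto simp: wt_min_def P1_def P2_def)
  then have "P1 k1" "P2 k2" unfolding k1_def k2_def by (auto intro: LeastI_ex)
  then obtain m1 m2 where m: "?c E1 k1 m1 \<noteq> 0" "?w k1 m1 = \<mu>1" "?c E2 k2 m2 \<noteq> 0" "?w k2 m2 = \<mu>2"
    by (auto simp: P1_def P2_def)
  have uniq: "i = k1 \<and> j = m1" if ij: "i \<le> k1 + k2" "j \<le> m1 + m2" "?c E1 i j * ?c E2 (k1 + k2 - i) (m1 + m2 - j) \<noteq> 0" for i j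
  proof -
    have "?w i j + ?w (k1 + k2 - i) (m1 + m2 - j) = \<mu>1 + \<mu>2"
      using ij m by (simp add: of_nat_diff algebra_simps)
    then have w: "?w i j = \<mu>1" "?w (k1 + k2 - i) (m1 + m2 - j) = \<mu>2"
      using ge1[of i j] ge2[of "k1 + k2 - i" "m1 + m2 - j"] ij(3) by auto
    then have "P1 i" "P2 (k1 + k2 - i)" using ij(3) by (auto simp: P1_def P2_def)
    then have "k1 \<le> i" "k2 \<le> k1 + k2 - i" unfolding k1_def k2_def by (auto intro: Least_le)
    then have "i = k1" using ij(1) by linarith
    then show ?thesis using w(1) m(2) by simp
  qed
  have "?c (E1 * E2) (k1 + k2) (m1 + m2) = (\<Sum>i\<le>k1 + k2. \<Sum>j\<in>{0..m1 + m2}. if i = k1 \<and> j = m1 then ?c E1 k1 m1 * ?c E2 k2 m2 else 0)"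
    unfolding prod
  proof (intro sum.cong refl)
    fix i j assume ij: "i \<in> {..k1 + k2}" "j \<in> {0..m1 + m2}"
    show "?c E1 i j * ?c E2 (k1 + k2 - i) (m1 + m2 - j) = (if i = k1 \<and> j = m1 then ?c E1 k1 m1 * ?c E2 k2 m2 else 0)"
    proof (cases "i = k1 \<and> j = m1")
      case False
      then have "?c E1 i j * ?c E2 (k1 + k2 - i) (m1 + m2 - j) = 0"
        using uniq[of i j] ij by auto
      then show ?thesis using False by simp
    qed auto
  qed
  also have "\<dots> = (\<Sum>i\<le>k1 + k2. if i = k1 then ?c E1 k1 m1 * ?c E2 k2 m2 else 0)"
    by (intro sum.cong refl) auto
  also have "\<dots> = ?c E1 k1 m1 * ?c E2 k2 m2" by simp
  finally have "?c (E1 * E2) (k1 + k2) (m1 + m2) \<noteq> 0" using m by simp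
  moreover have "?w (k1 + k2) (m1 + m2) = \<mu>1 + \<mu>2" using m by (simp add: algebra_simps)
  ultimately show ?thesis unfolding wt_min_def using lower by blast
qed

lemma wt_min_linear:
  assumes "f \<noteq> 0" "\<tau> \<ge> 0"
  shows "wt_min \<tau> [:f, - 1:] (min (real (subdegree f)) \<tau>)"
proof -
  have c: "fps_nth (coeff [:f, - 1:] k) m \<noteq> 0 \<longleftrightarrow> (k = 0 \<and> fps_nth f m \<noteq> 0) \<or> (k = 1 \<and> m = 0)" for k m
    by (cases k; cases "k - 1") auto
  have "m \<ge> subdegree f" if "fps_nth f m \<noteq> 0" for m using that by (rule subdegree_leI)
  then have "real m + \<tau> * real k \<ge> min (real (subdegree f)) \<tau>" if "fps_nth (coeff [:f, - 1:] k) m \<noteq> 0" for k m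
    using that unfolding c by fastforce
  moreover have "\<exists>k m. fps_nth (coeff [:f, - 1:] k) m \<noteq> 0 \<and> real m + \<tau> * real k = min (real (subdegree f)) \<tau>"
  proof (cases "real (subdegree f) \<le> \<tau>")
    case True
    then show ?thesis unfolding c using assms nth_subdegree_nonzero[of f]
      by (intro exI[of _ 0] exI[of _ "subdegree f"]) auto
  next
    case False
    then show ?thesis unfolding c by (intro exI[of _ 1] exI[of _ 0]) auto
  qed
  ultimately show ?thesis unfolding wt_min_def by blast
qed

lemma wt_min_prod:
  assumes "\<tau> \<ge> 0" "\<And>g. g \<in># G \<Longrightarrow> f g \<noteq> 0"
  shows "wt_min \<tau> (\<Prod>g\<in>#G. [:f g, - 1:]) (\<Sum>g\<in>#G. min (real (subdegree (f g))) \<tau>)"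
  using assms(2)
proof (induction G)
  case empty
  have "fps_nth (coeff 1 k) m \<noteq> (0 :: complex) \<longleftrightarrow> k = 0 \<and> m = 0" for k m
    by (cases k) auto
  then show ?case by (auto simp: wt_min_def)
next
  case (add g G)
  have "wt_min \<tau> ([:f g, - 1:] * (\<Prod>g\<in>#G. [:f g, - 1:])) (min (real (subdegree (f g))) \<tau> + (\<Sum>g\<in>#G. min (real (subdegree (f g))) \<tau>))"
    using add assms(1) by (intro wt_min_mult wt_min_linear) auto
  then show ?case by (simp del: mult_pCons_left)
qed

lemma coeff_top_prod: "coeff (\<Prod>g\<in>#G. [:f g, - 1 :: complex fps:]) (size G) = (- 1) ^ size G"
  and degree_prod_le: "degree (\<Prod>g\<in>#G. [:f g, - 1 :: complex fps:]) \<le> size G"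
proof (induction G)
  case (add g G)
  let ?P = "\<Prod>g\<in>#G. [:f g, - 1 :: complex fps:]"
  { case 1
    have "coeff ([:f g, - 1:] * ?P) (Suc (size G)) = - coeff ?P (size G)"
      using add(2) by (simp add: coeff_eq_0)
    then show ?case using add(1) by (simp del: mult_pCons_left) }
  { case 2
    show ?case using add(2) order_trans[OF degree_mult_le[of "[:f g, - 1:]" ?P]]
      by (simp del: mult_pCons_left) }
qed simp_all

lemma subdegree_poly_roots:
  fixes Y :: "complex fps set"
  assumes "finite Y" "\<gamma> \<notin> Y" "a \<noteq> 0"
  shows "poly (smult (fps_const a) (roots_poly (mset_set Y))) \<gamma> \<noteq> 0"
    and "subdegree (poly (smult (fps_const a) (roots_poly (mset_set Y))) \<gamma>) = (\<Sum>y\<in>Y. subdegree (\<gamma> - y))"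
proof -
  have e: "poly (smult (fps_const a) (roots_poly (mset_set Y))) \<gamma> = fps_const a * (\<Prod>y\<in>Y. \<gamma> - y)"
    by (simp add: poly_roots_poly prod_unfold_prod_mset)
  have nz: "(\<Prod>y\<in>Y. \<gamma> - y) \<noteq> 0" using assms by auto
  show "poly (smult (fps_const a) (roots_poly (mset_set Y))) \<gamma> \<noteq> 0" unfolding e using nz assms by simp
  have "subdegree (\<Prod>y\<in>Y. \<gamma> - y) = (\<Sum>y\<in>Y. subdegree (\<gamma> - y))"
    using assms(1,2) by (induction Y rule: finite_induct) (auto simp: subdegree_mult simp del: fps_mult_subdegree_ge)
  then show "subdegree (poly (smult (fps_const a) (roots_poly (mset_set Y))) \<gamma>) = (\<Sum>y\<in>Y. subdegree (\<gamma> - y))"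
    unfolding e using nz assms by (simp add: subdegree_mult)
qed

section \<open>Newton diagrams of Merle sequences\<close>

lemma T_diagram_nset:
  assumes "L > 0" "M > 0"
  shows "T_diagram L M = nset {(real L, 0), (0, real M)}"
proof -
  have "rsupp (monom (monom 1 L) 0 + monom (monom 1 0) M) = {(real L, 0), (0, real M)}"
  proof -
    have "supp2 (monom (monom 1 L) 0 + monom (monom 1 0) M) = {(L, 0), (0, M)}"
      unfolding supp2_def using assms by (auto split: if_splits)
    then show ?thesis by (auto simp: rsupp_def)
  qed
  then show ?thesis
    unfolding T_diagram_def newton_diagram_def nset_def
    by (simp add: convex_hull_set_plus hull_same[of convex quadrant, OF convex_quadrant])
qed

lemma sum_nset:
  fixes L M :: "nat \<Rightarrow> real"
  assumes "finite I" "I \<noteq> {}" "\<And>k. k \<in> I \<Longrightarrow> L k \<ge> 0 \<and> M k \<ge> 0"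
  shows "\<exists>A. finite A \<and> A \<subseteq> quadrant \<and> (\<exists>z\<in>A. snd z = 0) \<and> (\<Sum>k\<in>I. nset {(L k, 0), (0, M k)}) = nset A \<and>
    (\<forall>\<tau>. phi A \<tau> = (\<Sum>k\<in>I. min (L k) (\<tau> * M k)))"
proof -
  have p1: "phi {(l, 0), (0, m)} \<tau> = min l (\<tau> * m)" for l m \<tau> by (simp add: phi_def)
  show ?thesis
    using assms
  proof (induction I rule: finite_ne_induct)
    case (singleton k)
    then show ?case by (intro exI[of _ "{(L k, 0), (0, M k)}"]) (auto simp: p1 quadrant_iff)
  next
    case (insert k I)
    obtain A where A: "finite A" "A \<subseteq> quadrant" "\<exists>z\<in>A. snd z = 0" "(\<Sum>k\<in>I. nset {(L k, 0), (0, M k)}) = nset A"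
      "\<And>\<tau>. phi A \<tau> = (\<Sum>k\<in>I. min (L k) (\<tau> * M k))"
      using insert.IH insert.prems by auto
    let ?B = "{(L k, 0), (0, M k)}"
    obtain z where z: "z \<in> A" "snd z = 0" using A(3) by blast
    have "finite (?B + A)" using A by (simp add: finite_set_plus)
    moreover have "?B + A \<subseteq> quadrant"
    proof -
      have "?B \<subseteq> quadrant" using insert.prems by (auto simp: quadrant_iff)
      then have "?B + A \<subseteq> quadrant + quadrant" using A(2) by (rule set_plus_mono2)
      then show ?thesis by (simp add: quadrant_plus_quadrant)
    qed
    moreover have "\<exists>z\<in>?B + A. snd z = 0"
      using z by (intro bexI[of _ "(L k, 0) + z"] set_plus_intro) auto
    moreover have "(\<Sum>k\<in>insert k I. nset {(L k, 0), (0, M k)}) = nset (?B + A)"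
      using insert.hyps A(4) by (simp add: nset_plus)
    moreover have "phi (?B + A) \<tau> = (\<Sum>k\<in>insert k I. min (L k) (\<tau> * M k))" for \<tau>
    proof -
      have "phi (?B + A) \<tau> = phi ?B \<tau> + phi A \<tau>" using A z by (intro phi_plus) auto
      then show ?thesis using insert.hyps A(5) by (simp add: p1)
    qed
    ultimately show ?case by blast
  qed
qed

lemma merle_diagram_nset:
  assumes seq: "merle_seq0 h b" and h: "h \<ge> 1"
  shows "\<exists>A. finite A \<and> A \<subseteq> quadrant \<and> (\<exists>z\<in>A. snd z = 0) \<and> merle_diagram h b = nset A \<and>
    (\<forall>\<tau>. phi A \<tau> = (\<Sum>s\<in>#merle_ms h b. min s \<tau>))"
proof -
  let ?P = "\<lambda>k. \<Prod>j=1..<k. merle_n b j"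
  let ?L = "\<lambda>k. (merle_n b k - 1) * b k" and ?M = "\<lambda>k. (merle_n b k - 1) * ?P k"
  have n: "merle_n b k > 1" "b k > 0" "?P k > 0" if "k \<in> {1..h}" for k
    using seq that merle_n_pos[of h b k] by (auto simp: merle_seq0_def)
  have md: "merle_diagram h b = (\<Sum>k\<in>{1..h}. nset {(real (?L k), 0), (0, real (?M k))})"
    unfolding merle_diagram_def using n by (intro sum.cong refl T_diagram_nset) auto
  have nn: "finite {1..h}" "{1..h} \<noteq> {}" using h by auto
  have nn': "0 \<le> real (?L k) \<and> 0 \<le> real (?M k)" for k by (simp only: of_nat_0_le_iff)
  obtain A where A: "finite A" "A \<subseteq> quadrant" "\<exists>z\<in>A. snd z = 0"
    "(\<Sum>k\<in>{1..h}. nset {(real (?L k), 0), (0, real (?M k))}) = nset A"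
    "\<And>\<tau>. phi A \<tau> = (\<Sum>k\<in>{1..h}. min (real (?L k)) (\<tau> * real (?M k)))"
    using sum_nset[of "{1..h}" "\<lambda>k. real (?L k)" "\<lambda>k. real (?M k)", OF nn nn'] by blast
  have ph: "phi A \<tau> = (\<Sum>s\<in>#merle_ms h b. min s \<tau>)" for \<tau>
  proof -
    have sm: "(\<Sum>s\<in>#(\<Sum>k\<in>I. R k). min s \<tau>) = (\<Sum>k\<in>I. \<Sum>s\<in>#R k. min s \<tau>)" if "finite I"
      for I :: "nat set" and R :: "nat \<Rightarrow> real multiset"
      using that by (induction I rule: finite_induct) auto
    have "(\<Sum>s\<in>#merle_ms h b. min s \<tau>) = (\<Sum>k\<in>{1..h}. real (?M k) * min (real (b k) / real (?P k)) \<tau>)"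
      unfolding merle_ms_def by (simp add: sm)
    also have "\<dots> = (\<Sum>k\<in>{1..h}. min (real (?L k)) (\<tau> * real (?M k)))"
    proof (rule sum.cong)
      fix k assume k: "k \<in> {1..h}"
      have "real (?M k) * min (real (b k) / real (?P k)) \<tau> = min (real (?M k) * (real (b k) / real (?P k))) (real (?M k) * \<tau>)"
        by (simp only: min_mult_distrib_left of_nat_0_le_iff if_True)
      also have "real (?M k) * (real (b k) / real (?P k)) = real (?L k)"
      proof -
        have "real (?P k) \<noteq> 0" using n(3)[OF k] by (simp only: of_nat_eq_0_iff)
        moreover have "(x * q) * (y / q) = x * y" if "q \<noteq> 0" for x y q :: real using that by simp
        ultimately have q: "(x * real (?P k)) * (y / real (?P k)) = x * y" for x y by blast
        show ?thesis unfolding of_nat_mult by (rule q)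
      qed
      finally show "real (?M k) * min (real (b k) / real (?P k)) \<tau> = min (real (?L k)) (\<tau> * real (?M k))"
        by (simp only: mult.commute)
    qed simp
    finally show ?thesis using A(5) by simp
  qed
  show ?thesis using A(1-3) trans[OF md A(4)] ph by blast
qed

text \<open>The multiset is the negative second difference of its support function.\<close>

lemma mset_eq_of_sum_min:
  fixes S S' :: "real multiset"
  assumes pos: "\<And>s. s \<in># S + S' \<Longrightarrow> s > 0"
    and eq: "\<And>\<tau>. \<tau> > 0 \<Longrightarrow> (\<Sum>s\<in>#S. min s \<tau>) = (\<Sum>s\<in>#S'. min s \<tau>)"
  shows "S = S'"
proof (rule multiset_eqI)
  fix x
  show "count S x = count S' x"
  proof (cases "x > 0")
    case False
    then have "x \<notin># S" "x \<notin># S'" using pos by auto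
    then show ?thesis by (simp add: count_eq_zero_iff[THEN iffD2])
  next
    case True
    define \<epsilon> where "\<epsilon> = Min (insert (x / 2) ((\<lambda>s. \<bar>s - x\<bar>) ` (set_mset (S + S') - {x})))"
    have e: "\<epsilon> > 0" "\<epsilon> < x" "\<And>s. s \<in># S + S' \<Longrightarrow> s \<noteq> x \<Longrightarrow> \<epsilon> \<le> \<bar>s - x\<bar>"
    proof -
      show "\<epsilon> > 0" unfolding \<epsilon>_def using True by (subst Min_gr_iff) auto
      have "\<epsilon> \<le> x / 2" unfolding \<epsilon>_def by (intro Min_le) auto
      then show "\<epsilon> < x" using True by linarith
      show "\<epsilon> \<le> \<bar>s - x\<bar>" if "s \<in># S + S'" "s \<noteq> x" for s unfolding \<epsilon>_def using that by (intro Min_le) auto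
    qed
    have diff: "(\<Sum>s\<in>#R. min s (x + \<epsilon>)) + (\<Sum>s\<in>#R. min s (x - \<epsilon>)) - 2 * (\<Sum>s\<in>#R. min s x) = - \<epsilon> * real (count R x)"
      if "set_mset R \<subseteq> set_mset (S + S')" for R
      using that
    proof (induction R)
      case (add s R)
      have "s = x \<or> \<epsilon> \<le> \<bar>s - x\<bar>" using e(3)[of s] add.prems by auto
      then have "min s (x + \<epsilon>) + min s (x - \<epsilon>) - 2 * min s x = (if s = x then - \<epsilon> else 0)"
        using e(1) by (cases "s \<le> x") (auto simp: min_def abs_if split: if_splits)
      then show ?case using add by (simp add: algebra_simps split: if_splits)
    qed simp
    have "- \<epsilon> * real (count S x) = - \<epsilon> * real (count S' x)"
      using diff[of S] diff[of S'] eq[of "x + \<epsilon>"] eq[of "x - \<epsilon>"] eq[of x] e True by simp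
    then show ?thesis using e by simp
  qed
qed

section \<open>The slopes of the discriminant\<close>

lemma fps_nth_poly_0: "fps_nth (poly f y) 0 = poly (red f) (fps_nth y 0)"
proof (induction f)
  case (pCons b f)
  have "red (pCons b f) = pCons (fps_nth b 0) (red f)"
    by (rule poly_eqI) (simp add: coeff_pCons split: nat.splits)
  then show ?case using pCons.IH by simp
qed (simp add: red_def)

lemma roots_vanish_at_0:
  assumes "red (smult b (roots_poly R)) = monom a n" "a \<noteq> 0" "y \<in># R"
  shows "fps_nth y 0 = 0"
proof -
  have "poly (roots_poly R) y = 0" using assms(3) by (force simp: poly_roots_poly)
  then have "0 = fps_nth (poly (smult b (roots_poly R)) y) 0" by simp
  also have "\<dots> = poly (monom a n) (fps_nth y 0)" unfolding fps_nth_poly_0 assms(1) ..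
  finally show ?thesis using assms(2) by (simp add: poly_monom)
qed

lemma polar_ms_pos:
  assumes fin: "finite Y" and ne: "Y \<noteq> {}" and rolle: "rolle Y G"
    and Y0: "\<And>y. y \<in> Y \<Longrightarrow> fps_nth y 0 = 0" and s: "s \<in># polar_ms Y G"
  shows "s > 0"
proof -
  obtain y0 where y0: "y0 \<in> Y" using ne by blast
  interpret bunch Y G 1 y0
    by unfold_locales (use fin ne rolle Y0 y0 in \<open>auto simp: near_def\<close>)
  obtain g where g: "g \<in># G" "s = (\<Sum>y\<in>Y. subdegree (g - y))" using s by (auto simp: polar_ms_def)
  have "fps_nth g 0 = 0" using near_a_G[OF g(1)] Y0[OF y0] by (simp add: near_def)
  moreover have "g \<noteq> y0" using rolle_disjoint[OF rolle fin g(1)] y0 by blast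
  ultimately have "subdegree (g - y0) > 0" using Y0[OF y0] by (simp add: subdegree_eq_0_iff gr0_conv_Suc[symmetric] flip: neq0_conv)
  also have "subdegree (g - y0) \<le> s" unfolding g(2) using y0 fin by (intro member_le_sum) auto
  finally show ?thesis .
qed

text \<open>
  The exponents of \<open>w = v^(1/N)\<close> are divided by \<open>N\<close>, so the slopes of the diagram are the intersection
  numbers of the polar roots with the curve.
\<close>

lemma critical_diagram:
  fixes Y :: "complex fps set" and G :: "complex fps multiset"
  assumes fin: "finite Y" and rolle: "rolle Y G" and N: "N > 0" and a: "a \<noteq> 0"
    and E: "E = (\<Prod>g\<in>#G. [:poly (smult (fps_const a) (roots_poly (mset_set Y))) g, - 1:])"
    and A: "A = {(real m / real N, real k) | m k. fps_nth (coeff E k) m \<noteq> 0}" and finA: "finite A"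
  shows "A \<subseteq> quadrant"
    and "\<tau> \<ge> 0 \<Longrightarrow> phi A \<tau> = (\<Sum>s\<in>#image_mset (\<lambda>s. real s / real N) (polar_ms Y G). min s \<tau>)"
    and "(0, real (size G)) \<in> A"
    and "\<exists>x. (x, 0) \<in> A"
proof -
  let ?f = "poly (smult (fps_const a) (roots_poly (mset_set Y)))"
  have f: "?f g \<noteq> 0" "subdegree (?f g) = (\<Sum>y\<in>Y. subdegree (g - y))" if "g \<in># G" for g
    using subdegree_poly_roots[OF fin rolle_disjoint[OF rolle fin that] a] by blast+
  show "A \<subseteq> quadrant" by (auto simp: A quadrant_iff)
  show "phi A \<tau> = (\<Sum>s\<in>#image_mset (\<lambda>s. real s / real N) (polar_ms Y G). min s \<tau>)" if \<tau>: "\<tau> \<ge> 0"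
  proof -
    define \<mu> where "\<mu> = (\<Sum>g\<in>#G. min (real (subdegree (?f g))) (real N * \<tau>))"
    have "wt_min (real N * \<tau>) E \<mu>"
      unfolding E \<mu>_def by (rule wt_min_prod) (use \<tau> f in auto)
    then have ge: "\<And>k m. fps_nth (coeff E k) m \<noteq> 0 \<Longrightarrow> real m + real N * \<tau> * real k \<ge> \<mu>"
      and ex: "\<exists>k m. fps_nth (coeff E k) m \<noteq> 0 \<and> real m + real N * \<tau> * real k = \<mu>"
      by (auto simp: wt_min_def)
    have e: "real m / real N + \<tau> * real k = (real m + real N * \<tau> * real k) / real N" for m k
      using N by (simp add: field_simps)
    obtain k m where km: "fps_nth (coeff E k) m \<noteq> 0" "real m + real N * \<tau> * real k = \<mu>" using ex by blast
    have "phi A \<tau> = \<mu> / real N"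
    proof (rule phi_eqI[OF finA])
      show "(real m / real N, real k) \<in> A" using km by (auto simp: A)
      show "fst (real m / real N, real k) + \<tau> * snd (real m / real N, real k) = \<mu> / real N"
        by (simp only: fst_conv snd_conv e km(2))
      show "\<mu> / real N \<le> fst w + \<tau> * snd w" if w: "w \<in> A" for w
      proof -
        obtain m' k' where "w = (real m' / real N, real k')" "fps_nth (coeff E k') m' \<noteq> 0" using w by (auto simp: A)
        then show ?thesis using ge[of k' m'] by (simp add: e divide_right_mono)
      qed
    qed
    also have "\<mu> / real N = (\<Sum>s\<in>#image_mset (\<lambda>s. real s / real N) (polar_ms Y G). min s \<tau>)"
    proof -
      have m: "min (real k / real N) \<tau> = min (real k) (real N * \<tau>) / real N" for k
        using N by (simp add: min_def field_simps)
      have "(\<Sum>g\<in>#H. min (real (k g) / real N) \<tau>) = (\<Sum>g\<in>#H. min (real (k g)) (real N * \<tau>)) / real N"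
        for H :: "complex fps multiset" and k :: "complex fps \<Rightarrow> nat"
        by (induction H) (simp_all only: image_mset_empty image_mset_add_mset sum_mset.empty sum_mset.add_mset m add_divide_distrib div_0)
      moreover have "\<mu> = (\<Sum>g\<in>#G. min (real (\<Sum>y\<in>Y. subdegree (g - y))) (real N * \<tau>))"
        unfolding \<mu>_def by (intro arg_cong[of _ _ sum_mset] image_mset_cong) (simp only: f)
      ultimately show ?thesis by (simp only: polar_ms_def multiset.map_comp o_def)
    qed
    finally show ?thesis .
  qed
  have "coeff E (size G) = (- 1) ^ size G" unfolding E by (rule coeff_top_prod)
  then have "fps_nth (coeff E (size G)) 0 \<noteq> 0" by (cases "even (size G)") simp_all
  then show "(0, real (size G)) \<in> A" unfolding A by (intro CollectI exI[of _ 0] exI[of _ "size G"]) simp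
  have "poly (\<Prod>g\<in>#H. [:?f g, - 1:]) 0 = (\<Prod>g\<in>#H. ?f g)" for H :: "complex fps multiset"
    by (induction H) simp_all
  then have "coeff E 0 = (\<Prod>g\<in>#G. ?f g)" by (simp only: E flip: poly_0_coeff_0)
  then have "coeff E 0 \<noteq> 0" using f(1) by auto
  then have "fps_nth (coeff E 0) (subdegree (coeff E 0)) \<noteq> 0" by (rule nth_subdegree_nonzero)
  then have "(real (subdegree (coeff E 0)) / real N, real 0) \<in> A" unfolding A by blast
  then show "\<exists>x. (x, 0) \<in> A" by auto
qed

lemma sum_mset_min_pos:
  fixes M :: "real multiset"
  assumes "M \<noteq> {#}" "\<And>s. s \<in># M \<Longrightarrow> s > 0" "\<tau> > 0"
  shows "(\<Sum>s\<in>#M. min s \<tau>) > 0"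
  using assms
proof (induction M)
  case (add s M)
  then show ?case by (cases "M = {#}") (auto intro!: add_pos_pos)
qed simp

theorem theorem5p1:
  fixes p :: "complex poly poly" and n :: nat and Q :: proj_point
  assumes "total_degree p = n" and "n \<ge> 2"
    and "squarefree p"
    and "proj_closure p \<inter> line_at_infinity = {Q}" and "Q \<noteq> hpoint 0 1 0"
  shows "analytically_irreducible_at p Q \<longleftrightarrow>
    (\<exists>\<Delta>. merle_type_diagram \<Delta> \<and>
         affine_L n ` newton_polygon_at_infinity (D_infinity p) = newton_polygon_at_zero \<Delta>)"
proof -
  have n1: "n \<ge> 1" using assms(2) by simp
  obtain a c where a0: "a \<noteq> 0" and top: "top_form p = smult a ([:- c, 1:] ^ n)" and Q: "Q = hpoint 1 c 0"
    by (rule single_point_at_infinity[OF assms(1) n1 assms(4,5)])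
  have lc0: "coeff (coeff p n) 0 = a"
  proof -
    have "coeff (top_form p) n = a" unfolding top coeff_smult coeff_linear_power by simp
    then show ?thesis by (simp add: coeff_top_form assms(1))
  qed
  define F where "F = map_poly fps_of_poly (loc_poly p c)"
  have cF: "coeff F n = fps_const a"
    using coeff_loc_poly[of p c] by (simp add: F_def coeff_map_poly assms(1) lc0 fps_of_poly_const)
  have dF: "degree F = n"
  proof (rule antisym)
    have "degree F \<le> degree (loc_poly p c)" unfolding F_def by (rule degree_map_poly_le)
    then show "degree F \<le> n" using degree_loc_poly[of p c] assms(1) by simp
    show "n \<le> degree F" using cF a0 by (intro le_degree) simp
  qed
  obtain N R G where N: "N > 0" and split: "psub N F = smult (fps_const a) (roots_poly R)"
    and der: "pderiv (roots_poly R) = smult (of_nat n) (roots_poly G)" and sR: "size R = n"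
    by (rule puiseux_with_derivative[OF cF a0 dF n1])
  note prems = assms(1) n1 lc0 a0 N F_def split der sR
  define Y where "Y = set_mset R"
  have RY: "R = mset_set Y" unfolding Y_def by (rule distinct_roots[OF prems assms(3)])
  have fin: "finite Y" by (simp add: Y_def)
  have cY: "card Y = n" using sR unfolding RY by simp
  have ne: "Y \<noteq> {}" using cY n1 by auto
  note split' = split[unfolded RY] and der' = der[unfolded RY]
  have rol: "rolle Y G" using n1 by (intro rolleI[OF der' _ fin]) simp
  have red: "red (smult (fps_const a) (roots_poly (mset_set Y))) = monom a n"
  proof -
    have "red (psub N F) = map_poly (\<lambda>q. poly q 0) (loc_poly p c)"
      using N by (intro poly_eqI) (simp add: F_def coeff_map_poly fsub_nth poly_0_coeff_0)
    then show ?thesis by (simp only: split' map_poly_const_term_loc_poly[OF top])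
  qed
  have Y0: "fps_nth y 0 = 0" if "y \<in> Y" for y
    by (rule roots_vanish_at_0[OF red a0]) (use that fin in simp)
  define \<zeta> :: complex where "\<zeta> = exp (2 * of_real pi * \<i> / of_nat N)"
  have prim: "\<zeta> ^ k = 1 \<longleftrightarrow> N dvd k" for k
  proof -
    have "\<zeta> ^ k = exp (2 * of_real pi * \<i> * of_nat k / of_nat N)"
      unfolding \<zeta>_def by (simp add: mult_ac flip: exp_of_nat_mult)
    then show ?thesis using complex_root_unity_eq_1[of N k] N by simp
  qed
  have tR: "image_mset (twist \<zeta>) (mset_set Y) = mset_set Y"
    by (rule twist_roots_stable[OF _ N split' a0]) (simp add: prim)
  have tY: "twist \<zeta> ` Y = Y"
    using tR fin by (metis finite_set_mset_mset_set set_image_mset)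
  have dN: "psub N (pderiv F) = smult (fps_const (a * of_nat n)) (roots_poly G)"
  proof -
    have "psub N (pderiv F) = pderiv (psub N F)"
      by (rule poly_eqI) (simp add: coeff_map_poly coeff_pderiv hom_distribs)
    then show ?thesis by (simp add: split' pderiv_smult der' fps_of_nat flip: fps_const_mult)
  qed
  have tG: "image_mset (twist \<zeta>) G = G"
    by (rule twist_roots_stable[OF _ N dN]) (use prim n1 a0 in simp_all)
  define S where "S = image_mset (\<lambda>s. real s / real N) (polar_ms Y G)"
  have irr: "analytically_irreducible_at p Q \<longleftrightarrow> (\<exists>h b. merle_seq0 h b \<and> b 0 = n \<and> merle_ms h b = S)"
  proof -
    have "analytically_irreducible_at p Q \<longleftrightarrow> irreducible (local_equation p (1, c, 0))"
      unfolding Q by (rule analytically_irreducible_hpoint)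
    also have "\<dots> \<longleftrightarrow> conjugate_set \<zeta> Y"
      by (rule irreducible_iff_conjugate[OF N prim F_def sw_local_equation[of p c, folded F_def] split' a0 fin ne Y0])
    also have "\<dots> \<longleftrightarrow> (\<exists>h b. merle_seq0 h b \<and> b 0 = card Y \<and> merle_ms h b = S)"
      using conjugate_iff_merle[OF N prim, of 1 Y G] fin ne tY tG rol by (simp add: S_def)
    finally show ?thesis by (simp only: cY)
  qed

  define E where "E = (\<Prod>g\<in>#G. [:poly (psub N F) g, - 1:])"
  have E': "E = (\<Prod>g\<in>#G. [:poly (smult (fps_const a) (roots_poly (mset_set Y))) g, - 1:])"
    unfolding E_def split' ..
  have supp1: "\<exists>m. fps_nth (coeff E k) m \<noteq> 0 \<and> int m = int N * (int n * (int n - 1) - int i - int n * int k)"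
    if "coeff (coeff (D_infinity p) k) i \<noteq> 0" for i k
    using supp_D_infinity(1)[OF prems that] by (simp only: crit_def[OF prems] E_def)
  have supp2: "\<exists>i. coeff (coeff (D_infinity p) k) i \<noteq> 0 \<and> int m = int N * (int n * (int n - 1) - int i - int n * int k)"
    if "fps_nth (coeff E k) m \<noteq> 0" for m k
  proof (rule supp_D_infinity(2)[OF prems])
    show "fps_nth (coeff (crit N G F) k) m \<noteq> 0" using that unfolding crit_def[OF prems] E_def .
  qed
  define A where "A = affine_L n ` rsupp (D_infinity p)"
  have finA: "finite A" by (simp add: A_def rsupp_def)
  have rs: "z \<in> rsupp g \<longleftrightarrow> (\<exists>i k. z = (real i, real k) \<and> coeff (coeff g k) i \<noteq> 0)" for z g
    by (auto simp: rsupp_def supp2_def)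
  have pos_eq: "affine_L n (real i, real k) = (real m / real N, real k)"
    if "int m = int N * (int n * (int n - 1) - int i - int n * int k)" for m i k
  proof -
    have "real_of_int (int m) = real_of_int (int N * (int n * (int n - 1) - int i - int n * int k))"
      by (simp only: that)
    then have m: "real m = real N * (real n * (real n - 1) - real i - real n * real k)" by simp
    have "real m / real N = real n * (real n - 1) - real i - real n * real k" unfolding m using N by simp
    then show ?thesis by (simp add: affine_L_def)
  qed
  have A_eq: "A = {(real m / real N, real k) | m k. fps_nth (coeff E k) m \<noteq> 0}"
  proof (intro equalityI subsetI)
    fix z assume "z \<in> A"
    then obtain i k where z: "z = affine_L n (real i, real k)" "coeff (coeff (D_infinity p) k) i \<noteq> 0"
      unfolding A_def by (auto simp: rs)
    obtain m where m: "fps_nth (coeff E k) m \<noteq> 0" "int m = int N * (int n * (int n - 1) - int i - int n * int k)"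
      using supp1[OF z(2)] by blast
    show "z \<in> {(real m / real N, real k) | m k. fps_nth (coeff E k) m \<noteq> 0}"
      unfolding z(1) pos_eq[OF m(2)] using m(1) by blast
  next
    fix z assume "z \<in> {(real m / real N, real k) | m k. fps_nth (coeff E k) m \<noteq> 0}"
    then obtain m k where z: "z = (real m / real N, real k)" "fps_nth (coeff E k) m \<noteq> 0" by blast
    obtain i where i: "coeff (coeff (D_infinity p) k) i \<noteq> 0" "int m = int N * (int n * (int n - 1) - int i - int n * int k)"
      using supp2[OF z(2)] by blast
    have "(real i, real k) \<in> rsupp (D_infinity p)" using i(1) unfolding rs by blast
    then have "affine_L n (real i, real k) \<in> A" unfolding A_def by (rule imageI)
    then show "z \<in> A" by (simp only: z(1) pos_eq[OF i(2)])
  qed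
  note cd = critical_diagram[OF fin rol N a0 E' A_eq finA]
  have Spos: "s > 0" if s: "s \<in># S" for s
  proof -
    obtain k where "k \<in># polar_ms Y G" "s = real k / real N" using s by (auto simp: S_def)
    then show ?thesis using polar_ms_pos[OF fin ne rol Y0, of k] N by simp
  qed
  have sizeG: "size G = n - 1" by (rule size_G[OF prems])
  have sizeS: "size S = n - 1" by (simp add: S_def polar_ms_def sizeG)
  have S0: "S \<noteq> {#}" using sizeS assms(2) by auto
  have phiA: "phi A \<tau> = (\<Sum>s\<in>#S. min s \<tau>)" if "\<tau> \<ge> 0" for \<tau>
    using cd(2)[OF that] unfolding S_def .
  have topA: "(0, real n - 1) \<in> A" using cd(3) n1 by (simp add: sizeG of_nat_diff)
  obtain x where x: "(x, 0) \<in> A" using cd(4) by blast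
  define \<tau>0 where "\<tau>0 = Min (set_mset S)"
  have \<tau>0: "\<tau>0 > 0" unfolding \<tau>0_def using S0 Spos by (subst Min_gr_iff) auto
  have phi0: "phi A \<tau>0 = \<tau>0 * (real n - 1)"
  proof -
    have "(\<Sum>s\<in>#S. min s \<tau>0) = (\<Sum>s\<in>#S. \<tau>0)"
      unfolding \<tau>0_def by (intro arg_cong[of _ _ sum_mset] image_mset_cong min_absorb2 Min_le) simp_all
    then show ?thesis using phiA[of \<tau>0] \<tau>0 n1 by (simp add: sizeS of_nat_diff)
  qed
  have NP: "affine_L n ` newton_polygon_at_infinity (D_infinity p) = newton_polygon_at_zero (nset A)"
    by (rule newton_polygon_at_infinity_image[OF assms(2) A_def cd(1) topA x \<tau>0 phi0])
  show ?thesis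
  proof
    assume "analytically_irreducible_at p Q"
    then obtain h b where hb: "merle_seq0 h b" "b 0 = n" "merle_ms h b = S" using irr by blast
    have h: "h \<ge> 1" using hb(3) S0 by (cases h) (auto simp: merle_ms_def)
    obtain B where B: "finite B" "B \<subseteq> quadrant" "\<exists>z\<in>B. snd z = 0" "merle_diagram h b = nset B"
      "\<And>\<tau>. phi B \<tau> = (\<Sum>s\<in>#merle_ms h b. min s \<tau>)"
      using merle_diagram_nset[OF hb(1) h] by blast
    obtain z where z: "z \<in> B" "snd z = 0" using B(3) by blast
    have "phi B \<tau> = phi A \<tau>" if "\<tau> \<ge> 0" for \<tau> using phiA[OF that] B(5)[of \<tau>] hb(3) by simp
    moreover have "nset A = {z \<in> quadrant. \<forall>\<tau>\<ge>0. phi A \<tau> \<le> fst z + \<tau> * snd z}"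
      by (rule nset_eq[OF finA cd(1) x]) simp
    moreover have "nset B = {z \<in> quadrant. \<forall>\<tau>\<ge>0. phi B \<tau> \<le> fst z + \<tau> * snd z}"
      by (rule nset_eq[OF B(1,2) z])
    ultimately have "nset A = merle_diagram h b" unfolding B(4) by simp
    moreover have "merle_type_diagram (merle_diagram h b)"
      unfolding merle_type_diagram_def merle_sequence_iff using hb(1) h by blast
    ultimately show "\<exists>\<Delta>. merle_type_diagram \<Delta> \<and>
        affine_L n ` newton_polygon_at_infinity (D_infinity p) = newton_polygon_at_zero \<Delta>"
      using NP by metis
  next
    assume "\<exists>\<Delta>. merle_type_diagram \<Delta> \<and>
        affine_L n ` newton_polygon_at_infinity (D_infinity p) = newton_polygon_at_zero \<Delta>"
    then obtain h b where hb: "merle_seq0 h b" "h \<ge> 1"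
      and eq: "newton_polygon_at_zero (nset A) = newton_polygon_at_zero (merle_diagram h b)"
      unfolding NP merle_type_diagram_def merle_sequence_iff by blast
    obtain B where B: "finite B" "B \<subseteq> quadrant" "\<exists>z\<in>B. snd z = 0" "merle_diagram h b = nset B"
      "\<And>\<tau>. phi B \<tau> = (\<Sum>s\<in>#merle_ms h b. min s \<tau>)"
      using merle_diagram_nset[OF hb] by blast
    have ms: "merle_ms h b \<noteq> {#}" using merle_ms_first[OF hb] by auto
    have Ane: "A \<noteq> {}" and Bne: "B \<noteq> {}" using x B(3) by auto
    have sums: "(\<Sum>s\<in>#S. min s \<tau>) = (\<Sum>s\<in>#merle_ms h b. min s \<tau>)" if \<tau>: "\<tau> > 0" for \<tau>
    proof -
      have pA: "phi A \<tau> > 0" using phiA[of \<tau>] sum_mset_min_pos[OF S0 Spos \<tau>] \<tau> by simp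
      have pB: "phi B \<tau> > 0" unfolding B(5) using sum_mset_min_pos[OF ms merle_ms_elem_pos[OF hb(1)] \<tau>] .
      note npA = newton_polygon_phi[OF finA cd(1) Ane \<tau> pA] and npB = newton_polygon_phi[OF B(1,2) Bne \<tau> pB]
      note eq' = eq[unfolded B(4)]
      have "phi A \<tau> \<le> phi B \<tau>" using npB(2) npA(1) eq' by fastforce
      moreover have "phi B \<tau> \<le> phi A \<tau>" using npA(2) npB(1) eq' by fastforce
      ultimately show ?thesis using phiA[of \<tau>] B(5)[of \<tau>] \<tau> by simp
    qed
    have S: "S = merle_ms h b"
    proof (rule mset_eq_of_sum_min)
      show "s > 0" if "s \<in># S + merle_ms h b" for s
        using that Spos merle_ms_elem_pos[OF hb(1)] by auto
    qed (rule sums)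
    have "b 0 = n" using size_merle_ms[OF hb(1)] sizeS assms(2) unfolding S by linarith
    then show "analytically_irreducible_at p Q" using irr hb(1) S by blast
  qed
qed

end
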